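(* Let $\mathcal L$ be a signed alphabet, $D$ a row-convex shape, and $\mathbf f=(f_p)_{p\in\mathcal P}$ a weakly increasing sequence of letters of $\mathcal L$ indexed by the column indices. Then the elements $\phi_{\mathbf f}([T])$, where $T$ runs over all flagged straight tableaux of shape $D$ with entries in $\mathcal L$, form a $\mathbb Z$-basis of the flagged super-Schur module $\mathcal S^D_{\mathbf f}(\mathcal L)$.
   Context: Signed alphabets. A signed alphabet $\mathcal L$ is a totally ordered set with a function $|\cdot|:\mathcal L\to\mathbb Z/2$; letters with $|a|=0$ are positive, letters with $|a|=1$ are negative. Write $a<_+b$ if $a<b$, or $a=b$ and $a$ is positive; write $a<_-b$ if $a<b$, or $a=b$ and $a$ is negative; $a>_{\pm}b$ means $b<_{\pm}a$. Shapes and tableaux. A shape is a finite set of cells $(i,j)$ (row $i$, counted from top; column $j$, counted from left; $i,j$ positive integers). A tableau $T$ of shape $D$ on $\mathcal L$ assigns a letter $T_{i,j}\in\mathcal L$ to each cell. $D$ is row-convex if $(r,i),(r,k)\in D$ and $i<j<k$ imply $(r,j)\in D$; the rows of a row-convex shape are always assumed sorted so that higher rows end at least as far to the right as lower rows. $T$ is row-standard if in each row the entries $<_+$-increase from left to right. For $i<j$, the cells $(i,k),(j,k)$ form an inversion if $T_{i,k}>_+T_{j,k}$; the inversion is flippable unless the cell $(i,k-1)$ exists in $D$ and $T_{i,k-1}>_-T_{j,k}$. A tableau of row-convex shape is straight if it is row-standard and has no flippable inversion. The elements $[T]$. Let $\mathcal P$ be a finite set of column indices (regarded as negative letters) containing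 all columns of $D$. The letterplace algebra $\mathcal A=\mathrm{Super}([\mathcal L|\mathcal P])$ is the free supercommutative $\mathbb Z$-algebra on symbols $(a|p)$, $a\in\mathcal L,p\in\mathcal P$, of sign $|a|+1\in \mathbb Z/2$: generators with $a$ negative are even (commuting polynomial variables), generators with $a$ positive are odd (they anticommute with each other and square to $0$, and commute with even ones). For a row with entries $w_1,\dots,w_k$ in columns $p_1<\dots<p_k$ put $$\mathrm{Tab}(w|p)=\frac1{\mathbf c(w)!}\sum_{\sigma\in S_k}(-1)^{n_\sigma}(w_{\sigma(1)}|p_1)\cdots(w_{\sigma(k)}|p_k),$$ where $\mathbf c(w)!=\prod_{a\text{ positive}}(\text{number of times } a \text{ occurs in } w)!$ and $n_\sigma=\#\{(i,j):i<j,\ \sigma^{-1}(i)>\sigma^{-1}(j),\ w_i,w_j\text{ negative}\}+\#\{(i,j): i>j,\ w_{\sigma(i)}\text{ negative}\}$ (this lies in $\mathcal A$). For a tableau $T$, $[T]\in\mathcal A$ is the product of $\mathrm{Tab}$ of its rows, taken from top to bottom. The super-Schur module $\mathcal S^D(\mathcal L)$ is the $\mathbb Z$-span of all $[T]$, $T$ a tableau of shape $D$ on $\mathcal L$. Flags. $\phi_{\mathbf f}$ is the quotient map of $\mathcal A$ that sets $(l|p)=0$ whenever $l>f_p$. The flagged super-Schur module is $\mathcal S^D_{\mathbf f}(\mathcal L)=\phi_{\mathbf f}(\mathcal S^D(\mathcal L))$. A tableau is flagged if, for each column $i$, no entry in column $i$ exceeds $f_i$. *)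

theory Defs
  imports
    "HOL-Algebra.QuotRing"
    "HOL-Combinatorics.Permutations"
    "HOL-Library.FuncSet"
    "HOL-Library.Poly_Mapping"
    "HOL-Library.Z2"
begin

text \<open>
  A signed alphabet is a linearly ordered type \<open>'a\<close> with a parity \<open>par :: 'a \<Rightarrow> bit\<close>;
  \<open>par a = 0\<close> means that the letter \<open>a\<close> is positive, \<open>par a = 1\<close> that it is negative.
\<close>

subsection \<open>The free supercommutative ring on a set of signed generators\<close>

datatype 'g fword = FWord (letters: "'g list")

instantiation fword :: (type) monoid_add
begin

definition zero_fword :: "'a fword" where "0 = FWord []"

definition plus_fword :: "'a fword \<Rightarrow> 'a fword \<Rightarrow> 'a fword" where
  "u + v = FWord (letters u @ letters v)"

instance
  by standard (simp_all add: zero_fword_def plus_fword_def)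

end

text \<open>
  Words get a type of their own so that they form a \<^class>\<open>monoid_add\<close> under concatenation:
  \<^typ>\<open>'g fword \<Rightarrow>\<^sub>0 int\<close> with the convolution product of \<^theory>\<open>HOL-Library.Poly_Mapping\<close> is then the free associative unital
  ring of noncommutative integer polynomials in the indeterminates \<open>'g\<close>.
\<close>

type_synonym 'g ncpoly = "'g fword \<Rightarrow>\<^sub>0 int"

definition fvar :: "'g \<Rightarrow> 'g ncpoly" where
  "fvar x = Poly_Mapping.single (FWord [x]) 1"

definition free_ring :: "'g set \<Rightarrow> 'g ncpoly ring" where
  "free_ring X =
     \<lparr>carrier = {q. \<forall>u \<in> Poly_Mapping.keys q. set (letters u) \<subseteq> X},
      monoid.mult = (*), one = 1, zero = 0, add = (+)\<rparr>"

definition super_relations :: "'g set \<Rightarrow> ('g \<Rightarrow> bit) \<Rightarrow> 'g ncpoly set" where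
  "super_relations X s =
     {fvar x * fvar y - fvar y * fvar x | x y. x \<in> X \<and> y \<in> X \<and> (s x = 0 \<or> s y = 0)} \<union>
     {fvar x * fvar y + fvar y * fvar x | x y. x \<in> X \<and> y \<in> X \<and> s x = 1 \<and> s y = 1} \<union>
     {fvar x * fvar x | x. x \<in> X \<and> s x = 1}"

definition super_ideal :: "'g set \<Rightarrow> ('g \<Rightarrow> bit) \<Rightarrow> 'g ncpoly set" where
  "super_ideal X s = Idl\<^bsub>free_ring X\<^esub> (super_relations X s)"

definition free_super_ring :: "'g set \<Rightarrow> ('g \<Rightarrow> bit) \<Rightarrow> 'g ncpoly set ring" where
  "free_super_ring X s = free_ring X Quot super_ideal X s"

definition super_class :: "'g set \<Rightarrow> ('g \<Rightarrow> bit) \<Rightarrow> 'g ncpoly \<Rightarrow> 'g ncpoly set" where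
  "super_class X s q = super_ideal X s +>\<^bsub>free_ring X\<^esub> q"

lemma free_ring_is_ring: "ring (free_ring X)"
proof -
  define C where "C = {q :: 'a ncpoly. \<forall>u \<in> Poly_Mapping.keys q. set (letters u) \<subseteq> X}"
  have add: "p + q \<in> C" if "p \<in> C" "q \<in> C" for p q
    using that keys_add[of p q] unfolding C_def by blast
  have neg: "- p \<in> C" if "p \<in> C" for p
    using that by (simp add: C_def)
  have mult: "p * q \<in> C" if "p \<in> C" "q \<in> C" for p q
  proof -
    have "set (letters u) \<subseteq> X" if u: "u \<in> Poly_Mapping.keys (p * q)" for u
    proof -
      obtain a b where "u = a + b" "a \<in> Poly_Mapping.keys p" "b \<in> Poly_Mapping.keys q"
        using subsetD[OF keys_mult u] by blast
      then show ?thesis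
        using \<open>p \<in> C\<close> \<open>q \<in> C\<close> by (auto simp: plus_fword_def C_def)
    qed
    then show ?thesis unfolding C_def by blast
  qed
  have one: "1 \<in> C"
    by (auto simp: C_def keys_def one_poly_mapping.rep_eq zero_fword_def when_def split: if_splits)
  have R: "carrier (free_ring X) = C" "x \<oplus>\<^bsub>free_ring X\<^esub> y = x + y" "x \<otimes>\<^bsub>free_ring X\<^esub> y = x * y"
    "\<zero>\<^bsub>free_ring X\<^esub> = 0" "\<one>\<^bsub>free_ring X\<^esub> = 1" for x y
    by (simp_all add: free_ring_def C_def)
  have zero: "0 \<in> C" by (simp add: C_def)
  show ?thesis
  proof (rule ringI)
    show "abelian_group (free_ring X)"
    proof (rule abelian_groupI)
      fix x assume "x \<in> carrier (free_ring X)"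
      then have "- x \<in> C" "- x + x = 0"
        using neg by (simp_all add: R)
      then show "\<exists>y\<in>carrier (free_ring X). y \<oplus>\<^bsub>free_ring X\<^esub> x = \<zero>\<^bsub>free_ring X\<^esub>"
        unfolding R by blast
    qed (simp_all add: R add zero ac_simps)
    show "monoid (free_ring X)"
      by (rule monoidI) (simp_all add: R mult one mult.assoc)
  qed (simp_all add: R distrib_left distrib_right)
qed


subsection \<open>Shapes and tableaux\<close>

definition pos_less :: "('a::linorder \<Rightarrow> bit) \<Rightarrow> 'a \<Rightarrow> 'a \<Rightarrow> bool" where
  "pos_less par a b \<longleftrightarrow> a < b \<or> (a = b \<and> par a = 0)"

definition neg_less :: "('a::linorder \<Rightarrow> bit) \<Rightarrow> 'a \<Rightarrow> 'a \<Rightarrow> bool" where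
  "neg_less par a b \<longleftrightarrow> a < b \<or> (a = b \<and> par a = 1)"

text \<open>A cell is a pair (row, column), both numbered from 1.\<close>

definition is_shape :: "(nat \<times> nat) set \<Rightarrow> bool" where
  "is_shape D \<longleftrightarrow> finite D \<and> (\<forall>(i, j) \<in> D. 1 \<le> i \<and> 1 \<le> j)"

definition row_columns :: "(nat \<times> nat) set \<Rightarrow> nat \<Rightarrow> nat set" where
  "row_columns D r = {j. (r, j) \<in> D}"

text \<open>
  The sorting convention on rows is part of row-convexity; it constrains nonempty rows only,
  since an empty row has no end.
\<close>

definition row_convex :: "(nat \<times> nat) set \<Rightarrow> bool" where
  "row_convex D \<longleftrightarrow>
     (\<forall>r i j k. (r, i) \<in> D \<and> (r, k) \<in> D \<and> i < j \<and> j < k \<longrightarrow> (r, j) \<in> D) \<and>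
     (\<forall>r s. r < s \<and> row_columns D r \<noteq> {} \<and> row_columns D s \<noteq> {} \<longrightarrow>
        Max (row_columns D s) \<le> Max (row_columns D r))"

text \<open>Extensional functions, so that a tableau is determined by its entries on \<open>D\<close>.\<close>

definition tableaux :: "(nat \<times> nat) set \<Rightarrow> (nat \<times> nat \<Rightarrow> 'a) set" where
  "tableaux D = D \<rightarrow>\<^sub>E UNIV"

definition row_standard ::
    "('a::linorder \<Rightarrow> bit) \<Rightarrow> (nat \<times> nat) set \<Rightarrow> (nat \<times> nat \<Rightarrow> 'a) \<Rightarrow> bool" where
  "row_standard par D T \<longleftrightarrow>
     (\<forall>r j k. (r, j) \<in> D \<and> (r, k) \<in> D \<and> j < k \<longrightarrow> pos_less par (T (r, j)) (T (r, k)))"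

definition inversion ::
    "('a::linorder \<Rightarrow> bit) \<Rightarrow> (nat \<times> nat) set \<Rightarrow> (nat \<times> nat \<Rightarrow> 'a) \<Rightarrow> nat \<Rightarrow> nat \<Rightarrow> nat \<Rightarrow> bool" where
  "inversion par D T i j k \<longleftrightarrow>
     i < j \<and> (i, k) \<in> D \<and> (j, k) \<in> D \<and> pos_less par (T (j, k)) (T (i, k))"

text \<open>For \<open>k = 1\<close> the cell \<open>(i, k - 1)\<close> has column 0 and so is never in a shape.\<close>

definition flippable ::
    "('a::linorder \<Rightarrow> bit) \<Rightarrow> (nat \<times> nat) set \<Rightarrow> (nat \<times> nat \<Rightarrow> 'a) \<Rightarrow> nat \<Rightarrow> nat \<Rightarrow> nat \<Rightarrow> bool" where
  "flippable par D T i j k \<longleftrightarrow>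
     \<not> ((i, k - 1) \<in> D \<and> neg_less par (T (j, k)) (T (i, k - 1)))"

definition straight ::
    "('a::linorder \<Rightarrow> bit) \<Rightarrow> (nat \<times> nat) set \<Rightarrow> (nat \<times> nat \<Rightarrow> 'a) \<Rightarrow> bool" where
  "straight par D T \<longleftrightarrow>
     row_standard par D T \<and>
     \<not> (\<exists>i j k. inversion par D T i j k \<and> flippable par D T i j k)"

definition flagged ::
    "(nat \<Rightarrow> 'a::linorder) \<Rightarrow> (nat \<times> nat) set \<Rightarrow> (nat \<times> nat \<Rightarrow> 'a) \<Rightarrow> bool" where
  "flagged f D T \<longleftrightarrow> (\<forall>(r, j) \<in> D. T (r, j) \<le> f j)"


subsection \<open>The letterplace algebra and the elements of tableaux\<close>

text \<open>The pair \<open>(a, p)\<close> stands for the symbol \<open>(a|p)\<close>; places are negative, whence the shift by 1.\<close>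

definition lp_sign :: "('a \<Rightarrow> bit) \<Rightarrow> 'a \<times> nat \<Rightarrow> bit" where
  "lp_sign par = (\<lambda>(a, p). par a + 1)"

definition letterplace :: "('a \<Rightarrow> bit) \<Rightarrow> nat set \<Rightarrow> ('a \<times> nat) ncpoly set ring" where
  "letterplace par P = free_super_ring (UNIV \<times> P) (lp_sign par)"

definition lp_class :: "('a \<Rightarrow> bit) \<Rightarrow> nat set \<Rightarrow> ('a \<times> nat) ncpoly \<Rightarrow> ('a \<times> nat) ncpoly set" where
  "lp_class par P = super_class (UNIV \<times> P) (lp_sign par)"

definition content_fact :: "('a \<Rightarrow> bit) \<Rightarrow> 'a list \<Rightarrow> nat" where
  "content_fact par w = (\<Prod>a \<in> {a \<in> set w. par a = 0}. fact (count_list w a))"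

text \<open>Positions in \<open>w\<close> and \<open>p\<close> are numbered from 0, so \<open>\<sigma>\<close> permutes \<open>{..<length w}\<close>.\<close>

definition tab_sign_exp :: "('a \<Rightarrow> bit) \<Rightarrow> 'a list \<Rightarrow> (nat \<Rightarrow> nat) \<Rightarrow> nat" where
  "tab_sign_exp par w \<sigma> =
     card {(i, j). i < length w \<and> j < length w \<and> i < j \<and>
             inv_into UNIV \<sigma> i > inv_into UNIV \<sigma> j \<and> par (w ! i) = 1 \<and> par (w ! j) = 1} +
     card {(i, j). i < length w \<and> j < length w \<and> i > j \<and> par (w ! \<sigma> i) = 1}"

definition tab_sum :: "('a \<Rightarrow> bit) \<Rightarrow> 'a list \<Rightarrow> nat list \<Rightarrow> ('a \<times> nat) ncpoly" where
  "tab_sum par w p =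
     (\<Sum>\<sigma> | \<sigma> permutes {..<length w}.
        (-1) ^ tab_sign_exp par w \<sigma> *
        prod_list (map (\<lambda>i. fvar (w ! \<sigma> i, p ! i)) [0..<length w]))"

text \<open>
  The division by \<open>content_fact\<close> is already exact for the noncommutative polynomial
  \<open>tab_sum\<close> (lemma \<open>content_fact_times_tab_poly\<close> below), so it is carried out there,
  coefficient by coefficient, before passing to the supercommutative quotient.
\<close>

definition tab_poly :: "('a \<Rightarrow> bit) \<Rightarrow> 'a list \<Rightarrow> nat list \<Rightarrow> ('a \<times> nat) ncpoly" where
  "tab_poly par w p =
     Poly_Mapping.map (\<lambda>c. c div int (content_fact par w)) (tab_sum par w p)"

definition tab :: "('a \<Rightarrow> bit) \<Rightarrow> nat set \<Rightarrow> 'a list \<Rightarrow> nat list \<Rightarrow> ('a \<times> nat) ncpoly set" where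
  "tab par P w p = lp_class par P (tab_poly par w p)"

definition row_tab ::
    "('a \<Rightarrow> bit) \<Rightarrow> nat set \<Rightarrow> (nat \<times> nat) set \<Rightarrow> (nat \<times> nat \<Rightarrow> 'a) \<Rightarrow> nat \<Rightarrow> ('a \<times> nat) ncpoly set" where
  "row_tab par P D T r =
     (let p = sorted_list_of_set (row_columns D r) in tab par P (map (\<lambda>j. T (r, j)) p) p)"

definition tableau_element ::
    "('a \<Rightarrow> bit) \<Rightarrow> nat set \<Rightarrow> (nat \<times> nat) set \<Rightarrow> (nat \<times> nat \<Rightarrow> 'a) \<Rightarrow> ('a \<times> nat) ncpoly set" where
  "tableau_element par P D T =
     foldr (\<lambda>r x. row_tab par P D T r \<otimes>\<^bsub>letterplace par P\<^esub> x)
       (sorted_list_of_set (fst ` D)) \<one>\<^bsub>letterplace par P\<^esub>"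


subsection \<open>Integral spans and bases in an abelian group\<close>

definition int_combination :: "('b, 'm) ring_scheme \<Rightarrow> 'i set \<Rightarrow> ('i \<Rightarrow> 'b) \<Rightarrow> ('i \<Rightarrow> int) \<Rightarrow> 'b" where
  "int_combination G I b c = (\<Oplus>\<^bsub>G\<^esub>i \<in> {i \<in> I. c i \<noteq> 0}. [c i] \<cdot>\<^bsub>G\<^esub> b i)"

definition int_span :: "('b, 'm) ring_scheme \<Rightarrow> 'i set \<Rightarrow> ('i \<Rightarrow> 'b) \<Rightarrow> 'b set" where
  "int_span G I b = {int_combination G I b c | c. finite {i \<in> I. c i \<noteq> 0}}"

definition int_independent :: "('b, 'm) ring_scheme \<Rightarrow> 'i set \<Rightarrow> ('i \<Rightarrow> 'b) \<Rightarrow> bool" where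
  "int_independent G I b \<longleftrightarrow>
     (\<forall>c. finite {i \<in> I. c i \<noteq> 0} \<and> int_combination G I b c = \<zero>\<^bsub>G\<^esub> \<longrightarrow> (\<forall>i \<in> I. c i = 0))"

definition int_basis :: "('b, 'm) ring_scheme \<Rightarrow> 'i set \<Rightarrow> ('i \<Rightarrow> 'b) \<Rightarrow> 'b set \<Rightarrow> bool" where
  "int_basis G I b M \<longleftrightarrow> int_independent G I b \<and> int_span G I b = M"


subsection \<open>Super-Schur modules and flags\<close>

definition super_schur ::
    "('a \<Rightarrow> bit) \<Rightarrow> nat set \<Rightarrow> (nat \<times> nat) set \<Rightarrow> ('a \<times> nat) ncpoly set set" where
  "super_schur par P D = int_span (letterplace par P) (tableaux D) (tableau_element par P D)"

definition flag_ideal ::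
    "('a::linorder \<Rightarrow> bit) \<Rightarrow> nat set \<Rightarrow> (nat \<Rightarrow> 'a) \<Rightarrow> ('a \<times> nat) ncpoly set set" where
  "flag_ideal par P f =
     Idl\<^bsub>letterplace par P\<^esub> {lp_class par P (fvar (l, p)) | l p. p \<in> P \<and> l > f p}"

definition flag_ring ::
    "('a::linorder \<Rightarrow> bit) \<Rightarrow> nat set \<Rightarrow> (nat \<Rightarrow> 'a) \<Rightarrow> ('a \<times> nat) ncpoly set set ring" where
  "flag_ring par P f = letterplace par P Quot flag_ideal par P f"

definition flag_map ::
    "('a::linorder \<Rightarrow> bit) \<Rightarrow> nat set \<Rightarrow> (nat \<Rightarrow> 'a) \<Rightarrow> ('a \<times> nat) ncpoly set \<Rightarrow>
     ('a \<times> nat) ncpoly set set" where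
  "flag_map par P f x = flag_ideal par P f +>\<^bsub>letterplace par P\<^esub> x"

definition flagged_super_schur ::
    "('a::linorder \<Rightarrow> bit) \<Rightarrow> nat set \<Rightarrow> (nat \<Rightarrow> 'a) \<Rightarrow> (nat \<times> nat) set \<Rightarrow>
     ('a \<times> nat) ncpoly set set set" where
  "flagged_super_schur par P f D = flag_map par P f ` super_schur par P D"


subsection \<open>Exactness of the division in \<open>tab_poly\<close>\<close>

text \<open>
  The permutations that only move positions of equal positive letters form a group of order
  \<open>content_fact par w\<close>, and composing \<open>\<sigma>\<close> with one of them does not change its summand.
\<close>

definition stab :: "('a \<Rightarrow> bit) \<Rightarrow> 'a list \<Rightarrow> (nat \<Rightarrow> nat) set" where
  "stab par w = {\<tau>. \<tau> permutes {..<length w} \<and> (\<forall>i<length w. w ! \<tau> i = w ! i) \<and>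
                    (\<forall>i<length w. par (w ! i) = 1 \<longrightarrow> \<tau> i = i)}"

lemma stab_comp: "\<sigma> \<in> stab par w \<Longrightarrow> \<tau> \<in> stab par w \<Longrightarrow> \<sigma> \<circ> \<tau> \<in> stab par w"
  unfolding stab_def by (auto simp: permutes_compose) (metis lessThan_iff permutes_in_image)+

lemma stab_inv: 
  assumes "\<tau> \<in> stab par w" shows "inv_into UNIV \<tau> \<in> stab par w"
proof -
  from assms have p: "\<tau> permutes {..<length w}" by (simp add: stab_def)
  have q: "inv_into UNIV \<tau> i < length w" if "i < length w" for i
    using permutes_in_image[OF permutes_inv[OF p], of i] that by simp
  have r: "\<tau> (inv_into UNIV \<tau> i) = i" for i using permutes_inverses(1)[OF p] .
  have "w ! inv_into UNIV \<tau> i = w ! i" if "i < length w" for i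
    using assms q[OF that] r[of i] by (simp add: stab_def) metis
  moreover have "inv_into UNIV \<tau> i = i" if "i < length w" "par (w ! i) = 1" for i
    using assms that permutes_inverses(2)[OF p, of i] by (simp add: stab_def)
  ultimately show ?thesis using permutes_inv[OF p] by (simp add: stab_def)
qed

lemma id_stab: "id \<in> stab par w"
  by (simp add: stab_def permutes_id)

lemma finite_stab: "finite (stab par w)"
  by (rule finite_subset[OF _ finite_permutations[of "{..<length w}"]]) (auto simp: stab_def)

lemma card_stab: "card (stab par w) = content_fact par w"
proof -
  define A where "A = {a \<in> set w. par a = 0}"
  define B where "B a = {i. i < length w \<and> w ! i = a}" for a
  define Q where "Q = (PiE A (\<lambda>a. {\<tau>. \<tau> permutes B a}))"
  define h where "h g i = (if i < length w \<and> par (w ! i) = 0 then g (w ! i) i else i)"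
    for g :: "'a \<Rightarrow> nat \<Rightarrow> nat" and i
  define h' where "h' \<tau> = (\<lambda>a\<in>A. \<lambda>i. if i \<in> B a then \<tau> i else i)" for \<tau> :: "nat \<Rightarrow> nat"
  have finB: "finite (B a)" for a by (simp add: B_def)
  have inA: "w ! i \<in> A" if "i < length w" "par (w ! i) = 0" for i
    using that by (simp add: A_def)
  have gB: "g a i \<in> B a" if "g \<in> Q" "a \<in> A" "i \<in> B a" for g a i
  proof -
    have "g a permutes B a" using that by (auto simp: Q_def)
    then show ?thesis using that(3) by (simp add: permutes_in_image)
  qed
  have "bij_betw h Q (stab par w)"
  proof (rule bij_betw_byWitness[where f' = h'])
    show "\<forall>g\<in>Q. h' (h g) = g"
    proof
      fix g assume g: "g \<in> Q"
      show "h' (h g) = g"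
      proof (rule PiE_ext[of _ A "\<lambda>_. UNIV"])
        show "g \<in> A \<rightarrow>\<^sub>E UNIV" using g by (auto simp: Q_def PiE_iff)
        show "h' (h g) \<in> A \<rightarrow>\<^sub>E UNIV" by (simp add: h'_def)
        fix a assume a: "a \<in> A"
        have "g a permutes B a" using g a by (auto simp: Q_def)
        then have "g a i = i" if "i \<notin> B a" for i using that by (simp add: permutes_not_in)
        then show "h' (h g) a = g a" using a by (auto simp: h'_def h_def B_def A_def fun_eq_iff)
      qed
    qed
    show "\<forall>\<tau>\<in>stab par w. h (h' \<tau>) = \<tau>"
    proof
      fix \<tau> assume t: "\<tau> \<in> stab par w"
      have "h (h' \<tau>) i = \<tau> i" for i
      proof (cases "i < length w \<and> par (w ! i) = 0")
        case True
        then show ?thesis using inA[of i] by (simp add: h_def h'_def B_def)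
      next
        case False
        then have "\<tau> i = i"
          using t permutes_not_in[of \<tau> "{..<length w}" i] by (auto simp: stab_def)
        with False show ?thesis unfolding h_def by presburger
      qed
      then show "h (h' \<tau>) = \<tau>" ..
    qed
    show "h ` Q \<subseteq> stab par w"
    proof
      fix \<tau> assume "\<tau> \<in> h ` Q"
      then obtain g where g: "g \<in> Q" and \<tau>: "\<tau> = h g" by blast
      have val: "h g i < length w \<and> w ! h g i = w ! i" if "i < length w" for i
        using gB[OF g inA, of i i] that by (auto simp: h_def B_def)
      have "inj_on (h g) {..<length w}"
      proof (rule inj_onI)
        fix i j assume ij: "i \<in> {..<length w}" "j \<in> {..<length w}" "h g i = h g j"
        then have e: "w ! i = w ! j" using val[of i] val[of j] by simp
        show "i = j"
        proof (cases "par (w ! i) = 0")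
          case True
          then have "g (w ! i) permutes B (w ! i)"
            using g inA[of i] ij by (auto simp: Q_def)
          then have "inj (g (w ! i))" by (rule permutes_inj)
          then show ?thesis using ij e True by (auto simp: h_def dest: injD)
        next
          case False
          then show ?thesis using ij e by (simp add: h_def)
        qed
      qed
      moreover have "h g ` {..<length w} \<subseteq> {..<length w}" using val by auto
      ultimately have "bij_betw (h g) {..<length w} {..<length w}"
        by (simp add: bij_betw_def endo_inj_surj)
      then have "h g permutes {..<length w}"
        by (rule bij_imp_permutes) (simp add: h_def)
      then show "\<tau> \<in> stab par w"
        using val by (auto simp: \<tau> stab_def h_def)
    qed
    show "h' ` stab par w \<subseteq> Q"
    proof
      fix g assume "g \<in> h' ` stab par w"
      then obtain \<tau> where t: "\<tau> \<in> stab par w" and g: "g = h' \<tau>" by blast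
      have "(\<lambda>i. if i \<in> B a then \<tau> i else i) permutes B a" for a
      proof (rule bij_imp_permutes)
        have inj: "inj_on (\<lambda>i. if i \<in> B a then \<tau> i else i) (B a)"
          using t by (auto simp: stab_def inj_on_def dest: permutes_inj injD)
        have "\<tau> i \<in> B a" if "i \<in> B a" for i
          using t that permutes_in_image[of \<tau> "{..<length w}" i] by (auto simp: stab_def B_def)
        then have "(\<lambda>i. if i \<in> B a then \<tau> i else i) ` B a \<subseteq> B a" by auto
        with inj show "bij_betw (\<lambda>i. if i \<in> B a then \<tau> i else i) (B a) (B a)"
          unfolding bij_betw_def by (metis endo_inj_surj finB)
      qed simp
      then show "g \<in> Q" by (simp add: g Q_def h'_def)
    qed
  qed
  then have "card (stab par w) = card Q" by (simp add: bij_betw_same_card)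
  also have "\<dots> = (\<Prod>a\<in>A. card {\<tau>. \<tau> permutes B a})"
    unfolding Q_def by (rule card_PiE) (simp add: A_def)
  also have "\<dots> = (\<Prod>a\<in>A. fact (count_list w a))"
    by (intro prod.cong refl card_permutations finB)
      (simp add: B_def count_list_eq_length_filter length_filter_conv_card eq_commute)
  finally show ?thesis by (simp add: content_fact_def A_def)
qed

lemma stab_invariant_sum:
  fixes g :: "(nat \<Rightarrow> nat) \<Rightarrow> int"
  assumes "finite S" and "S \<subseteq> {\<sigma>. bij \<sigma>}"
    and "\<And>\<sigma> \<tau>. \<sigma> \<in> S \<Longrightarrow> \<tau> \<in> stab par w \<Longrightarrow> \<tau> \<circ> \<sigma> \<in> S \<and> g (\<tau> \<circ> \<sigma>) = g \<sigma>"
  shows "int (content_fact par w) dvd sum g S"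
  using assms
proof (induction S rule: finite_psubset_induct)
  case (psubset S)
  show ?case
  proof (cases "S = {}")
    case False
    then obtain \<sigma> where \<sigma>: "\<sigma> \<in> S" by blast
    define Orb where "Orb = (\<lambda>\<tau>. \<tau> \<circ> \<sigma>) ` stab par w"
    have bij: "bij \<sigma>" using \<sigma> psubset.prems by blast
    have OS: "Orb \<subseteq> S"
      unfolding Orb_def by (rule image_subsetI) (rule psubset.prems(2)[OF \<sigma>, THEN conjunct1])
    have "\<sigma> \<in> Orb" unfolding Orb_def by (rule image_eqI[of _ _ id]) (simp_all add: id_stab)
    then have less: "S - Orb \<subset> S" using \<sigma> by blast
    have inj: "inj_on (\<lambda>\<tau>. \<tau> \<circ> \<sigma>) (stab par w)"
      by (rule inj_onI) (metis bij bij_is_surj fun.map_comp surj_iff comp_id o_assoc)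
    have "sum g Orb = (\<Sum>\<tau>\<in>stab par w. g \<sigma>)"
      unfolding Orb_def sum.reindex[OF inj]
      by (intro sum.cong refl, unfold comp_apply[of g])
        (rule psubset.prems(2)[OF \<sigma>, THEN conjunct2])
    then have 1: "int (content_fact par w) dvd sum g Orb" by (simp add: card_stab)
    have "\<tau> \<circ> \<rho> \<notin> Orb" if "\<rho> \<in> S - Orb" "\<tau> \<in> stab par w" for \<rho> \<tau>
    proof
      assume "\<tau> \<circ> \<rho> \<in> Orb"
      then obtain \<tau>' where t': "\<tau>' \<in> stab par w" "\<tau> \<circ> \<rho> = \<tau>' \<circ> \<sigma>" by (auto simp: Orb_def)
      have "\<tau> permutes {..<length w}" using that by (simp add: stab_def)
      then have "inv_into UNIV \<tau> \<circ> \<tau> = id" by (rule permutes_inv_o(2))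
      then have "\<rho> = (inv_into UNIV \<tau> \<circ> \<tau>') \<circ> \<sigma>"
        using t'(2) by (metis comp_assoc id_comp)
      then have "\<rho> \<in> Orb" using stab_comp[OF stab_inv[OF that(2)] t'(1)] by (auto simp: Orb_def)
      with that show False by blast
    qed
    then have "int (content_fact par w) dvd sum g (S - Orb)"
      using psubset.prems by (intro psubset.IH[OF less]) blast+
    with 1 have "int (content_fact par w) dvd sum g (S - Orb) + sum g Orb" by (rule dvd_add[rotated])
    then show ?thesis using sum.subset_diff[OF OS psubset.hyps(1), of g] by simp
  qed simp
qed

lemma tab_sign_exp_stab:
  assumes "\<sigma> permutes {..<length w}" "\<tau> \<in> stab par w"
  shows "tab_sign_exp par w (\<tau> \<circ> \<sigma>) = tab_sign_exp par w \<sigma>"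
proof -
  have t: "\<tau> permutes {..<length w}" using assms by (simp add: stab_def)
  have i: "inv_into UNIV (\<tau> \<circ> \<sigma>) i = inv_into UNIV \<sigma> i"
    if "i < length w" "par (w ! i) = 1" for i
  proof -
    have "inv_into UNIV \<tau> i = i" using stab_inv[OF assms(2)] that by (simp add: stab_def)
    then show ?thesis
      using o_inv_distrib[OF permutes_bij[OF t] permutes_bij[OF assms(1)]] by simp
  qed
  have s: "w ! \<tau> (\<sigma> i) = w ! \<sigma> i" if "i < length w" for i
    using assms that permutes_in_image[OF assms(1), of i] by (simp add: stab_def)
  show ?thesis
    unfolding tab_sign_exp_def
    by (intro arg_cong2[where f = "(+)"] arg_cong[where f = card]) (auto simp: i s)
qed

lemma prod_list_fvar:
  "prod_list (map (\<lambda>i. fvar (k i)) is) = Poly_Mapping.single (FWord (map k is)) 1"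
  by (induction "is")
    (simp_all add: fvar_def mult_single plus_fword_def flip: zero_fword_def)

lemma minus_one_power_times_single:
  "(-1) ^ n * Poly_Mapping.single u (1::int) = Poly_Mapping.single u ((-1) ^ n)"
  by (induction n) (simp_all flip: single_uminus)

lemma content_fact_dvd_tab_sum:
  "int (content_fact par w) dvd Poly_Mapping.lookup (tab_sum par w p) u"
proof -
  define g :: "(nat \<Rightarrow> nat) \<Rightarrow> int" where
    "g \<sigma> = Poly_Mapping.lookup (Poly_Mapping.single
       (FWord (map (\<lambda>i. (w ! \<sigma> i, p ! i)) [0..<length w])) ((-1) ^ tab_sign_exp par w \<sigma>)) u" for \<sigma>
  have "Poly_Mapping.lookup (tab_sum par w p) u = sum g {\<sigma>. \<sigma> permutes {..<length w}}"
    unfolding tab_sum_def prod_list_fvar minus_one_power_times_single g_def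
    by (rule lookup_sum)
  moreover have "int (content_fact par w) dvd sum g {\<sigma>. \<sigma> permutes {..<length w}}"
  proof (rule stab_invariant_sum)
    fix \<sigma> \<tau>
    assume a: "\<sigma> \<in> {\<sigma>. \<sigma> permutes {..<length w}}" "\<tau> \<in> stab par w"
    then have "w ! \<tau> (\<sigma> i) = w ! \<sigma> i" if "i < length w" for i
      using that permutes_in_image[of \<sigma> "{..<length w}" i] by (simp add: stab_def)
    then have "map (\<lambda>i. (w ! (\<tau> \<circ> \<sigma>) i, p ! i)) [0..<length w] =
        map (\<lambda>i. (w ! \<sigma> i, p ! i)) [0..<length w]" by simp
    moreover have "tab_sign_exp par w (\<tau> \<circ> \<sigma>) = tab_sign_exp par w \<sigma>"
      using a by (intro tab_sign_exp_stab) auto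
    ultimately have "g (\<tau> \<circ> \<sigma>) = g \<sigma>" unfolding g_def by presburger
    then show "\<tau> \<circ> \<sigma> \<in> {\<sigma>. \<sigma> permutes {..<length w}} \<and> g (\<tau> \<circ> \<sigma>) = g \<sigma>"
      using a by (auto simp: stab_def intro: permutes_compose)
  qed (auto simp: finite_permutations permutes_bij)
  ultimately show ?thesis by simp
qed

lemma content_fact_times_tab_poly:
  "of_nat (content_fact par w) * tab_poly par w p = tab_sum par w p"
proof (rule poly_mapping_eqI)
  fix u
  have "Poly_Mapping.lookup (of_nat n * q) u = int n * Poly_Mapping.lookup q u"
    for n and q :: "('a \<times> nat) ncpoly"
    by (induction n) (simp_all add: algebra_simps lookup_add)
  then show "Poly_Mapping.lookup (of_nat (content_fact par w) * tab_poly par w p) u =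
      Poly_Mapping.lookup (tab_sum par w p) u"
    using content_fact_dvd_tab_sum[of par w p u]
    by (auto simp: tab_poly_def Poly_Mapping.map.rep_eq when_def)
qed

end

theory Submission
  imports Defs "HOL-Library.Product_Lexorder"
begin

text \<open>
  Up to signs, an element of the letterplace algebra is determined by its coefficients at
  supercommutative monomials, so everything is done with the coefficient functional on
  noncommutative polynomials. Independence: with weights that favour small letters in small columns,
  the monomial of the column contents of a row-standard tableau is its leading monomial, with
  coefficient a unit, and a straight tableau is determined by its column contents. Spanning: antisymmetry
  in the places gives two-row Garnir relations, and these, applied with rational coefficients to a
  flippable inversion, decrease a lexicographic measure of the pair of rows; several rows are
  straightened two at a time. Unit leading coefficients make the rational expansion integral. Finally,
  because the flag increases weakly, every monomial of an unflagged row-standard tableau contains a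
  vanishing generator, while the leading monomial of a flagged tableau survives.
\<close>

subsection \<open>Signs of permutations as products over pairs\<close>

text \<open>Signs are tamed by one observation: with the letters of a row kept in a fixed order,
  \<open>Tab\<close> is, up to a global sign, the antisymmetrization over its places, whatever the
  parities of the letters. Two rows thus become a signed sum over placements of labelled letters,
  and cancellation needs no more than two free labels in the same column. The obstacle is the
  position of the lower row. The usual exchange at an inversion frees the upper cells from its
  column rightwards and the lower cells up to it. If the lower row starts \<open>a\<close> columns
  further right than the upper one, these are \<open>n1 + 1 - a\<close> labels against
  \<open>n1\<close> columns, so for \<open>a > 0\<close> nothing is forced to cancel. Such pairs
  need relations that also force labels down. Which labels to exchange is found by comparing, for
  each letter \<open>d\<close>, the columns where the entries above \<open>d\<close> start in the
  two sorted rows; \<open>height\<close> is the difference of these starts. Rational coefficients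
  enter because equal letters carry different labels: terms of a relation coincide with
  multiplicity, and factorials appear.\<close>

definition pairs_below :: "nat \<Rightarrow> (nat \<times> nat) set" where
  "pairs_below n = {(i, j). i < j \<and> j < n}"

text \<open>The signs of sorting a word, of the exponent in a row, and of a permutation are all
  brought into this form, so that they can be compared factor by factor.\<close>

definition pair_prod :: "nat \<Rightarrow> (nat \<Rightarrow> nat \<Rightarrow> int) \<Rightarrow> int" where
  "pair_prod n \<psi> = (\<Prod>(i, j) \<in> pairs_below n. \<psi> i j)"

lemma finite_pairs_below [simp]: "finite (pairs_below n)"
  by (rule finite_subset[of _ "{..<n} \<times> {..<n}"]) (auto simp: pairs_below_def)

lemma pair_prod_cong:
  assumes "\<And>i j. i < j \<Longrightarrow> j < n \<Longrightarrow> \<psi> i j = \<psi>' i j"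
  shows "pair_prod n \<psi> = pair_prod n \<psi>'"
  unfolding pair_prod_def by (rule prod.cong) (auto simp: pairs_below_def assms)

lemma pair_prod_mult: "pair_prod n (\<lambda>i j. \<psi> i j * \<psi>' i j) = pair_prod n \<psi> * pair_prod n \<psi>'"
  unfolding pair_prod_def by (simp add: case_prod_unfold prod.distrib)

lemma pair_prod_Suc: "pair_prod (Suc n) \<psi> = pair_prod n \<psi> * (\<Prod>i<n. \<psi> i n)"
proof -
  have "pairs_below (Suc n) = pairs_below n \<union> (\<lambda>i. (i, n)) ` {..<n}"
    by (auto simp: pairs_below_def less_Suc_eq)
  moreover have "pairs_below n \<inter> (\<lambda>i. (i, n)) ` {..<n} = {}"
    by (auto simp: pairs_below_def)
  moreover have "(\<Prod>(i, j) \<in> (\<lambda>i. (i, n)) ` {..<n}. \<psi> i j) = (\<Prod>i<n. \<psi> i n)"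
    by (subst prod.reindex) (auto simp: inj_on_def)
  ultimately show ?thesis by (simp add: pair_prod_def prod.union_disjoint)
qed

text \<open>Sorting \<open>(\<tau> i, \<tau> j)\<close> increasingly is a bijection of the pairs,
  undone by the same construction for the inverse; the conditional records whether a pair was turned
  round.\<close>

lemma pair_prod_permute:
  assumes "\<tau> permutes {..<n}"
  shows "pair_prod n (\<lambda>i j. \<psi> (\<tau> i) (\<tau> j)) =
    pair_prod n (\<lambda>i j. if inv_into UNIV \<tau> i < inv_into UNIV \<tau> j then \<psi> i j else \<psi> j i)"
proof -
  have lt: "\<tau> i < n \<longleftrightarrow> i < n" "inv_into UNIV \<tau> i < n \<longleftrightarrow> i < n" for i
    using permutes_in_image[OF assms, of i] permutes_in_image[OF permutes_inv[OF assms], of i]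
    by simp_all
  have inv: "\<tau> (inv_into UNIV \<tau> i) = i" "inv_into UNIV \<tau> (\<tau> i) = i" for i
    using permutes_inverses[OF assms] by simp_all
  have eq: "\<tau> i = \<tau> j \<longleftrightarrow> i = j" "inv_into UNIV \<tau> i = inv_into UNIV \<tau> j \<longleftrightarrow> i = j" for i j
    by (metis inv)+
  have cases: "(\<tau> i < \<tau> j \<or> \<tau> j < \<tau> i) \<and> (inv_into UNIV \<tau> i < inv_into UNIV \<tau> j \<or> inv_into UNIV \<tau> j < inv_into UNIV \<tau> i)"
    if "i < j" for i j using that eq[of i j] by linarith
  let ?f = "\<lambda>\<tau>::nat \<Rightarrow> nat. \<lambda>(i, j). if \<tau> i < \<tau> j then (\<tau> i, \<tau> j) else (\<tau> j, \<tau> i)"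
  have *: "?f (inv_into UNIV \<tau>) (?f \<tau> (i, j)) = (i, j) \<and> ?f \<tau> (?f (inv_into UNIV \<tau>) (i, j)) = (i, j) \<and>
      ?f \<tau> (i, j) \<in> pairs_below n \<and> ?f (inv_into UNIV \<tau>) (i, j) \<in> pairs_below n"
    if "(i, j) \<in> pairs_below n" for i j
    using that cases[of i j] unfolding pairs_below_def by (auto simp: lt inv)
  show ?thesis
    unfolding pair_prod_def
  proof (rule prod.reindex_bij_witness[where i = "?f (inv_into UNIV \<tau>)" and j = "?f \<tau>"])
    fix x assume x: "x \<in> pairs_below n"
    obtain i j where ij: "x = (i, j)" by fastforce
    show "?f (inv_into UNIV \<tau>) (?f \<tau> x) = x" "?f \<tau> (?f (inv_into UNIV \<tau>) x) = x"
      "?f \<tau> x \<in> pairs_below n" "?f (inv_into UNIV \<tau>) x \<in> pairs_below n"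
      using * x unfolding ij by blast+
    show "(case ?f \<tau> x of (i, j) \<Rightarrow> if inv_into UNIV \<tau> i < inv_into UNIV \<tau> j then \<psi> i j else \<psi> j i) =
        (case x of (i, j) \<Rightarrow> \<psi> (\<tau> i) (\<tau> j))"
      using x cases[of i j] unfolding ij pairs_below_def by (auto simp: inv)
  qed
qed

text \<open>Zero values are allowed, so that the exchange factor of two equal odd generators at
  different positions fits in.\<close>

definition alternating_on :: "nat \<Rightarrow> (nat \<Rightarrow> nat \<Rightarrow> int) \<Rightarrow> bool" where
  "alternating_on n \<psi> \<longleftrightarrow> (\<forall>i<n. \<forall>j<n. i \<noteq> j \<longrightarrow> \<psi> j i = - \<psi> i j)"

lemma alternating_onD: "alternating_on n \<psi> \<Longrightarrow> i < n \<Longrightarrow> j < n \<Longrightarrow> i \<noteq> j \<Longrightarrow> \<psi> j i = - \<psi> i j"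
  unfolding alternating_on_def by blast

text \<open>An adjacent transposition reverses the order of the single pair
  \<open>(a, Suc a)\<close>, and alternation turns that one factor into its negative.\<close>

lemma pair_prod_adjacent:
  assumes "Suc a < n" "alternating_on n \<psi>"
  shows "pair_prod n (\<lambda>i j. \<psi> (transpose a (Suc a) i) (transpose a (Suc a) j)) = - pair_prod n \<psi>"
proof -
  let ?t = "transpose a (Suc a)"
  have p: "?t permutes {..<n}" using assms by (intro permutes_swap_id) auto
  have m: "(a, Suc a) \<in> pairs_below n" using assms by (auto simp: pairs_below_def)
  have "pair_prod n (\<lambda>i j. \<psi> (?t i) (?t j)) =
      (\<Prod>(i, j) \<in> pairs_below n. if ?t i < ?t j then \<psi> i j else \<psi> j i)"
    using pair_prod_permute[OF p, of \<psi>] by (simp add: pair_prod_def)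
  also have "\<dots> = \<psi> (Suc a) a *
      (\<Prod>(i, j) \<in> pairs_below n - {(a, Suc a)}. if ?t i < ?t j then \<psi> i j else \<psi> j i)"
    by (subst prod.remove[OF _ m]) simp_all
  also have "(\<Prod>(i, j) \<in> pairs_below n - {(a, Suc a)}. if ?t i < ?t j then \<psi> i j else \<psi> j i) =
      (\<Prod>(i, j) \<in> pairs_below n - {(a, Suc a)}. \<psi> i j)"
  proof (rule prod.cong)
    fix x assume "x \<in> pairs_below n - {(a, Suc a)}"
    then obtain i j where x: "x = (i, j)" "i < j" "(i, j) \<noteq> (a, Suc a)"
      by (auto simp: pairs_below_def)
    then have "?t i < ?t j" by (cases "j = a"; cases "i = Suc a") (auto simp: transpose_def)
    then show "(case x of (i, j) \<Rightarrow> if ?t i < ?t j then \<psi> i j else \<psi> j i) = (case x of (i, j) \<Rightarrow> \<psi> i j)"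
      using x by simp
  qed simp
  also have "\<psi> (Suc a) a = - \<psi> a (Suc a)"
    using assms(1) by (intro alternating_onD[OF assms(2)]) auto
  finally show ?thesis by (simp add: pair_prod_def prod.remove[OF _ m])
qed

lemma alternating_on_permute:
  "\<tau> permutes {..<n} \<Longrightarrow> alternating_on n \<psi> \<Longrightarrow> alternating_on n (\<lambda>i j. \<psi> (\<tau> i) (\<tau> j))"
  unfolding alternating_on_def by (metis lessThan_iff permutes_in_image permutes_inj injD)

text \<open>The transposition of \<open>a\<close> and \<open>b + 1\<close> is that of
  \<open>a\<close> and \<open>b\<close> conjugated by an adjacent one; the three transpositions
  contribute three signs.\<close>

lemma pair_prod_transpose:
  assumes "a < b" "b < n" "alternating_on n \<psi>"
  shows "pair_prod n (\<lambda>i j. \<psi> (transpose a b i) (transpose a b j)) = - pair_prod n \<psi>"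
  using assms
proof (induction b arbitrary: \<psi>)
  case (Suc b)
  show ?case
  proof (cases "a = b")
    case True
    then show ?thesis using Suc pair_prod_adjacent by simp
  next
    case False
    let ?s = "transpose b (Suc b)" and ?t = "transpose a b"
    have s: "?s permutes {..<n}" and t: "?t permutes {..<n}"
      using Suc.prems by (intro permutes_swap_id; simp)+
    have e: "transpose a (Suc b) i = ?s (?t (?s i))" for i
      using False Suc.prems by (auto simp: transpose_def)
    have "pair_prod n (\<lambda>i j. \<psi> (?s (?t (?s i))) (?s (?t (?s j)))) =
        - pair_prod n (\<lambda>i j. \<psi> (?s (?t i)) (?s (?t j)))"
      using alternating_on_permute[OF t alternating_on_permute[OF s Suc.prems(3)]] Suc.prems
      by (intro pair_prod_adjacent) auto
    also have "pair_prod n (\<lambda>i j. \<psi> (?s (?t i)) (?s (?t j))) = - pair_prod n (\<lambda>i j. \<psi> (?s i) (?s j))"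
      using alternating_on_permute[OF s Suc.prems(3)] Suc.prems False by (intro Suc.IH) auto
    also have "pair_prod n (\<lambda>i j. \<psi> (?s i) (?s j)) = - pair_prod n \<psi>"
      using Suc.prems by (intro pair_prod_adjacent) auto
    finally show ?thesis by (simp add: e)
  qed
qed simp

text \<open>The textbook characterization of the sign, with zero products permitted. It is applied
  by multiplying a given pair function with auxiliary signs until the result alternates.\<close>

lemma pair_prod_alternating:
  assumes "\<tau> permutes {..<n}" "alternating_on n \<psi>"
  shows "pair_prod n (\<lambda>i j. \<psi> (\<tau> i) (\<tau> j)) = sign \<tau> * pair_prod n \<psi>"
  using assms(1) finite_lessThan assms(2)
proof (induction arbitrary: \<psi> rule: permutes_induct)
  case id
  then show ?case by simp
next
  case (swap a b p)
  have t: "transpose a b permutes {..<n}" using swap by (intro permutes_swap_id) auto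
  have pp: "permutation p" using swap.hyps by (metis finite_lessThan permutation_permutes)
  have "pair_prod n (\<lambda>i j. \<psi> (transpose a b (p i)) (transpose a b (p j))) =
      sign p * pair_prod n (\<lambda>i j. \<psi> (transpose a b i) (transpose a b j))"
    using swap.IH[OF alternating_on_permute[OF t swap.prems]] by simp
  also have "pair_prod n (\<lambda>i j. \<psi> (transpose a b i) (transpose a b j)) =
      sign (transpose a b) * pair_prod n \<psi>"
  proof -
    consider "a < b" | "b < a" using swap.hyps by linarith
    then have "pair_prod n (\<lambda>i j. \<psi> (transpose a b i) (transpose a b j)) = - pair_prod n \<psi>"
    proof cases
      case 1
      then show ?thesis using swap by (intro pair_prod_transpose) auto
    next
      case 2
      then show ?thesis using swap
        by (subst (1 2) transpose_commute, intro pair_prod_transpose) auto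
    qed
    then show ?thesis using swap.hyps by (simp add: sign_swap_id)
  qed
  finally show ?case
    by (simp add: sign_compose[OF permutation_swap_id pp] del: comp_apply) (simp add: comp_def)
qed

subsection \<open>The coefficient functional\<close>

text \<open>The factor that sorting a word picks up from \<open>x\<close> standing before
  \<open>y\<close>: a sign for two odd generators in the wrong order, and 0 for equal ones because
  odd squares vanish. The order only fixes which arrangement of a monomial is the reference.\<close>

definition exch :: "('g::linorder \<Rightarrow> bit) \<Rightarrow> 'g \<Rightarrow> 'g \<Rightarrow> int" where
  "exch s x y = (if s x = 1 \<and> s y = 1 then if x < y then 1 else if y < x then - 1 else 0 else 1)"

fun wsgn :: "('g::linorder \<Rightarrow> bit) \<Rightarrow> 'g list \<Rightarrow> int" where
  "wsgn s [] = 1"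
| "wsgn s (x # u) = prod_list (map (exch s x) u) * wsgn s u"

definition cross :: "('g::linorder \<Rightarrow> bit) \<Rightarrow> 'g multiset \<Rightarrow> 'g multiset \<Rightarrow> int" where
  "cross s M N = (\<Prod>x\<in>#M. \<Prod>y\<in>#N. exch s x y)"

lemma prod_list_mset: "prod_list (map f u) = (\<Prod>x\<in>#mset u. f x)"
  by (induction u) simp_all

lemma wsgn_append: "wsgn s (u @ v) = wsgn s u * wsgn s v * cross s (mset u) (mset v)"
  by (induction u) (simp_all add: cross_def prod_list_mset)

lemma wsgn_upt: "wsgn s (map g [0..<n]) = pair_prod n (\<lambda>i j. exch s (g i) (g j))"
proof (induction n)
  case 0
  then show ?case by (simp add: pair_prod_def pairs_below_def)
next
  case (Suc n)
  have "cross s (mset (map g [0..<n])) {#g n#} = (\<Prod>i<n. exch s (g i) (g n))"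
    by (simp add: cross_def image_mset.compositionality comp_def atLeast0LessThan prod_unfold_prod_mset)
  then show ?case by (simp add: wsgn_append pair_prod_Suc Suc)
qed

definition cw :: "('g::linorder \<Rightarrow> bit) \<Rightarrow> 'g list \<Rightarrow> 'g multiset \<Rightarrow> int" where
  "cw s u M = (if mset u = M then wsgn s u else 0)"

text \<open>Reading off, up to the sign of sorting, the coefficient of a supercommutative monomial.\<close>

definition cf :: "('g::linorder \<Rightarrow> bit) \<Rightarrow> 'g ncpoly \<Rightarrow> 'g multiset \<Rightarrow> int" where
  "cf s q M = (\<Sum>u\<in>Poly_Mapping.keys q. Poly_Mapping.lookup q u * cw s (letters u) M)"

lemma cf_superset:
  assumes "finite A" "Poly_Mapping.keys q \<subseteq> A"
  shows "cf s q M = (\<Sum>u\<in>A. Poly_Mapping.lookup q u * cw s (letters u) M)"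
  unfolding cf_def using assms by (intro sum.mono_neutral_left) (auto simp: in_keys_iff)

lemma cf_add: "cf s (p + q) M = cf s p M + cf s q M"
proof -
  let ?A = "Poly_Mapping.keys p \<union> Poly_Mapping.keys q"
  have "cf s r M = (\<Sum>u\<in>?A. Poly_Mapping.lookup r u * cw s (letters u) M)" if "r \<in> {p, q, p + q}" for r
    using that keys_add[of p q] by (intro cf_superset) auto
  then show ?thesis by (simp add: lookup_add distrib_right sum.distrib)
qed

lemma cf_zero [simp]: "cf s 0 M = 0"
  by (simp add: cf_def)

lemma cf_uminus: "cf s (- q) M = - cf s q M"
  using cf_add[of s q "- q" M] by simp

lemma cf_diff: "cf s (p - q) M = cf s p M - cf s q M"
  using cf_add[of s p "- q" M] by (simp add: cf_uminus)

lemma cf_sum: "cf s (\<Sum>i\<in>A. q i) M = (\<Sum>i\<in>A. cf s (q i) M)"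
  by (induction A rule: infinite_finite_induct) (simp_all add: cf_add)

lemma cf_single: "cf s (Poly_Mapping.single u c) M = c * cw s (letters u) M"
  by (simp add: cf_def lookup_single)

lemma letters_plus [simp]: "letters (u + v) = letters u @ letters v"
  by (simp add: plus_fword_def)

lemma ncpoly_expand:
  "(q :: 'g ncpoly) = (\<Sum>u\<in>Poly_Mapping.keys q. Poly_Mapping.single u (Poly_Mapping.lookup q u))"
  by (rule poly_mapping_eqI) (auto simp: lookup_sum lookup_single when_def in_keys_iff)

lemma cf_mult:
  "cf s (p * q) M = (\<Sum>u\<in>Poly_Mapping.keys p. \<Sum>v\<in>Poly_Mapping.keys q.
     Poly_Mapping.lookup p u * Poly_Mapping.lookup q v * cw s (letters u @ letters v) M)"
proof -
  have "p * q = (\<Sum>u\<in>Poly_Mapping.keys p. \<Sum>v\<in>Poly_Mapping.keys q.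
      Poly_Mapping.single (u + v) (Poly_Mapping.lookup p u * Poly_Mapping.lookup q v))"
    by (subst ncpoly_expand[of p], subst ncpoly_expand[of q])
      (simp add: sum_product mult_single)
  then show ?thesis by (simp add: cf_sum cf_single)
qed

lemma cw_append_left:
  "cw s (u @ v) M = (if mset u \<subseteq># M
     then wsgn s u * cross s (mset u) (M - mset u) * cw s v (M - mset u) else 0)"
  by (cases "mset u \<subseteq># M") (auto simp: cw_def wsgn_append)

lemma cw_append_right:
  "cw s (u @ v) M = (if mset v \<subseteq># M
     then wsgn s v * cross s (M - mset v) (mset v) * cw s u (M - mset v) else 0)"
  by (cases "mset v \<subseteq># M") (auto simp: cw_def wsgn_append)

text \<open>The coefficients of a product depend on the right factor only through its own
  coefficients, taken at sub-multisets of \<open>M\<close>. Compatibility with multiplication and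
  the ideals below both come from this.\<close>

lemma cf_mult_left:
  "cf s (p * q) M = (\<Sum>u\<in>Poly_Mapping.keys p. Poly_Mapping.lookup p u *
     (if mset (letters u) \<subseteq># M
      then wsgn s (letters u) * cross s (mset (letters u)) (M - mset (letters u)) *
        cf s q (M - mset (letters u)) else 0))"
  unfolding cf_mult
  by (rule sum.cong) (auto simp: cw_append_left cf_def sum_distrib_left intro!: sum.cong)

lemma cf_mult_right:
  "cf s (p * q) M = (\<Sum>v\<in>Poly_Mapping.keys q. Poly_Mapping.lookup q v *
     (if mset (letters v) \<subseteq># M
      then wsgn s (letters v) * cross s (M - mset (letters v)) (mset (letters v)) *
        cf s p (M - mset (letters v)) else 0))"
  unfolding cf_mult
  by (subst sum.swap, rule sum.cong) (auto simp: cw_append_right cf_def sum_distrib_left intro!: sum.cong)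

lemma cf_mult_cong_right: "cf s q = cf s q' \<Longrightarrow> cf s (p * q) = cf s (p * q')"
  by (rule ext) (simp only: cf_mult_left)

lemma cf_mult_cong_left: "cf s p = cf s p' \<Longrightarrow> cf s (p * q) = cf s (p' * q)"
  by (rule ext) (simp only: cf_mult_right)

section \<open>The supercommutativity ideal seen through coefficients\<close>

lemma free_ring_simps [simp]:
  "x \<oplus>\<^bsub>free_ring X\<^esub> y = x + y" "x \<otimes>\<^bsub>free_ring X\<^esub> y = x * y"
  "\<zero>\<^bsub>free_ring X\<^esub> = 0" "\<one>\<^bsub>free_ring X\<^esub> = 1"
  by (simp_all add: free_ring_def)

lemma carrier_free_ring:
  "q \<in> carrier (free_ring X) \<longleftrightarrow> (\<forall>u\<in>Poly_Mapping.keys q. set (letters u) \<subseteq> X)"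
  by (simp add: free_ring_def)

lemma free_ring_uminus:
  assumes "q \<in> carrier (free_ring X)"
  shows "\<ominus>\<^bsub>free_ring X\<^esub> q = - q"
proof -
  interpret ring "free_ring X" by (rule free_ring_is_ring)
  have "- q \<in> carrier (free_ring X)" using assms by (simp add: carrier_free_ring)
  with assms show ?thesis by (intro minus_equality) simp_all
qed

text \<open>\<open>F\<close> selects the monomials that are tested. Closed under sub-multisets, it
  gives an ideal; with the monomials respecting the flags it will bound the flag ideal.\<close>

definition cf_null ::
    "'g set \<Rightarrow> ('g::linorder \<Rightarrow> bit) \<Rightarrow> ('g multiset \<Rightarrow> bool) \<Rightarrow> 'g ncpoly set" where
  "cf_null X s F = {q \<in> carrier (free_ring X). \<forall>M. F M \<longrightarrow> cf s q M = 0}"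

lemma ideal_cf_null:
  assumes "\<And>M N. F M \<Longrightarrow> N \<subseteq># M \<Longrightarrow> F N"
  shows "ideal (cf_null X s F) (free_ring X)"
proof (rule idealI)
  interpret ring "free_ring X" by (rule free_ring_is_ring)
  show "ring (free_ring X)" by (rule free_ring_is_ring)
  show "subgroup (cf_null X s F) (add_monoid (free_ring X))"
  proof (rule add.subgroupI)
    fix a assume "a \<in> cf_null X s F"
    then have "\<ominus>\<^bsub>free_ring X\<^esub> a = - a" "- a \<in> cf_null X s F"
      by (auto simp: cf_null_def free_ring_uminus cf_uminus carrier_free_ring)
    then show "\<ominus>\<^bsub>free_ring X\<^esub> a \<in> cf_null X s F" by simp
  next
    fix a b assume "a \<in> cf_null X s F" "b \<in> cf_null X s F"
    then show "a \<oplus>\<^bsub>free_ring X\<^esub> b \<in> cf_null X s F"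
      using add.m_closed[of a b] by (auto simp: cf_null_def cf_add)
  next
    have "0 \<in> cf_null X s F" using zero_closed by (simp add: cf_null_def)
    then show "cf_null X s F \<noteq> {}" by blast
  qed (auto simp: cf_null_def)
  fix a x assume a: "a \<in> cf_null X s F" and x: "x \<in> carrier (free_ring X)"
  have sub: "F (M - N)" if "F M" for M N using assms[OF that] by simp
  from a x m_closed[of x a] show "x \<otimes>\<^bsub>free_ring X\<^esub> a \<in> cf_null X s F"
    by (auto simp: cf_null_def cf_mult_left sub intro!: sum.neutral)
  from a x m_closed[of a x] show "a \<otimes>\<^bsub>free_ring X\<^esub> x \<in> cf_null X s F"
    by (auto simp: cf_null_def cf_mult_right sub intro!: sum.neutral)
qed

lemma fvar_in_carrier [simp]: "fvar x \<in> carrier (free_ring X) \<longleftrightarrow> x \<in> X"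
  by (simp add: carrier_free_ring fvar_def)

lemma fvar_mult: "fvar x * fvar y = Poly_Mapping.single (FWord [x, y]) 1"
  by (simp add: fvar_def mult_single plus_fword_def)

lemma super_relations_carrier: "super_relations X s \<subseteq> carrier (free_ring X)"
proof -
  interpret ring "free_ring X" by (rule free_ring_is_ring)
  have "p * q - r \<in> carrier (free_ring X)" "p * q + r \<in> carrier (free_ring X)" "p * q \<in> carrier (free_ring X)"
    if "p \<in> carrier (free_ring X)" "q \<in> carrier (free_ring X)" "r \<in> carrier (free_ring X)" for p q r
    using that m_closed[of p q] a_closed[of "p * q" r] a_closed[of "p * q" "- r"]
    by (auto simp: carrier_free_ring)
  moreover have "fvar x * fvar y \<in> carrier (free_ring X)" if "x \<in> X" "y \<in> X" for x y
    using that m_closed[of "fvar x" "fvar y"] by simp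
  ultimately show ?thesis unfolding super_relations_def by auto
qed

lemma super_relations_cf_null: "super_relations X s \<subseteq> cf_null X s F"
proof
  fix r assume r: "r \<in> super_relations X s"
  then have "cf s r M = 0" for M
    unfolding super_relations_def
  proof (elim UnE CollectE exE conjE)
    fix x y assume "r = fvar x * fvar y - fvar y * fvar x" "s x = 0 \<or> s y = 0"
    then show ?thesis
      by (auto simp: fvar_mult cf_diff cf_single cw_def exch_def add_mset_commute)
  next
    fix x y assume "r = fvar x * fvar y + fvar y * fvar x" "s x = 1" "s y = 1"
    then show ?thesis
      by (cases x y rule: linorder_cases)
        (auto simp: fvar_mult cf_add cf_single cw_def exch_def add_mset_commute)
  next
    fix x assume "r = fvar x * fvar x" "s x = 1"
    then show ?thesis by (simp add: fvar_mult cf_single cw_def exch_def)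
  qed
  with r super_relations_carrier show "r \<in> cf_null X s F" by (auto simp: cf_null_def)
qed

lemma super_ideal_ideal: "ideal (super_ideal X s) (free_ring X)"
  unfolding super_ideal_def
  by (rule ring.genideal_ideal[OF free_ring_is_ring super_relations_carrier])

lemma super_ideal_cf_null:
  assumes "\<And>M N. F M \<Longrightarrow> N \<subseteq># M \<Longrightarrow> F N"
  shows "super_ideal X s \<subseteq> cf_null X s F"
  unfolding super_ideal_def
  using ring.genideal_minimal[OF free_ring_is_ring ideal_cf_null super_relations_cf_null] assms by blast

lemma super_ideal_relation: "r \<in> super_relations X s \<Longrightarrow> r \<in> super_ideal X s"
  using ring.genideal_self[OF free_ring_is_ring super_relations_carrier]
  unfolding super_ideal_def by blast

lemma super_ideal_closed:
  shows super_ideal_add: "p \<in> super_ideal X s \<Longrightarrow> q \<in> super_ideal X s \<Longrightarrow> p + q \<in> super_ideal X s"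
    and super_ideal_left: "p \<in> super_ideal X s \<Longrightarrow> r \<in> carrier (free_ring X) \<Longrightarrow> r * p \<in> super_ideal X s"
    and super_ideal_right: "p \<in> super_ideal X s \<Longrightarrow> r \<in> carrier (free_ring X) \<Longrightarrow> p * r \<in> super_ideal X s"
    and super_ideal_0: "0 \<in> super_ideal X s"
proof -
  interpret ideal "super_ideal X s" "free_ring X" by (rule super_ideal_ideal)
  show "p \<in> super_ideal X s \<Longrightarrow> q \<in> super_ideal X s \<Longrightarrow> p + q \<in> super_ideal X s"
    using additive_subgroup.a_closed[OF is_additive_subgroup, of p q] by simp
  show "p \<in> super_ideal X s \<Longrightarrow> r \<in> carrier (free_ring X) \<Longrightarrow> r * p \<in> super_ideal X s"
    using I_l_closed[of p r] by simp
  show "p \<in> super_ideal X s \<Longrightarrow> r \<in> carrier (free_ring X) \<Longrightarrow> p * r \<in> super_ideal X s"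
    using I_r_closed[of p r] by simp
  show "0 \<in> super_ideal X s"
    using additive_subgroup.zero_closed[OF is_additive_subgroup] by simp
qed

lemma super_ideal_sum:
  "(\<And>i. i \<in> A \<Longrightarrow> q i \<in> super_ideal X s) \<Longrightarrow> (\<Sum>i\<in>A. q i) \<in> super_ideal X s"
  by (induction A rule: infinite_finite_induct) (simp_all add: super_ideal_0 super_ideal_add)

section \<open>Sorting words modulo the relations\<close>

lemma single_carrier [simp]:
  "set u \<subseteq> X \<Longrightarrow> Poly_Mapping.single (FWord u) c \<in> carrier (free_ring X)"
  by (simp add: carrier_free_ring)

abbreviation word :: "'g list \<Rightarrow> int \<Rightarrow> 'g ncpoly" where
  "word u c \<equiv> Poly_Mapping.single (FWord u) c"

lemma word_mult: "word u c * word v d = word (u @ v) (c * d)"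
  by (simp add: mult_single plus_fword_def)

lemma word_insort:
  assumes "sorted w" "x \<in> X" "set w \<subseteq> X"
  shows "word (x # w) 1 - word (insort x w) (prod_list (map (exch s x) w)) \<in> super_ideal X s"
  using assms
proof (induction w)
  case Nil
  then show ?case by (simp add: super_ideal_0)
next
  case (Cons y w)
  show ?case
  proof (cases "x \<le> y")
    case True
    have "exch s x z = 1" if "z \<in> set (y # w)" "\<not> (x = y \<and> s x = 1)" for z
      using that Cons.prems True by (auto simp: exch_def)
    then have 1: "prod_list (map (exch s x) (y # w)) = 1" if "\<not> (x = y \<and> s x = 1)"
      using that by (simp add: prod_list_mset prod_mset.neutral)
    \<comment> \<open>An odd generator meets its own copy: the sorting factor vanishes, and the
      unsorted word lies in the ideal because the square does.\<close>
    have 0: "prod_list (map (exch s x) (y # w)) = 0" if "x = y" "s x = 1"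
      using that by (simp add: exch_def)
    have sq: "word (x # x # w) 1 \<in> super_ideal X s" if "s x = 1"
    proof -
      have "fvar x * fvar x \<in> super_ideal X s"
        using Cons.prems that by (intro super_ideal_relation) (auto simp: super_relations_def)
      from super_ideal_right[OF this, of "word w 1"] show ?thesis
        using Cons.prems by (simp add: fvar_mult word_mult)
    qed
    show ?thesis
    proof (cases "x = y \<and> s x = 1")
      case True
      then have "x = y" "s x = 1" by auto
      then show ?thesis using 0 sq by (simp del: list.map)
    next
      case False
      have "insort x (y # w) = x # y # w" using \<open>x \<le> y\<close> by simp
      then show ?thesis unfolding 1[OF False] by (simp add: super_ideal_0)
    qed
  next
    case False
    let ?c = "exch s x y" and ?P = "prod_list (map (exch s x) w)"
    have "word [x, y] 1 - word [y, x] ?c \<in> super_ideal X s"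
      using Cons.prems False
      by (intro super_ideal_relation)
        (cases "s x"; cases "s y"; auto simp: super_relations_def fvar_mult exch_def single_uminus)
    from super_ideal_right[OF this, of "word w 1"]
    have 1: "word (x # y # w) 1 - word (y # x # w) ?c \<in> super_ideal X s"
      using Cons.prems by (simp add: left_diff_distrib word_mult)
    have "word (x # w) 1 - word (insort x w) ?P \<in> super_ideal X s"
      using Cons by simp
    from super_ideal_left[OF this, of "word [y] ?c"]
    have 2: "word (y # x # w) ?c - word (y # insort x w) (?c * ?P) \<in> super_ideal X s"
      using Cons.prems by (simp add: right_diff_distrib word_mult)
    show ?thesis using super_ideal_add[OF 1 2] False by simp
  qed
qed

lemma word_sort:
  assumes "set u \<subseteq> X"
  shows "word u 1 - word (sorted_list_of_multiset (mset u)) (wsgn s u) \<in> super_ideal X s"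
  using assms
proof (induction u)
  case Nil
  then show ?case by (simp add: super_ideal_0)
next
  case (Cons x u)
  let ?w = "sorted_list_of_multiset (mset u)"
  have m: "mset ?w = mset u" by simp
  then have st: "set ?w = set u" by (metis set_mset_mset)
  have "word u 1 - word ?w (wsgn s u) \<in> super_ideal X s" using Cons by simp
  from super_ideal_left[OF this, of "word [x] 1"]
  have 1: "word (x # u) 1 - word (x # ?w) (wsgn s u) \<in> super_ideal X s"
    using Cons.prems by (simp add: right_diff_distrib word_mult)
  have "word (x # ?w) 1 - word (insort x ?w) (prod_list (map (exch s x) ?w)) \<in> super_ideal X s"
    using Cons.prems st by (intro word_insort) auto
  from super_ideal_left[OF this, of "word [] (wsgn s u)"]
  have 2: "word (x # ?w) (wsgn s u) - word (insort x ?w) (wsgn s u * prod_list (map (exch s x) ?w))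
      \<in> super_ideal X s"
    by (simp add: right_diff_distrib word_mult)
  have 3: "prod_list (map (exch s x) ?w) = prod_list (map (exch s x) u)"
    by (simp add: prod_list_mset)
  show ?case using super_ideal_add[OF 1 2] unfolding 3 by (simp add: mult.commute)
qed

text \<open>Modulo the ideal each word is a multiple of its sorted form, and collecting the words
  with multiset \<open>M\<close> leaves the sorted word with coefficient \<open>cf s q M\<close>.
  Hence equality in the letterplace ring can be tested by coefficients.\<close>

lemma super_idealI:
  assumes q: "q \<in> carrier (free_ring X)" and 0: "\<And>M. cf s q M = 0"
  shows "q \<in> super_ideal X s"
proof -
  let ?K = "Poly_Mapping.keys q" and ?l = "Poly_Mapping.lookup q"
  let ?m = "\<lambda>u. mset (letters u)"
  let ?S = "\<lambda>u. word (sorted_list_of_multiset (?m u)) (?l u * wsgn s (letters u))"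
  have "(\<Sum>u\<in>?K. word (letters u) (?l u) - ?S u) \<in> super_ideal X s"
  proof (rule super_ideal_sum)
    fix u assume u: "u \<in> ?K"
    have "word (letters u) 1 - word (sorted_list_of_multiset (?m u)) (wsgn s (letters u)) \<in> super_ideal X s"
      using q u by (intro word_sort) (auto simp: carrier_free_ring)
    from super_ideal_left[OF this, of "word [] (?l u)"]
    show "word (letters u) (?l u) - ?S u \<in> super_ideal X s"
      by (simp add: right_diff_distrib word_mult del: fword.collapse)
  qed
  moreover have "(\<Sum>u\<in>?K. ?S u) = 0"
  proof -
    have "(\<Sum>u\<in>?K. ?S u) = (\<Sum>M\<in>?m ` ?K. \<Sum>u\<in>{u\<in>?K. ?m u = M}. ?S u)"
      by (rule sum.image_gen) simp
    also have "\<dots> = (\<Sum>M\<in>?m ` ?K. word (sorted_list_of_multiset M) (cf s q M))"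
    proof (rule sum.cong[OF refl])
      fix M assume "M \<in> ?m ` ?K"
      have "(\<Sum>u\<in>{u\<in>?K. ?m u = M}. ?S u) =
          (\<Sum>u\<in>{u\<in>?K. ?m u = M}. word (sorted_list_of_multiset M) (?l u * cw s (letters u) M))"
        by (rule sum.cong) (auto simp: cw_def)
      also have "\<dots> = word (sorted_list_of_multiset M) (\<Sum>u\<in>{u\<in>?K. ?m u = M}. ?l u * cw s (letters u) M)"
        by (rule poly_mapping_eqI) (simp add: lookup_sum lookup_single when_def)
      also have "(\<Sum>u\<in>{u\<in>?K. ?m u = M}. ?l u * cw s (letters u) M) = cf s q M"
        unfolding cf_def by (rule sum.mono_neutral_left) (auto simp: cw_def)
      finally show "(\<Sum>u\<in>{u\<in>?K. ?m u = M}. ?S u) = word (sorted_list_of_multiset M) (cf s q M)" .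
    qed
    finally show ?thesis by (simp add: 0)
  qed
  moreover have "q = (\<Sum>u\<in>?K. word (letters u) (?l u))"
    using ncpoly_expand[of q] by simp
  ultimately show ?thesis by (simp add: sum_subtractf)
qed

subsection \<open>Reordering words\<close>

definition unit_sign :: "int \<Rightarrow> bool" where
  "unit_sign e \<longleftrightarrow> e = 1 \<or> e = - 1"

lemma unit_sign_simps [simp]: "unit_sign 1" "unit_sign (- 1)" "unit_sign (sign p)"
  by (auto simp: unit_sign_def sign_def)

lemma unit_sign_mult: "unit_sign a \<Longrightarrow> unit_sign b \<Longrightarrow> unit_sign (a * b)"
  by (auto simp: unit_sign_def)

lemma unit_sign_square: "unit_sign a \<Longrightarrow> a * a = 1"
  by (auto simp: unit_sign_def)

lemma unit_sign_pair_prod: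
  assumes "\<And>i j. i < j \<Longrightarrow> j < n \<Longrightarrow> unit_sign (\<psi> i j)"
  shows "unit_sign (pair_prod n \<psi>)"
proof -
  have "unit_sign (\<Prod>x\<in>A. case x of (i, j) \<Rightarrow> \<psi> i j)" if "finite A" "A \<subseteq> pairs_below n" for A
    using that by induction (auto simp: pairs_below_def assms intro!: unit_sign_mult)
  then show ?thesis unfolding pair_prod_def by simp
qed

lemma exch_swap: "exch s y x = (if s x = 1 \<and> s y = 1 then - 1 else 1) * exch s x y"
  by (auto simp: exch_def)

lemma permutes_less: "\<tau> permutes {..<n} \<Longrightarrow> \<tau> i < n \<longleftrightarrow> i < (n::nat)"
  using permutes_in_image[of \<tau> "{..<n}" i] by simp

lemma mset_map_permute:
  assumes "\<tau> permutes {..<n}"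
  shows "mset (map (g \<circ> \<tau>) [0..<n]) = mset (map g [0..<n])"
proof -
  have "mset (map (g \<circ> \<tau>) [0..<n]) = image_mset g (image_mset \<tau> (mset_set {..<n}))"
    by (simp add: image_mset.compositionality atLeast0LessThan)
  then show ?thesis by (simp add: permutes_image_mset[OF assms] atLeast0LessThan)
qed

text \<open>Each pair whose order is reversed costs a sign exactly if both generators are odd. So
  \<open>e\<close> depends only on \<open>\<tau>\<close> and the parities, and a single
  \<open>e\<close> serves all placements of the same letters.\<close>

lemma cw_permute:
  assumes "\<tau> permutes {..<n}"
  obtains e where "unit_sign e"
    "\<And>g M. (\<And>i. i < n \<Longrightarrow> s (g i) = o' i) \<Longrightarrow> cw s (map (g \<circ> \<tau>) [0..<n]) M = e * cw s (map g [0..<n]) M"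
proof
  let ?k = "\<lambda>i j. if inv_into UNIV \<tau> i < inv_into UNIV \<tau> j then 1 else if o' i = 1 \<and> o' j = 1 then - 1 else 1 :: int"
  show "unit_sign (pair_prod n ?k)" by (rule unit_sign_pair_prod) simp
  fix g M assume o: "\<And>i. i < n \<Longrightarrow> s (g i) = o' i"
  have "wsgn s (map (g \<circ> \<tau>) [0..<n]) = pair_prod n (\<lambda>i j. exch s (g (\<tau> i)) (g (\<tau> j)))"
    by (simp add: wsgn_upt)
  also have "\<dots> = pair_prod n (\<lambda>i j. if inv_into UNIV \<tau> i < inv_into UNIV \<tau> j
      then exch s (g i) (g j) else exch s (g j) (g i))"
    by (rule pair_prod_permute[OF assms])
  also have "\<dots> = pair_prod n (\<lambda>i j. ?k i j * exch s (g i) (g j))"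
  proof (rule pair_prod_cong)
    fix i j assume "i < j" "j < n"
    then show "(if inv_into UNIV \<tau> i < inv_into UNIV \<tau> j then exch s (g i) (g j) else exch s (g j) (g i)) =
        ?k i j * exch s (g i) (g j)"
      using o[of i] o[of j] exch_swap[of s "g j" "g i"] by auto
  qed
  finally have "wsgn s (map (g \<circ> \<tau>) [0..<n]) = pair_prod n ?k * wsgn s (map g [0..<n])"
    by (simp add: pair_prod_mult wsgn_upt)
  then show "cw s (map (g \<circ> \<tau>) [0..<n]) M = pair_prod n ?k * cw s (map g [0..<n]) M"
    using mset_map_permute[OF assms, of g] by (simp add: cw_def)
qed

lemma cw_permute_odd:
  assumes \<tau>: "\<tau> permutes {..<n}"
    and par: "\<And>i. i < n \<Longrightarrow> s (g (\<tau> i)) = s (g i)"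
    and fixd: "\<And>i. i < n \<Longrightarrow> s (g i) = 0 \<Longrightarrow> \<tau> i = i"
  shows "cw s (map (g \<circ> \<tau>) [0..<n]) M = sign \<tau> * cw s (map g [0..<n]) M"
proof -
  let ?e = "\<lambda>i j. exch s (g i) (g j)"
  \<comment> \<open>\<open>?r\<close> completes the exchange factors to an alternating function: the
    order of positions for two even generators, the location of the odd one for a mixed pair. It is
    invariant because \<open>\<tau>\<close> fixes the even positions.\<close>
  let ?r = "\<lambda>i j. if s (g i) = s (g j) then if s (g i) = 1 then 1 else if i < j then 1 else - 1
                   else if s (g i) = 1 then 1 else - 1 :: int"
  have "alternating_on n (\<lambda>i j. ?e i j * ?r i j)"
    unfolding alternating_on_def by (auto simp: exch_def)
  from pair_prod_alternating[OF \<tau> this]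
  have 1: "pair_prod n (\<lambda>i j. ?e (\<tau> i) (\<tau> j)) * pair_prod n (\<lambda>i j. ?r (\<tau> i) (\<tau> j)) =
      sign \<tau> * (pair_prod n ?e * pair_prod n ?r)"
    by (simp only: pair_prod_mult)
  have 2: "pair_prod n (\<lambda>i j. ?r (\<tau> i) (\<tau> j)) = pair_prod n ?r"
  proof (rule pair_prod_cong)
    fix i j assume ij: "i < j" "j < n"
    then have "s (g (\<tau> i)) = s (g i)" "s (g (\<tau> j)) = s (g j)"
      "s (g i) = 0 \<Longrightarrow> \<tau> i = i" "s (g j) = 0 \<Longrightarrow> \<tau> j = j"
      using par[of i] par[of j] fixd[of i] fixd[of j] by simp_all
    then show "?r (\<tau> i) (\<tau> j) = ?r i j" using ij by (cases "s (g i)"; cases "s (g j)") simp_all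
  qed
  have "unit_sign (pair_prod n ?r)" by (rule unit_sign_pair_prod) simp
  then have "pair_prod n ?r \<noteq> 0" by (auto simp: unit_sign_def)
  with 1 2 have "pair_prod n (\<lambda>i j. ?e (\<tau> i) (\<tau> j)) = sign \<tau> * pair_prod n ?e" by simp
  then have "wsgn s (map (g \<circ> \<tau>) [0..<n]) = sign \<tau> * wsgn s (map g [0..<n])"
    by (simp add: wsgn_upt)
  then show ?thesis using mset_map_permute[OF \<tau>, of g] by (simp add: cw_def)
qed

lemma cw_permute_even:
  assumes \<tau>: "\<tau> permutes {..<n}"
    and par: "\<And>i. i < n \<Longrightarrow> s (g (\<tau> i)) = s (g i)"
    and fixd: "\<And>i. i < n \<Longrightarrow> s (g i) = 1 \<Longrightarrow> \<tau> i = i"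
  shows "cw s (map (g \<circ> \<tau>) [0..<n]) M = cw s (map g [0..<n]) M"
proof -
  have "wsgn s (map (g \<circ> \<tau>) [0..<n]) = wsgn s (map g [0..<n])"
    unfolding wsgn_upt comp_apply
    by (rule pair_prod_cong) (auto simp: exch_def par fixd)
  then show ?thesis using mset_map_permute[OF \<tau>, of g] by (simp add: cw_def)
qed

subsection \<open>Rows as antisymmetrizations over places\<close>

lemma lp_sign_simps [simp]:
  "lp_sign par (a, p) = 1 \<longleftrightarrow> par a = 0" "lp_sign par (a, p) = 0 \<longleftrightarrow> par a = 1"
  by (cases "par a"; simp add: lp_sign_def)+

lemma minus_one_power_card_pairs:
  "(- 1 :: int) ^ card {(i, j) \<in> pairs_below n. Q i j} = pair_prod n (\<lambda>i j. if Q i j then - 1 else 1)"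
proof -
  have "{x \<in> pairs_below n. case_prod Q x} = {(i, j) \<in> pairs_below n. Q i j}" by auto
  moreover have "pair_prod n (\<lambda>i j. if Q i j then - 1 else 1) =
      (\<Prod>x\<in>pairs_below n. if case_prod Q x then - 1 else 1)"
    unfolding pair_prod_def by (rule prod.cong) auto
  moreover have "\<dots> = (\<Prod>x\<in>{x \<in> pairs_below n. case_prod Q x}. - 1)"
    by (rule prod.inter_filter[symmetric]) simp
  ultimately show ?thesis by simp
qed

text \<open>Both counts are transported to pairs of positions of the rearranged word, where the
  sorting sign lives: the first through the inverse of \<open>\<sigma>\<close> with the pair
  reversed, the second by swapping components.\<close>

lemma minus_one_power_tab_sign_exp:
  assumes \<sigma>: "\<sigma> permutes {..<n}" and n: "n = length w"
  shows "(- 1 :: int) ^ tab_sign_exp par w \<sigma> = pair_prod n (\<lambda>i j.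
    (if \<sigma> j < \<sigma> i \<and> par (w ! \<sigma> i) = 1 \<and> par (w ! \<sigma> j) = 1 then - 1 else 1) *
    (if par (w ! \<sigma> j) = 1 then - 1 else 1))"
proof -
  let ?i = "inv_into UNIV \<sigma>"
  have lt: "\<sigma> i < n \<longleftrightarrow> i < n" "?i i < n \<longleftrightarrow> i < n" for i
    using permutes_less[OF \<sigma>] permutes_less[OF permutes_inv[OF \<sigma>]] by simp_all
  have inv: "\<sigma> (?i i) = i" "?i (\<sigma> i) = i" for i
    using permutes_inverses[OF \<sigma>] by simp_all
  have "card {(i, j). i < n \<and> j < n \<and> i < j \<and> ?i i > ?i j \<and> par (w ! i) = 1 \<and> par (w ! j) = 1} =
      card {(i, j) \<in> pairs_below n. \<sigma> j < \<sigma> i \<and> par (w ! \<sigma> i) = 1 \<and> par (w ! \<sigma> j) = 1}"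
    by (rule bij_betw_same_card[where f = "\<lambda>(i, j). (?i j, ?i i)"],
        rule bij_betw_byWitness[where f' = "\<lambda>(i, j). (\<sigma> j, \<sigma> i)"])
      (auto simp: pairs_below_def lt inv)
  moreover have "card {(i, j). i < n \<and> j < n \<and> i > j \<and> par (w ! \<sigma> i) = 1} =
      card {(i, j) \<in> pairs_below n. par (w ! \<sigma> j) = 1}"
    by (rule bij_betw_same_card[where f = "\<lambda>(i, j). (j, i)"],
        rule bij_betw_byWitness[where f' = "\<lambda>(i, j). (j, i)"])
      (auto simp: pairs_below_def)
  ultimately show ?thesis
    unfolding tab_sign_exp_def n[symmetric]
    by (simp add: power_add minus_one_power_card_pairs pair_prod_mult)
qed

text \<open>This is -1 to the power of the sum of the zero-based positions of the negative
  letters.\<close>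

definition row_sign :: "('a \<Rightarrow> bit) \<Rightarrow> 'a list \<Rightarrow> int" where
  "row_sign par w = pair_prod (length w) (\<lambda>i j. if par (w ! j) = 1 then - 1 else 1)"

lemma unit_sign_row_sign: "unit_sign (row_sign par w)"
  unfolding row_sign_def by (rule unit_sign_pair_prod) simp

text \<open>The exponent is designed so that its factors \<open>?t\<close>, multiplied with the
  exchange factors, alternate. Moving the letters back to their original order therefore costs the
  sign of the place permutation, and the transported factors \<open>?t\<close> leave a sign that is
  the same for all \<open>\<sigma>\<close>.\<close>

lemma tab_term:
  assumes \<sigma>: "\<sigma> permutes {..<n}" and n: "n = length w"
  shows "(- 1) ^ tab_sign_exp par w \<sigma> * cw (lp_sign par) (map (\<lambda>i. (w ! \<sigma> i, q i)) [0..<n]) M =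
    row_sign par w * (sign (inv_into UNIV \<sigma>) *
      cw (lp_sign par) (map (\<lambda>i. (w ! i, q (inv_into UNIV \<sigma> i))) [0..<n]) M)"
proof -
  let ?i = "inv_into UNIV \<sigma>"
  let ?s = "lp_sign par"
  let ?g = "\<lambda>i. (w ! \<sigma> i, q i)"
  have inv: "\<sigma> (?i i) = i" "?i (\<sigma> i) = i" for i
    using permutes_inverses[OF \<sigma>] by simp_all
  have eq: "\<sigma> i = \<sigma> j \<longleftrightarrow> i = j" for i j by (metis inv(2))
  have p: "?i permutes {..<n}" by (rule permutes_inv[OF \<sigma>])
  have si: "sign ?i * sign ?i = 1" by simp
  let ?t = "\<lambda>i j. if par (w ! \<sigma> i) = 0 \<and> par (w ! \<sigma> j) = 0 then 1
      else if par (w ! \<sigma> i) = 1 \<and> par (w ! \<sigma> j) = 1 then (if \<sigma> j < \<sigma> i then 1 else - 1)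
      else if par (w ! \<sigma> j) = 1 then - 1 else 1 :: int"
  let ?psi = "\<lambda>i j. exch ?s (?g i) (?g j) * ?t i j"
  have "alternating_on n ?psi"
    unfolding alternating_on_def by (auto simp: exch_def eq)
  from pair_prod_alternating[OF p this]
  have 1: "pair_prod n (\<lambda>i j. ?psi (?i i) (?i j)) = sign ?i * pair_prod n ?psi" .
  have 2: "pair_prod n ?t = (- 1) ^ tab_sign_exp par w \<sigma>"
    unfolding minus_one_power_tab_sign_exp[OF \<sigma> n]
    by (rule pair_prod_cong) auto
  have 3: "pair_prod n (\<lambda>i j. ?t (?i i) (?i j)) = row_sign par w"
    unfolding row_sign_def n[symmetric]
    by (rule pair_prod_cong) (auto simp: inv)
  have "row_sign par w * wsgn ?s (map (\<lambda>i. (w ! i, q (?i i))) [0..<n]) =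
      pair_prod n (\<lambda>i j. ?psi (?i i) (?i j))"
    unfolding pair_prod_mult 3 wsgn_upt by (simp add: inv mult.commute)
  also have "\<dots> = sign ?i * ((- 1) ^ tab_sign_exp par w \<sigma> * wsgn ?s (map ?g [0..<n]))"
    unfolding 1 unfolding pair_prod_mult 2 wsgn_upt by (simp only: mult_ac)
  finally have 0: "row_sign par w * wsgn ?s (map (\<lambda>i. (w ! i, q (?i i))) [0..<n]) =
      sign ?i * ((- 1) ^ tab_sign_exp par w \<sigma> * wsgn ?s (map ?g [0..<n]))" .
  have "e * e = 1 \<Longrightarrow> r * A = e * B \<Longrightarrow> B = r * (e * A)" for e r A B :: int
    by (metis mult.assoc mult.left_commute mult_1)
  from this[OF si 0] have 4: "(- 1) ^ tab_sign_exp par w \<sigma> * wsgn ?s (map ?g [0..<n]) =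
      row_sign par w * (sign ?i * wsgn ?s (map (\<lambda>i. (w ! i, q (?i i))) [0..<n]))" .
  have "mset (map (\<lambda>i. (w ! i, q (?i i))) [0..<n]) = mset (map ?g [0..<n])"
    using mset_map_permute[OF p, of ?g] by (simp add: comp_def inv)
  then show ?thesis using 4 by (simp add: cw_def)
qed

text \<open>A determinant over the places with the letters in fixed order. Unlike in
  \<open>tab_sum\<close>, the signs do not depend on the parities.\<close>

definition row_poly :: "nat \<Rightarrow> (nat \<Rightarrow> 'a) \<Rightarrow> (nat \<Rightarrow> nat) \<Rightarrow> ('a \<times> nat) ncpoly" where
  "row_poly n u q = (\<Sum>\<sigma> | \<sigma> permutes {..<n}. word (map (\<lambda>i. (u i, q (\<sigma> i))) [0..<n]) (sign \<sigma>))"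

lemma tab_sum_word:
  "tab_sum par w p = (\<Sum>\<sigma> | \<sigma> permutes {..<length w}.
     word (map (\<lambda>i. (w ! \<sigma> i, p ! i)) [0..<length w]) ((- 1) ^ tab_sign_exp par w \<sigma>))"
  unfolding tab_sum_def prod_list_fvar minus_one_power_times_single ..

lemma cf_tab_sum:
  "cf (lp_sign par) (tab_sum par w p) M =
    row_sign par w * cf (lp_sign par) (row_poly (length w) ((!) w) ((!) p)) M"
proof -
  let ?s = "lp_sign par" and ?n = "length w"
  have "cf ?s (tab_sum par w p) M = (\<Sum>\<sigma> | \<sigma> permutes {..<?n}.
      (- 1) ^ tab_sign_exp par w \<sigma> * cw ?s (map (\<lambda>i. (w ! \<sigma> i, p ! i)) [0..<?n]) M)"
    by (simp add: tab_sum_word cf_sum cf_single)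
  also have "\<dots> = (\<Sum>\<sigma> | \<sigma> permutes {..<?n}. row_sign par w * (sign (inv_into UNIV \<sigma>) *
      cw ?s (map (\<lambda>i. (w ! i, p ! (inv_into UNIV \<sigma> i))) [0..<?n]) M))"
    by (rule sum.cong) (simp_all add: tab_term)
  also have "\<dots> = (\<Sum>\<sigma> | \<sigma> permutes {..<?n}. row_sign par w * (sign \<sigma> *
      cw ?s (map (\<lambda>i. (w ! i, p ! (\<sigma> i))) [0..<?n]) M))"
    by (rule sum_permutations_inverse[symmetric])
  finally show ?thesis by (simp add: row_poly_def cf_sum cf_single sum_distrib_left)
qed

section \<open>Permutations preserving the two blocks of positions\<close>

definition glue :: "nat \<Rightarrow> nat \<Rightarrow> (nat \<Rightarrow> nat) \<Rightarrow> (nat \<Rightarrow> nat) \<Rightarrow> nat \<Rightarrow> nat" where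
  "glue n1 n2 \<sigma> \<tau> i = (if i < n1 then \<sigma> i else if i < n1 + n2 then n1 + \<tau> (i - n1) else i)"

lemma glue_eq:
  assumes \<sigma>: "\<sigma> permutes {..<n1}"
  shows "glue n1 n2 \<sigma> \<tau> = \<sigma> \<circ> map_permutation {..<n2} ((+) n1) \<tau>"
proof
  fix i
  have im: "(+) n1 ` {..<n2} = {n1..<n1 + n2}" by (simp add: lessThan_atLeast0 add.commute)
  have inv: "inv_into {..<n2} ((+) n1) i = i - n1" if "n1 \<le> i" "i < n1 + n2"
    using that by (intro inv_into_f_eq) auto
  show "glue n1 n2 \<sigma> \<tau> i = (\<sigma> \<circ> map_permutation {..<n2} ((+) n1) \<tau>) i"
    using permutes_not_in[OF \<sigma>, of i] permutes_not_in[OF \<sigma>, of "n1 + \<tau> (i - n1)"]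
    by (auto simp: glue_def map_permutation_def restrict_id_def im inv)
qed

lemma glue_permutes:
  assumes \<sigma>: "\<sigma> permutes {..<n1}" and \<tau>: "\<tau> permutes {..<n2}"
  shows "glue n1 n2 \<sigma> \<tau> permutes {..<n1 + n2}" and "sign (glue n1 n2 \<sigma> \<tau>) = sign \<sigma> * sign \<tau>"
    and "glue n1 n2 \<sigma> \<tau> ` {..<n1} = {..<n1}"
proof -
  have b: "bij_betw ((+) n1) {..<n2} {n1..<n1 + n2}"
    by (rule bij_betw_byWitness[where f' = "\<lambda>i. i - n1"]) auto
  have m: "map_permutation {..<n2} ((+) n1) \<tau> permutes {n1..<n1 + n2}"
    by (rule map_permutation_permutes[OF b \<tau>])
  show "glue n1 n2 \<sigma> \<tau> permutes {..<n1 + n2}"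
    unfolding glue_eq[OF \<sigma>]
    by (rule permutes_compose; rule permutes_subset[OF m] permutes_subset[OF \<sigma>]) auto
  have "sign (map_permutation {..<n2} ((+) n1) \<tau>) = sign \<tau>"
    by (rule sign_map_permutation[OF _ \<tau>]) auto
  moreover have "permutation \<sigma>" "permutation (map_permutation {..<n2} ((+) n1) \<tau>)"
    using \<sigma> m by (meson finite_lessThan finite_atLeastLessThan permutation_permutes)+
  ultimately show "sign (glue n1 n2 \<sigma> \<tau>) = sign \<sigma> * sign \<tau>"
    unfolding glue_eq[OF \<sigma>] by (simp add: sign_compose)
  have "glue n1 n2 \<sigma> \<tau> ` {..<n1} = \<sigma> ` {..<n1}" by (rule image_cong) (auto simp: glue_def)
  then show "glue n1 n2 \<sigma> \<tau> ` {..<n1} = {..<n1}" using permutes_image[OF \<sigma>] by simp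
qed

lemma bij_betw_glue:
  "bij_betw (\<lambda>(\<sigma>, \<tau>). glue n1 n2 \<sigma> \<tau>)
     ({\<sigma>. \<sigma> permutes {..<n1}} \<times> {\<tau>. \<tau> permutes {..<n2}})
     {G. G permutes {..<n1 + n2} \<and> G ` {..<n1} = {..<n1}}"
proof -
  let ?r = "\<lambda>G. (\<lambda>i. if i < n1 then G i else i :: nat, \<lambda>i. if i < n2 then G (n1 + i) - n1 else i)"
  have *: "G i < n1 \<longleftrightarrow> i < n1" "G i < n1 + n2 \<longleftrightarrow> i < n1 + n2"
    if "G permutes {..<n1 + n2}" "G ` {..<n1} = {..<n1}" for G i
  proof -
    have "inj G" using that by (metis permutes_inj)
    then show "G i < n1 \<longleftrightarrow> i < n1" using that(2) by (metis inj_image_mem_iff lessThan_iff)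
  qed (use that permutes_less in blast)
  show ?thesis
  proof (rule bij_betw_byWitness[where f' = ?r])
    show "\<forall>x\<in>{\<sigma>. \<sigma> permutes {..<n1}} \<times> {\<tau>. \<tau> permutes {..<n2}}. ?r (case x of (\<sigma>, \<tau>) \<Rightarrow> glue n1 n2 \<sigma> \<tau>) = x"
    proof
      fix x assume "x \<in> {\<sigma>. \<sigma> permutes {..<n1}} \<times> {\<tau>. \<tau> permutes {..<n2}}"
      then obtain \<sigma> \<tau> where x: "x = (\<sigma>, \<tau>)" and st: "\<sigma> permutes {..<n1}" "\<tau> permutes {..<n2}" by auto
      have "(if i < n1 then glue n1 n2 \<sigma> \<tau> i else i) = \<sigma> i" for i
        using permutes_not_in[OF st(1), of i] by (auto simp: glue_def)
      moreover have "(if i < n2 then glue n1 n2 \<sigma> \<tau> (n1 + i) - n1 else i) = \<tau> i" for i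
        using permutes_not_in[OF st(2), of i] by (auto simp: glue_def)
      ultimately show "?r (case x of (\<sigma>, \<tau>) \<Rightarrow> glue n1 n2 \<sigma> \<tau>) = x"
        unfolding x prod.case by (simp add: fun_eq_iff)
    qed
  next
    show "\<forall>G\<in>{G. G permutes {..<n1 + n2} \<and> G ` {..<n1} = {..<n1}}. (case ?r G of (\<sigma>, \<tau>) \<Rightarrow> glue n1 n2 \<sigma> \<tau>) = G"
    proof (intro ballI, elim CollectE conjE)
      fix G assume G: "G permutes {..<n1 + n2}" "G ` {..<n1} = {..<n1}"
      have "glue n1 n2 (fst (?r G)) (snd (?r G)) i = G i" for i
        using *[OF G, of i] permutes_not_in[OF G(1), of i] by (auto simp: glue_def)
      then show "(case ?r G of (\<sigma>, \<tau>) \<Rightarrow> glue n1 n2 \<sigma> \<tau>) = G" by auto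
    qed
  next
    show "(\<lambda>(\<sigma>, \<tau>). glue n1 n2 \<sigma> \<tau>) ` ({\<sigma>. \<sigma> permutes {..<n1}} \<times> {\<tau>. \<tau> permutes {..<n2}})
      \<subseteq> {G. G permutes {..<n1 + n2} \<and> G ` {..<n1} = {..<n1}}"
      using glue_permutes(1,3) by (intro image_subsetI) (simp add: case_prod_unfold mem_Times_iff)
  next
    show "?r ` {G. G permutes {..<n1 + n2} \<and> G ` {..<n1} = {..<n1}}
      \<subseteq> {\<sigma>. \<sigma> permutes {..<n1}} \<times> {\<tau>. \<tau> permutes {..<n2}}"
    proof (rule image_subsetI, elim CollectE conjE)
      fix G assume G: "G permutes {..<n1 + n2}" "G ` {..<n1} = {..<n1}"
      have inj: "G i = G j \<longleftrightarrow> i = j" for i j using permutes_inj[OF G(1)] by (auto dest: injD)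
      have ge: "n1 \<le> G (n1 + i)" "G (n1 + i) < n1 + n2 \<longleftrightarrow> i < n2" for i
        using *[OF G, of "n1 + i"] by simp_all
      have "fst (?r G) permutes {..<n1}"
      proof (rule bij_imp_permutes)
        have "inj_on (fst (?r G)) {..<n1}" by (auto simp: inj_on_def inj)
        moreover have "fst (?r G) ` {..<n1} \<subseteq> {..<n1}" using *[OF G] by auto
        ultimately show "bij_betw (fst (?r G)) {..<n1} {..<n1}"
          unfolding bij_betw_def using endo_inj_surj[OF finite_lessThan] by blast
      qed auto
      moreover have "snd (?r G) permutes {..<n2}"
      proof (rule bij_imp_permutes)
        have "inj_on (snd (?r G)) {..<n2}"
          using ge inj by (auto simp: inj_on_def) (metis add_left_cancel le_add_diff_inverse)
        moreover have "snd (?r G) ` {..<n2} \<subseteq> {..<n2}" using ge by (auto simp: less_diff_conv2 add.commute)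
        ultimately show "bij_betw (snd (?r G)) {..<n2} {..<n2}"
          unfolding bij_betw_def using endo_inj_surj[OF finite_lessThan] by blast
      qed auto
      ultimately show "?r G \<in> {\<sigma>. \<sigma> permutes {..<n1}} \<times> {\<tau>. \<tau> permutes {..<n2}}" by simp
    qed
  qed
qed

subsection \<open>Two rows as sums over placements of labels\<close>

text \<open>
  Positions below \<open>n1\<close> are the cells of the first row, the remaining ones below \<open>n\<close> those of the
  second row; \<open>q\<close> gives their columns. The labels \<open>i < n\<close> carry the letters \<open>u i\<close>.
\<close>

definition placement :: "('a \<Rightarrow> bit) \<Rightarrow> nat \<Rightarrow> (nat \<Rightarrow> 'a) \<Rightarrow> (nat \<Rightarrow> nat) \<Rightarrow> (nat \<Rightarrow> nat) \<Rightarrow>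
    ('a::linorder \<times> nat) multiset \<Rightarrow> int" where
  "placement par n u q F M = sign F * cw (lp_sign par) (map (\<lambda>i. (u i, q (F i))) [0..<n]) M"

text \<open>\<open>X\<close> is the set of labels sent to the upper row. All terms list the labels
  in the same order, so moving labels between the rows changes \<open>X\<close> but no sign
  convention.\<close>

definition two_rows :: "('a \<Rightarrow> bit) \<Rightarrow> nat \<Rightarrow> nat \<Rightarrow> (nat \<Rightarrow> 'a) \<Rightarrow> (nat \<Rightarrow> nat) \<Rightarrow> nat set \<Rightarrow>
    ('a::linorder \<times> nat) multiset \<Rightarrow> int" where
  "two_rows par n n1 u q X M =
     (\<Sum>F | F permutes {..<n} \<and> F ` X = {..<n1}. placement par n u q F M)"

lemma cf_row_poly_mult:
  "cf (lp_sign par) (row_poly n1 ((!) w1) ((!) p1) * row_poly n2 ((!) w2) ((!) p2)) M =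
    two_rows par (n1 + n2) n1 ((!) (w1 @ w2)) ((!) (p1 @ p2)) {..<n1} M"
  if l: "length w1 = n1" "length w2 = n2" "length p1 = n1" "length p2 = n2"
proof -
  let ?s = "lp_sign par" and ?P = "{\<sigma>. \<sigma> permutes {..<n1}} \<times> {\<tau>. \<tau> permutes {..<n2}}"
  have "cf ?s (row_poly n1 ((!) w1) ((!) p1) * row_poly n2 ((!) w2) ((!) p2)) M =
    (\<Sum>(\<sigma>, \<tau>)\<in>?P. sign \<sigma> * sign \<tau> * cw ?s (map (\<lambda>i. (w1 ! i, p1 ! \<sigma> i)) [0..<n1] @
      map (\<lambda>i. (w2 ! i, p2 ! \<tau> i)) [0..<n2]) M)"
    unfolding row_poly_def sum_product word_mult by (simp add: cf_sum cf_single sum.cartesian_product case_prod_unfold)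
  also have "\<dots> = (\<Sum>(\<sigma>, \<tau>)\<in>?P. placement par (n1 + n2) ((!) (w1 @ w2)) ((!) (p1 @ p2)) (glue n1 n2 \<sigma> \<tau>) M)"
  proof (rule sum.cong[OF refl], clarify)
    fix \<sigma> \<tau> assume st: "\<sigma> permutes {..<n1}" "\<tau> permutes {..<n2}"
    have "map (\<lambda>i. (w1 ! i, p1 ! \<sigma> i)) [0..<n1] @ map (\<lambda>i. (w2 ! i, p2 ! \<tau> i)) [0..<n2] =
        map (\<lambda>i. ((w1 @ w2) ! i, (p1 @ p2) ! glue n1 n2 \<sigma> \<tau> i)) [0..<n1 + n2]"
      by (intro nth_equalityI)
        (auto simp: l nth_append glue_def permutes_less[OF st(1)] permutes_less[OF st(2)])
    then show "sign \<sigma> * sign \<tau> * cw ?s (map (\<lambda>i. (w1 ! i, p1 ! \<sigma> i)) [0..<n1] @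
          map (\<lambda>i. (w2 ! i, p2 ! \<tau> i)) [0..<n2]) M =
        placement par (n1 + n2) ((!) (w1 @ w2)) ((!) (p1 @ p2)) (glue n1 n2 \<sigma> \<tau>) M"
      by (simp add: placement_def glue_permutes(2)[OF st])
  qed
  also have "\<dots> = two_rows par (n1 + n2) n1 ((!) (w1 @ w2)) ((!) (p1 @ p2)) {..<n1} M"
    unfolding two_rows_def
    by (subst sum.reindex_bij_betw[OF bij_betw_glue, symmetric]) (simp add: case_prod_unfold)
  finally show ?thesis .
qed

lemma permutes_comp_bij:
  assumes "F0 permutes S"
  shows "bij_betw (\<lambda>G. G \<circ> F0) {G. G permutes S \<and> G ` (F0 ` X) = Y} {F. F permutes S \<and> F ` X = Y}"
proof (rule bij_betw_byWitness[where f' = "\<lambda>F. F \<circ> inv_into UNIV F0"])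
  have i: "inv_into UNIV F0 permutes S" by (rule permutes_inv[OF assms])
  have o: "F0 \<circ> inv_into UNIV F0 = id" "inv_into UNIV F0 \<circ> F0 = id"
    by (rule permutes_inv_o[OF assms])+
  show "\<forall>a\<in>{G. G permutes S \<and> G ` (F0 ` X) = Y}. a \<circ> F0 \<circ> inv_into UNIV F0 = a"
    "\<forall>a\<in>{F. F permutes S \<and> F ` X = Y}. a \<circ> inv_into UNIV F0 \<circ> F0 = a"
    by (simp_all add: comp_assoc o)
  show "(\<lambda>G. G \<circ> F0) ` {G. G permutes S \<and> G ` (F0 ` X) = Y} \<subseteq> {F. F permutes S \<and> F ` X = Y}"
    using permutes_compose[OF assms] by (auto simp: image_comp)
  have "inv_into UNIV F0 ` (F0 ` X) = X" by (metis image_comp o(2) image_id id_apply)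
  then show "(\<lambda>F. F \<circ> inv_into UNIV F0) ` {F. F permutes S \<and> F ` X = Y} \<subseteq>
      {G. G permutes S \<and> G ` (F0 ` X) = Y}"
    using permutes_compose[OF i] by (intro image_subsetI) (simp only: mem_Collect_eq image_comp[symmetric] simp_thms)
qed

lemma sign_comp_permutes:
  "finite S \<Longrightarrow> G permutes S \<Longrightarrow> F permutes S \<Longrightarrow> sign (G \<circ> F) = sign G * sign F"
  by (intro sign_compose) (auto simp: permutation_permutes)

text \<open>Precomposition with \<open>F0\<close> matches the two sums term by term, and by
  \<open>cw_permute\<close> the sign is common to all placements and all monomials.\<close>

lemma two_rows_relabel:
  assumes F0: "F0 permutes {..<n}" and u: "\<And>i. i < n \<Longrightarrow> u i = v (F0 i)"
  obtains e where "unit_sign e" "\<And>M. two_rows par n n1 u q X M = e * two_rows par n n1 v q (F0 ` X) M"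
proof -
  obtain e where e: "unit_sign e"
    "\<And>g M. (\<And>i. i < n \<Longrightarrow> lp_sign par (g i) = par (v i) + 1) \<Longrightarrow>
      cw (lp_sign par) (map (g \<circ> F0) [0..<n]) M = e * cw (lp_sign par) (map g [0..<n]) M"
    using cw_permute[OF F0, of "lp_sign par" "\<lambda>i. par (v i) + 1"] by blast
  have "two_rows par n n1 u q X M = sign F0 * e * two_rows par n n1 v q (F0 ` X) M" for M
  proof -
    have "two_rows par n n1 u q X M =
        (\<Sum>G | G permutes {..<n} \<and> G ` (F0 ` X) = {..<n1}. placement par n u q (G \<circ> F0) M)"
      unfolding two_rows_def by (rule sum.reindex_bij_betw[OF permutes_comp_bij[OF F0], symmetric])
    also have "\<dots> = (\<Sum>G | G permutes {..<n} \<and> G ` (F0 ` X) = {..<n1}. sign F0 * e * placement par n v q G M)"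
    proof (rule sum.cong[OF refl])
      fix G assume G: "G \<in> {G. G permutes {..<n} \<and> G ` (F0 ` X) = {..<n1}}"
      have 1: "map (\<lambda>i. (u i, q ((G \<circ> F0) i))) [0..<n] = map ((\<lambda>i. (v i, q (G i))) \<circ> F0) [0..<n]"
        using u by simp
      have 2: "sign (G \<circ> F0) = sign G * sign F0" using G F0 by (intro sign_comp_permutes) auto
      have "cw (lp_sign par) (map ((\<lambda>i. (v i, q (G i))) \<circ> F0) [0..<n]) M =
          e * cw (lp_sign par) (map (\<lambda>i. (v i, q (G i))) [0..<n]) M"
        by (rule e(2)) (simp only: lp_sign_def case_prod_conv)
      then show "placement par n u q (G \<circ> F0) M = sign F0 * e * placement par n v q G M"
        unfolding placement_def 1 2 by simp
    qed
    finally show ?thesis by (simp add: two_rows_def sum_distrib_left)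
  qed
  then show thesis using that[of "sign F0 * e"] e(1) by (simp add: unit_sign_mult)
qed

section \<open>From placements of labels to products of rows\<close>

lemma cf_of_nat_mult: "cf s (of_nat c * p) M = int c * cf s p M"
  by (induction c) (simp_all add: cf_add algebra_simps)

lemma cf_of_int_mult: "cf s (of_int c * p) M = c * cf s p M"
proof -
  have pos: "cf s (of_int k * p) M = k * cf s p M" if k0: "k \<ge> 0" for k
  proof -
    obtain m where k: "k = int m" using zero_le_imp_eq_int[OF k0] by blast
    show ?thesis unfolding k using cf_of_nat_mult[of s m p M] by simp
  qed
  show ?thesis
  proof (cases "c \<ge> 0")
    case False
    have "of_int c * p = - (of_int (- c) * p)" by simp
    then have "cf s (of_int c * p) M = - cf s (of_int (- c) * p) M" by (simp only: cf_uminus)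
    then show ?thesis using pos[of "- c"] False by simp
  qed (rule pos)
qed

lemma cf_mult_scaled:
  assumes "\<And>M. cf s p M = a * cf s p' M" "\<And>M. cf s q M = b * cf s q' M"
  shows "cf s (p * q) M = a * b * cf s (p' * q') M"
proof -
  have "cf s p = cf s (of_int a * p')" "cf s q = cf s (of_int b * q')"
    by (simp_all add: fun_eq_iff cf_of_int_mult assms)
  then have "cf s (p * q) = cf s ((of_int a * p') * (of_int b * q'))"
    using cf_mult_cong_left cf_mult_cong_right by metis
  also have "(of_int a * p') * (of_int b * q') = of_int (a * b) * (p' * q')"
    by (metis (no_types) mult.assoc mult_of_int_commute of_int_mult)
  finally show ?thesis by (simp only: cf_of_int_mult)
qed

lemma content_fact_pos: "content_fact par w > 0"
  unfolding content_fact_def by (intro prod_pos) simp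

lemma cf_tab_sum_tab_poly:
  "cf s (tab_sum par w p) M = int (content_fact par w) * cf s (tab_poly par w p) M"
  unfolding content_fact_times_tab_poly[symmetric] by (rule cf_of_nat_mult)

text \<open>The bridge between labels and tableaux: any choice \<open>X\<close> of upper labels
  gives a nonzero integer multiple, independent of \<open>M\<close>, of a product of two rows. The
  factorials count the ways to tell equal positive letters apart by labels.\<close>

lemma two_rows_tab:
  fixes par :: "'a::linorder \<Rightarrow> bit"
  assumes l: "length w1 = n1" "length w2 = n2" "length p1 = n1" "length p2 = n2"
    and X: "X \<subseteq> {..<n1 + n2}"
    and w: "mset w1 = image_mset u (mset_set X)" "mset w2 = image_mset u (mset_set ({..<n1 + n2} - X))"
  obtains e where "unit_sign e" "\<And>M. two_rows par (n1 + n2) n1 u ((!) (p1 @ p2)) X M =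
     e * (int (content_fact par w1) * int (content_fact par w2) *
       cf (lp_sign par) (tab_poly par w1 p1 * tab_poly par w2 p2) M)"
proof -
  let ?n = "n1 + n2" and ?s = "lp_sign par" and ?v = "(!) (w1 @ w2)"
  have "map ?v [0..<n1] = w1" "map ?v [n1..<?n] = w2"
    by (rule nth_equalityI; simp add: l nth_append)+
  then have w': "image_mset ?v (mset_set {..<n1}) = mset w1" "image_mset ?v (mset_set {n1..<?n}) = mset w2"
    by (metis mset_map mset_upt atLeast0LessThan)+
  have split: "image_mset h (mset_set (A \<union> B)) = image_mset h (mset_set A) + image_mset h (mset_set B)"
    if "finite A" "finite B" "A \<inter> B = {}" for h :: "nat \<Rightarrow> 'a \<times> bool" and A B
    using that by (simp add: mset_set_Union)
  have const: "image_mset (\<lambda>i. (h i, b i)) (mset_set A) = image_mset (\<lambda>a. (a, c)) (image_mset h (mset_set A))"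
    if "\<And>i. i \<in> A \<Longrightarrow> b i = c" for h :: "nat \<Rightarrow> 'a" and b :: "nat \<Rightarrow> bool" and A c
  proof -
    have "image_mset (\<lambda>i. (h i, b i)) (mset_set A) = image_mset (\<lambda>i. (h i, c)) (mset_set A)"
      by (cases "finite A") (auto intro!: image_mset_cong simp: that)
    then show ?thesis by (simp add: image_mset.compositionality comp_def)
  qed
  have un: "{..<?n} = X \<union> ({..<?n} - X)" "{..<?n} = {..<n1} \<union> {n1..<?n}" using X by auto
  \<comment> \<open>Tagging each letter with its row reduces the search for a relabelling that
    respects letters and rows to an equality of multisets.\<close>
  have "image_mset (\<lambda>i. (u i, i \<in> X)) (mset_set {..<?n}) =
      image_mset (\<lambda>i. (u i, i \<in> X)) (mset_set X) + image_mset (\<lambda>i. (u i, i \<in> X)) (mset_set ({..<?n} - X))"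
    using finite_subset[OF X] by (subst un(1), intro split) auto
  also have "\<dots> = image_mset (\<lambda>a. (a, True)) (mset w1) + image_mset (\<lambda>a. (a, False)) (mset w2)"
    unfolding w by (subst (1 2) const) auto
  also have "\<dots> = image_mset (\<lambda>j. (?v j, j < n1)) (mset_set {..<n1}) +
      image_mset (\<lambda>j. (?v j, j < n1)) (mset_set {n1..<?n})"
    unfolding w'[symmetric] by (subst (1 2) const) auto
  also have "\<dots> = image_mset (\<lambda>j. (?v j, j < n1)) (mset_set {..<?n})"
    by (subst un(2), intro split[symmetric]) auto
  finally have mm: "image_mset (\<lambda>i. (u i, i \<in> X)) (mset_set {..<?n}) =
      image_mset (\<lambda>j. (?v j, j < n1)) (mset_set {..<?n})" .
  obtain F0 where F0: "F0 permutes {..<?n}" and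
    eq: "\<forall>i\<in>{..<?n}. (u i, i \<in> X) = (?v (F0 i), F0 i < n1)"
    by (rule image_mset_eq_implies_permutes[OF finite_lessThan mm])
  have uv: "u i = ?v (F0 i)" if "i < ?n" for i using eq that by simp
  have im: "F0 ` X = {..<n1}"
  proof (intro equalityI subsetI)
    fix j assume "j \<in> {..<n1}"
    then have j: "j < n1" by simp
    obtain i where i: "j = F0 i" using permutes_surj[OF F0] by (metis surjD)
    then have "i < ?n" using j permutes_less[OF F0, of i] by simp
    then show "j \<in> F0 ` X" using eq i j by auto
  qed (use X eq in auto)
  obtain e where e: "unit_sign e"
    "\<And>M. two_rows par ?n n1 u ((!) (p1 @ p2)) X M = e * two_rows par ?n n1 ?v ((!) (p1 @ p2)) (F0 ` X) M"
    using two_rows_relabel[OF F0, of u ?v, OF uv] by metis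
  have "two_rows par ?n n1 u ((!) (p1 @ p2)) X M = e * (row_sign par w1 * row_sign par w2) *
     (int (content_fact par w1) * int (content_fact par w2) *
       cf ?s (tab_poly par w1 p1 * tab_poly par w2 p2) M)" for M
  proof -
    have r: "cf ?s (row_poly (length w) ((!) w) ((!) p)) M =
        (row_sign par w * int (content_fact par w)) * cf ?s (tab_poly par w p) M" for w p M
      using cf_tab_sum[of par w p M] unit_sign_square[OF unit_sign_row_sign, of par w]
      unfolding cf_tab_sum_tab_poly by (metis mult.assoc mult_1)
    have "two_rows par ?n n1 ?v ((!) (p1 @ p2)) {..<n1} M =
        cf ?s (row_poly n1 ((!) w1) ((!) p1) * row_poly n2 ((!) w2) ((!) p2)) M"
      by (rule cf_row_poly_mult[OF l, symmetric])
    also have "\<dots> = (row_sign par w1 * int (content_fact par w1)) * (row_sign par w2 * int (content_fact par w2)) *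
        cf ?s (tab_poly par w1 p1 * tab_poly par w2 p2) M"
      using r[of w1 p1] r[of w2 p2] unfolding l by (rule cf_mult_scaled)
    finally show ?thesis unfolding e(2) im by (simp only: mult_ac)
  qed
  then show thesis
    using that[of "e * (row_sign par w1 * row_sign par w2)"] e(1) by (simp add: unit_sign_mult unit_sign_row_sign)
qed

section \<open>Symmetries coming from equal letters\<close>

lemma transpose_image_exchange:
  "i \<in> X \<Longrightarrow> j \<notin> X \<Longrightarrow> transpose i j ` X = insert j (X - {i})"
  by (auto simp: transpose_def image_iff)

text \<open>Generators with a positive letter are odd, so swapping the two labels gives one sign
  from the placement and one from the word; they cancel.\<close>

lemma two_rows_exchange:
  assumes ij: "i < n" "j < n" "i \<in> X" "j \<notin> X" and u: "u i = u j" "par (u i) = 0"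
  shows "two_rows par n n1 u q X M = two_rows par n n1 u q (insert j (X - {i})) M"
proof -
  let ?t = "transpose i j" and ?Y = "insert j (X - {i})"
  have t: "?t permutes {..<n}" using ij by (intro permutes_swap_id) auto
  have ut: "u (?t k) = u k" for k using u by (simp add: transpose_def)
  have "two_rows par n n1 u q X M =
      (\<Sum>G | G permutes {..<n} \<and> G ` (?t ` X) = {..<n1}. placement par n u q (G \<circ> ?t) M)"
    unfolding two_rows_def by (rule sum.reindex_bij_betw[OF permutes_comp_bij[OF t], symmetric])
  also have "\<dots> = (\<Sum>G | G permutes {..<n} \<and> G ` (?t ` X) = {..<n1}. placement par n u q G M)"
  proof (rule sum.cong[OF refl])
    fix G assume "G \<in> {G. G permutes {..<n} \<and> G ` (?t ` X) = {..<n1}}"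
    then have 2: "sign (G \<circ> ?t) = sign G * sign ?t" using t by (intro sign_comp_permutes) auto
    have 1: "map (\<lambda>i. (u i, q ((G \<circ> ?t) i))) [0..<n] = map ((\<lambda>i. (u i, q (G i))) \<circ> ?t) [0..<n]"
      by (simp add: ut)
    have "cw (lp_sign par) (map ((\<lambda>i. (u i, q (G i))) \<circ> ?t) [0..<n]) M =
        sign ?t * cw (lp_sign par) (map (\<lambda>i. (u i, q (G i))) [0..<n]) M"
      using u by (intro cw_permute_odd[OF t]) (auto simp: lp_sign_def ut transpose_def)
    then show "placement par n u q (G \<circ> ?t) M = placement par n u q G M"
      unfolding placement_def 1 2 by (simp add: mult.assoc)
  qed
  finally show ?thesis unfolding two_rows_def transpose_image_exchange[OF ij(3,4)] .
qed

text \<open>Generators with a negative letter are even, so a swap within a row gives only the sign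
  of the placement, and the sum equals its own negative.\<close>

lemma two_rows_repeated_negative:
  assumes ij: "i < n" "j < n" "i \<noteq> j" "i \<in> X \<longleftrightarrow> j \<in> X" and u: "u i = u j" "par (u i) = 1"
  shows "two_rows par n n1 u q X M = 0"
proof -
  let ?t = "transpose i j"
  have t: "?t permutes {..<n}" using ij by (intro permutes_swap_id) auto
  have ut: "u (?t k) = u k" for k using u by (simp add: transpose_def)
  have "two_rows par n n1 u q X M =
      (\<Sum>G | G permutes {..<n} \<and> G ` (?t ` X) = {..<n1}. placement par n u q (G \<circ> ?t) M)"
    unfolding two_rows_def by (rule sum.reindex_bij_betw[OF permutes_comp_bij[OF t], symmetric])
  also have "\<dots> = (\<Sum>G | G permutes {..<n} \<and> G ` (?t ` X) = {..<n1}. - placement par n u q G M)"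
  proof (rule sum.cong[OF refl])
    fix G assume "G \<in> {G. G permutes {..<n} \<and> G ` (?t ` X) = {..<n1}}"
    then have 2: "sign (G \<circ> ?t) = sign G * sign ?t" using t by (intro sign_comp_permutes) auto
    have 1: "map (\<lambda>i. (u i, q ((G \<circ> ?t) i))) [0..<n] = map ((\<lambda>i. (u i, q (G i))) \<circ> ?t) [0..<n]"
      by (simp add: ut)
    have "cw (lp_sign par) (map ((\<lambda>i. (u i, q (G i))) \<circ> ?t) [0..<n]) M =
        cw (lp_sign par) (map (\<lambda>i. (u i, q (G i))) [0..<n]) M"
      using u by (intro cw_permute_even[OF t]) (auto simp: lp_sign_def ut transpose_def)
    then show "placement par n u q (G \<circ> ?t) M = - placement par n u q G M"
      unfolding placement_def 1 2 using ij by (simp add: sign_swap_id)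
  qed
  also have "?t ` X = X" using ij by (auto simp: transpose_def image_iff)
  finally show ?thesis by (simp add: two_rows_def sum_negf)
qed

text \<open>The labels of \<open>X\<close> outside \<open>X'\<close> are exchanged one at a time for
  labels of \<open>X'\<close> with the same letter.\<close>

lemma two_rows_same_letters:
  assumes "X \<subseteq> {..<n}" "X' \<subseteq> {..<n}"
    and "image_mset u (mset_set X) = image_mset u (mset_set X')"
    and "\<And>i. i \<in> X - X' \<Longrightarrow> par (u i) = 0"
  shows "two_rows par n n1 u q X M = two_rows par n n1 u q X' M"
  using assms
proof (induction "card (X - X')" arbitrary: X)
  case 0
  then have fin: "finite X" "finite X'" using finite_subset by blast+
  then have "X \<subseteq> X'" using 0 by simp
  moreover have "card X = card X'" using arg_cong[OF 0(4), of size] fin by simp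
  ultimately show ?case using fin card_subset_eq by metis
next
  case (Suc k)
  then have fin: "finite X" "finite X'" using finite_subset by blast+
  have "X - X' \<noteq> {}" using Suc.hyps(2) by (metis card.empty nat.distinct(1))
  then obtain i where i: "i \<in> X" "i \<notin> X'" by blast
  have split: "mset_set A = mset_set (A \<inter> B) + mset_set (A - B)" if "finite A" for A B :: "nat set"
    using that by (subst mset_set_Union[symmetric]) (auto simp: Int_Diff_Un)
  have "image_mset u (mset_set (X - X')) = image_mset u (mset_set (X' - X))"
    using Suc.prems(3) split[of X X'] split[of X' X] fin by (simp add: Int_commute)
  moreover have "u i \<in># image_mset u (mset_set (X - X'))" using i fin by auto
  ultimately have "u i \<in># image_mset u (mset_set (X' - X))" by metis
  then obtain j where j: "j \<in> X'" "j \<notin> X" "u j = u i" using fin by auto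
  let ?Y = "insert j (X - {i})"
  have Y: "?Y - X' = (X - X') - {i}" using j by auto
  have "two_rows par n n1 u q X M = two_rows par n n1 u q ?Y M"
    using i j Suc.prems by (intro two_rows_exchange) auto
  also have "\<dots> = two_rows par n n1 u q X' M"
  proof (rule Suc.hyps(1))
    show "k = card (?Y - X')" unfolding Y using Suc.hyps(2) i fin by simp
    have "mset_set X = add_mset i (mset_set (X - {i}))" using i fin by (metis mset_set.remove)
    moreover have "mset_set ?Y = add_mset j (mset_set (X - {i}))" using j fin by simp
    ultimately show "image_mset u (mset_set ?Y) = image_mset u (mset_set X')"
      using Suc.prems(3) j by simp
    show "par (u l) = 0" if "l \<in> ?Y - X'" for l using that Suc.prems(4) unfolding Y by simp
  qed (use Suc.prems j in auto)
  finally show ?case .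
qed

text \<open>Garnir relation: exchanging two free labels placed in the same column flips the sign.\<close>

lemma two_rows_Garnir:
  assumes Z: "Z \<subseteq> {..<n}" and C: "C \<subseteq> {..<n}" and n1: "n1 \<le> n"
    and big: "card (q ` {..<n}) < card ({..<n} - Z - C)"
  shows "(\<Sum>X | X \<subseteq> {..<n} \<and> card X = n1 \<and> Z \<subseteq> X \<and> X \<inter> C = {}. two_rows par n n1 u q X M) = 0"
proof -
  let ?W = "{..<n} - Z - C"
  \<comment> \<open>Labels in \<open>Z\<close> are confined to the upper row and those in
    \<open>C\<close> to the lower one. Splitting \<open>S\<close> by the set of labels in the upper
    row gives the sum in question.\<close>
  define S where "S = {F. F permutes {..<n} \<and> F ` Z \<subseteq> {..<n1} \<and> F ` C \<inter> {..<n1} = {}}"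
  define T where "T = {X. X \<subseteq> {..<n} \<and> card X = n1 \<and> Z \<subseteq> X \<and> X \<inter> C = {}}"
  let ?g = "\<lambda>F. {i. i < n \<and> F i < n1}"
  have finS: "finite S" unfolding S_def
    by (rule finite_subset[OF _ finite_permutations[of "{..<n}"]]) auto
  have finT: "finite T" unfolding T_def by (rule finite_subset[of _ "Pow {..<n}"]) auto
  have img: "F ` ?g F = {..<n1}" if F: "F permutes {..<n}" for F
  proof
    show "{..<n1} \<subseteq> F ` ?g F"
    proof
      fix j assume j: "j \<in> {..<n1}"
      obtain i where "j = F i" using permutes_surj[OF F] by (metis surjD)
      then show "j \<in> F ` ?g F" using j n1 permutes_less[OF F, of i] by auto
    qed
  qed auto
  have inj: "inj_on F A" if "F permutes {..<n}" for F A
    using permutes_inj[OF that] by (rule inj_on_subset) simp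
  have gS: "?g ` S \<subseteq> T"
  proof (rule image_subsetI)
    fix F assume F: "F \<in> S"
    then have p: "F permutes {..<n}" by (simp add: S_def)
    have "card (?g F) = n1" using card_image[OF inj[OF p], of "?g F"] img[OF p] by simp
    then show "?g F \<in> T" using F Z C by (auto simp: S_def T_def)
  qed
  have fib: "{F \<in> S. ?g F = X} = {F. F permutes {..<n} \<and> F ` X = {..<n1}}" if X: "X \<in> T" for X
  proof (intro equalityI subsetI)
    fix F assume "F \<in> {F. F permutes {..<n} \<and> F ` X = {..<n1}}"
    then have p: "F permutes {..<n}" and FX: "F ` X = {..<n1}" by auto
    have "i \<in> X \<longleftrightarrow> F i < n1" for i
      using FX permutes_inj[OF p] by (metis inj_image_mem_iff lessThan_iff)
    then show "F \<in> {F \<in> S. ?g F = X}" using X p by (auto simp: S_def T_def)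
  qed (auto simp: S_def img)
  have "(\<Sum>X\<in>T. two_rows par n n1 u q X M) = (\<Sum>X\<in>T. \<Sum>F | F \<in> S \<and> ?g F = X. placement par n u q F M)"
    by (rule sum.cong) (simp_all only: two_rows_def fib)
  also have "\<dots> = (\<Sum>F\<in>S. placement par n u q F M)"
    by (rule sum.group[OF finS finT gS])
  also have "\<dots> = 0"
  proof -
    define P where "P h i j \<longleftrightarrow> i \<in> ?W \<and> j \<in> ?W \<and> i \<noteq> j \<and> h i = h j" for h :: "nat \<Rightarrow> nat" and i j
    \<comment> \<open>The two labels to be swapped are chosen as a function of
      \<open>q \<circ> F\<close> alone. The swap does not change \<open>q \<circ> F\<close>, so the
      same pair is chosen again and the map is an involution.\<close>
    define ch where "ch h = (SOME ij. P h (fst ij) (snd ij))" for h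
    define t where "t F = transpose (fst (ch (q \<circ> F))) (snd (ch (q \<circ> F)))" for F :: "nat \<Rightarrow> nat"
    have chP: "P (q \<circ> F) (fst (ch (q \<circ> F))) (snd (ch (q \<circ> F)))" if F: "F \<in> S" for F
    proof -
      have "F ` {..<n} = {..<n}" using F by (auto simp: S_def permutes_image)
      then have "(q \<circ> F) ` ?W \<subseteq> q ` {..<n}" by auto
      then have "card ((q \<circ> F) ` ?W) \<le> card (q ` {..<n})" by (intro card_mono) auto
      with big have "\<not> inj_on (q \<circ> F) ?W" using card_image by fastforce
      then obtain i j where "P (q \<circ> F) i j" unfolding inj_on_def P_def by blast
      then have "\<exists>ij. P (q \<circ> F) (fst ij) (snd ij)" by auto
      then show ?thesis unfolding ch_def by (rule someI_ex)
    qed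
    have qt: "q \<circ> (F \<circ> t F) = q \<circ> F" if "F \<in> S" for F
      using chP[OF that] by (auto simp: P_def t_def transpose_def)
    have tt: "t (F \<circ> t F) = t F" if "F \<in> S" for F
      using t_def[of "F \<circ> t F"] t_def[of F] unfolding qt[OF that] by (rule trans[OF _ sym])
    have tp: "t F permutes {..<n}" if "F \<in> S" for F
      using chP[OF that] unfolding t_def P_def by (intro permutes_swap_id) auto
    have tS: "F \<circ> t F \<in> S" if "F \<in> S" for F
    proof -
      have "t F i = i" if "i \<in> Z \<union> C" for i
        using chP[OF \<open>F \<in> S\<close>] that by (auto simp: P_def t_def transpose_def)
      then have "(F \<circ> t F) ` Z = F ` Z" "(F \<circ> t F) ` C = F ` C" by auto
      then show ?thesis using that permutes_compose[OF tp[OF that], of F] by (simp add: S_def)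
    qed
    have inv: "(F \<circ> t F) \<circ> t (F \<circ> t F) = F" if "F \<in> S" for F
      unfolding tt[OF that] by (simp add: t_def comp_assoc)
    have neg: "placement par n u q (F \<circ> t F) M = - placement par n u q F M" if F: "F \<in> S" for F
    proof -
      have 1: "q ((F \<circ> t F) i) = q (F i)" for i using fun_cong[OF qt[OF F], of i] by simp
      have "sign (F \<circ> t F) = sign F * sign (t F)"
        using F tp[OF F] by (intro sign_comp_permutes) (auto simp: S_def)
      also have "sign (t F) = - 1" using chP[OF F] by (auto simp: t_def P_def sign_swap_id)
      finally have 2: "sign (F \<circ> t F) = sign F * - 1" .
      show ?thesis unfolding placement_def 1 2 by simp
    qed
    have "(\<Sum>F\<in>S. placement par n u q F M) = (\<Sum>F\<in>S. placement par n u q (F \<circ> t F) M)"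
      by (rule sum.reindex_bij_witness[where i = "\<lambda>F. F \<circ> t F" and j = "\<lambda>F. F \<circ> t F"])
        (simp_all add: inv tS)
    also have "\<dots> = - (\<Sum>F\<in>S. placement par n u q F M)" by (simp add: neg sum_negf)
    finally show ?thesis by simp
  qed
  finally show ?thesis by (simp add: T_def)
qed

subsection \<open>Rational closure and relations\<close>

text \<open>Closure under rational linear combinations, expressed over the integers: the last clause
  allows a nonzero factor to be cancelled.\<close>

definition rat_closed :: "(('m \<Rightarrow> int) \<Rightarrow> bool) \<Rightarrow> bool" where
  "rat_closed Q \<longleftrightarrow> Q (\<lambda>_. 0) \<and> (\<forall>x y. Q x \<longrightarrow> Q y \<longrightarrow> Q (\<lambda>M. x M + y M)) \<and>
     (\<forall>c x. Q x \<longrightarrow> Q (\<lambda>M. c * x M)) \<and> (\<forall>k x. k \<noteq> 0 \<longrightarrow> Q (\<lambda>M. k * x M) \<longrightarrow> Q x)"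

lemma rat_closedD:
  assumes "rat_closed Q"
  shows rat_closed_zero: "Q (\<lambda>_. 0)"
    and rat_closed_add: "Q x \<Longrightarrow> Q y \<Longrightarrow> Q (\<lambda>M. x M + y M)"
    and rat_closed_scale: "Q x \<Longrightarrow> Q (\<lambda>M. c * x M)"
    and rat_closed_divide: "k \<noteq> 0 \<Longrightarrow> Q (\<lambda>M. k * x M) \<Longrightarrow> Q x"
  using assms unfolding rat_closed_def by blast+

lemma rat_closed_sum:
  assumes "rat_closed Q" "\<And>i. i \<in> A \<Longrightarrow> Q (g i)"
  shows "Q (\<lambda>M. \<Sum>i\<in>A. c i * g i M)"
  using assms(2)
proof (induction A rule: infinite_finite_induct)
  case (insert i A)
  then have "Q (\<lambda>M. c i * g i M + (\<Sum>i\<in>A. c i * g i M))"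
    by (intro rat_closed_add[OF assms(1)] rat_closed_scale[OF assms(1)]) auto
  then show ?case using insert.hyps by simp
qed (simp_all add: rat_closed_zero[OF assms(1)])

text \<open>Terms equal to \<open>g X0\<close> all have coefficient 1, so they add up to a positive
  multiple of it and cannot cancel. Dividing by this multiplicity is where rational coefficients are
  needed.\<close>

lemma relation_step:
  assumes Q: "rat_closed Q" and fin: "finite T" and X0: "X0 \<in> T" "c X0 = 1"
    and rel: "\<And>M. (\<Sum>X\<in>T. c X * g X M) = 0"
    and cls: "\<And>X. X \<in> T \<Longrightarrow> (c X = 1 \<and> g X = g X0) \<or> Q (g X)"
  shows "Q (g X0)"
proof -
  let ?E = "{X \<in> T. c X = 1 \<and> g X = g X0}"
  have "int (card ?E) * g X0 M = (\<Sum>X\<in>T - ?E. (- c X) * g X M)" for M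
  proof -
    have "0 = (\<Sum>X\<in>T - ?E. c X * g X M) + (\<Sum>X\<in>?E. c X * g X M)"
      using rel[of M] sum.subset_diff[of ?E T "\<lambda>X. c X * g X M"] fin by auto
    moreover have "(\<Sum>X\<in>?E. c X * g X M) = (\<Sum>X\<in>?E. g X0 M)" by (rule sum.cong) auto
    ultimately show ?thesis by (simp add: sum_negf)
  qed
  moreover have "Q (\<lambda>M. \<Sum>X\<in>T - ?E. (- c X) * g X M)"
    using cls by (intro rat_closed_sum[OF Q]) blast
  ultimately have "Q (\<lambda>M. int (card ?E) * g X0 M)" by simp
  moreover have "int (card ?E) \<noteq> 0" using X0 fin by (auto simp: card_eq_0_iff)
  ultimately show ?thesis by (rule rat_closed_divide[OF Q, rotated])
qed

text \<open>
  Inclusion-exclusion over \<open>Z\<close> turns the Garnir relations into an exchange between the labels in \<open>Z\<close>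
  and the remaining free ones.
\<close>

lemma two_rows_inclusion_exclusion:
  assumes n: "n = n1 + n2" and C: "C \<subseteq> {n1..<n}" and Z: "Z \<subseteq> {..<n1}"
    and q: "card (q ` {..<n}) \<le> n1" and m: "card C + m = n2"
  shows "(\<Sum>X | X \<subseteq> {..<n} \<and> card X = n1 \<and> Z \<subseteq> X \<and> X \<inter> C = {}. two_rows par n n1 u q X M) =
    (- 1) ^ m * (\<Sum>V | V \<subseteq> Z \<and> card V = m. two_rows par n n1 u q ({..<n} - (C \<union> V)) M)"
proof -
  let ?R = "\<lambda>X. two_rows par n n1 u q X M"
  define T where "T V = {X. X \<subseteq> {..<n} \<and> card X = n1 \<and> X \<inter> (C \<union> V) = {}}" for V
  have finT: "finite (T V)" for V
    unfolding T_def by (rule finite_subset[of _ "Pow {..<n}"]) auto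
  have finZ: "finite Z" and finC: "finite C" using Z C finite_subset by blast+
  have "x \<notin> Z" if "x \<in> C" for x using subsetD[OF C that] subsetD[OF Z, of x] by auto
  then have CZ: "C \<inter> Z = {}" by blast
  have alt: "(\<Sum>V\<in>Pow W. (- 1) ^ card V) = (if W = {} then 1 else 0 :: int)" if "finite W" for W :: "nat set"
    using that
  proof induction
    case (insert w W)
    have "(\<Sum>V\<in>Pow (insert w W). (- 1 :: int) ^ card V) =
        (\<Sum>V\<in>Pow W. (- 1) ^ card V) + (\<Sum>V\<in>insert w ` Pow W. (- 1) ^ card V)"
      unfolding Pow_insert using insert.hyps by (intro sum.union_disjoint) auto
    also have "(\<Sum>V\<in>insert w ` Pow W. (- 1 :: int) ^ card V) = (\<Sum>V\<in>Pow W. (- 1) ^ card (insert w V))"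
      using insert.hyps by (intro sum.reindex_cong[of "insert w"]) (auto simp: inj_on_def)
    also have "\<dots> = (\<Sum>V\<in>Pow W. - ((- 1) ^ card V))"
    proof (rule sum.cong[OF refl])
      fix V assume "V \<in> Pow W"
      then have "finite V" "w \<notin> V" using insert.hyps finite_subset by blast+
      then show "(- 1 :: int) ^ card (insert w V) = - ((- 1) ^ card V)" by simp
    qed
    finally show ?case by (simp add: sum_negf)
  qed simp
  \<comment> \<open>The condition that \<open>X\<close> contains \<open>Z\<close> is expanded as an
    alternating sum over the sets \<open>V\<close> of labels of \<open>Z\<close> that
    \<open>X\<close> avoids.\<close>
  have "(\<Sum>X | X \<subseteq> {..<n} \<and> card X = n1 \<and> Z \<subseteq> X \<and> X \<inter> C = {}. ?R X) =
      (\<Sum>X\<in>T {}. (if Z - X = {} then 1 else 0) * ?R X)"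
    by (rule sum.mono_neutral_cong_left[OF finT]) (auto simp: T_def)
  also have "\<dots> = (\<Sum>X\<in>T {}. \<Sum>V\<in>Pow Z. if V \<inter> X = {} then (- 1) ^ card V * ?R X else 0)"
  proof (rule sum.cong[OF refl])
    fix X
    have "(if Z - X = {} then 1 else 0) * ?R X = (\<Sum>V\<in>Pow (Z - X). (- 1) ^ card V * ?R X)"
      using alt[of "Z - X"] finZ by (simp flip: sum_distrib_right)
    also have "\<dots> = (\<Sum>V\<in>Pow Z. if V \<inter> X = {} then (- 1) ^ card V * ?R X else 0)"
      using finZ by (intro sum.mono_neutral_cong_left) auto
    finally show "(if Z - X = {} then 1 else 0) * ?R X =
        (\<Sum>V\<in>Pow Z. if V \<inter> X = {} then (- 1) ^ card V * ?R X else 0)" .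
  qed
  also have "\<dots> = (\<Sum>V\<in>Pow Z. \<Sum>X\<in>T {}. if V \<inter> X = {} then (- 1) ^ card V * ?R X else 0)"
    by (rule sum.swap)
  also have "\<dots> = (\<Sum>V\<in>Pow Z. (- 1) ^ card V * (\<Sum>X\<in>T V. ?R X))"
  proof (rule sum.cong[OF refl])
    fix V
    have "(\<Sum>X\<in>T {}. if V \<inter> X = {} then (- 1) ^ card V * ?R X else 0) = (\<Sum>X\<in>T V. (- 1) ^ card V * ?R X)"
      by (rule sum.mono_neutral_cong_right[OF finT]) (auto simp: T_def)
    then show "(\<Sum>X\<in>T {}. if V \<inter> X = {} then (- 1) ^ card V * ?R X else 0) = (- 1) ^ card V * (\<Sum>X\<in>T V. ?R X)"
      by (simp add: sum_distrib_left)
  qed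
  also have "\<dots> = (\<Sum>V | V \<subseteq> Z \<and> card V = m. (- 1) ^ card V * ?R ({..<n} - (C \<union> V)))"
  proof (rule sum.mono_neutral_cong_right)
    have card: "card (C \<union> V) = card C + card V" if "V \<subseteq> Z" for V
      using that finC finZ CZ by (intro card_Un_disjoint) (auto intro: finite_subset)
    have sub: "C \<union> V \<subseteq> {..<n}" if "V \<subseteq> Z" for V using that C Z n by auto
    have cc: "card ({..<n} - (C \<union> V)) + (card C + card V) = n" if "V \<subseteq> Z" for V
      using card_mono[OF _ sub[OF that]] card_Diff_subset[OF finite_subset[OF sub[OF that]] sub[OF that]]
        card[OF that] by simp
    \<comment> \<open>Outside \<open>C \<union> V\<close> there are \<open>n1 + m - card V\<close>
      labels. If \<open>V\<close> is too small, these exceed the number of columns and a Garnir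
      relation applies; if it is too large, they cannot fill the upper row. For
      \<open>card V = m\<close> the upper row is forced.\<close>
    show "\<forall>V\<in>Pow Z - {V. V \<subseteq> Z \<and> card V = m}. (- 1) ^ card V * (\<Sum>X\<in>T V. ?R X) = 0"
    proof
      fix V assume V: "V \<in> Pow Z - {V. V \<subseteq> Z \<and> card V = m}"
      then consider "card V < m" | "card V > m" by force
      then have "(\<Sum>X\<in>T V. ?R X) = 0"
      proof cases
        case 1
        have "card (q ` {..<n}) < card ({..<n} - {} - (C \<union> V))"
          using 1 V cc[of V] q m n by simp
        from two_rows_Garnir[OF _ _ _ this, of n1 par u M] show ?thesis
          using V sub[of V] n by (simp add: T_def)
      next
        case 2
        have "card X < n1" if "X \<subseteq> {..<n}" "X \<inter> (C \<union> V) = {}" for X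
        proof -
          have "X \<subseteq> {..<n} - (C \<union> V)" using that by blast
          then have "card X \<le> card ({..<n} - (C \<union> V))" by (intro card_mono) auto
          then show ?thesis using 2 V cc[of V] m n by simp
        qed
        then have "T V = {}" by (auto simp: T_def)
        then show ?thesis by simp
      qed
      then show "(- 1) ^ card V * (\<Sum>X\<in>T V. ?R X) = 0" by simp
    qed
    fix V assume "V \<in> {V. V \<subseteq> Z \<and> card V = m}"
    then have V: "V \<subseteq> Z" "card V = m" by auto
    have c: "card ({..<n} - (C \<union> V)) = n1" using cc[OF V(1)] V m n by simp
    have "T V = {{..<n} - (C \<union> V)}"
    proof (intro equalityI subsetI)
      fix X assume X: "X \<in> T V"
      then have "X \<subseteq> {..<n} - (C \<union> V)" "card X = n1" by (auto simp: T_def)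
      then show "X \<in> {{..<n} - (C \<union> V)}" using c card_subset_eq[of "{..<n} - (C \<union> V)" X] by simp
    qed (use c in \<open>auto simp: T_def\<close>)
    then show "(- 1) ^ card V * (\<Sum>X\<in>T V. ?R X) = (- 1) ^ card V * ?R ({..<n} - (C \<union> V))" by simp
  qed (use finZ in auto)
  also have "\<dots> = (- 1) ^ m * (\<Sum>V | V \<subseteq> Z \<and> card V = m. ?R ({..<n} - (C \<union> V)))"
    by (simp add: sum_distrib_left)
  finally show ?thesis .
qed

subsection \<open>A lexicographic measure for two rows\<close>

text \<open>Comparison of digits in base \<open>G\<close>: the digits below position
  \<open>pos d\<close>, even if all equal to \<open>G - 1\<close>, add up to less than one unit at
  that position.\<close>

lemma lex_sum_less:
  fixes f g :: "'b \<Rightarrow> nat" and pos :: "'b \<Rightarrow> nat"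
  assumes "finite S" "inj_on pos S" "d \<in> S" "f d < g d"
    and eq: "\<And>e. e \<in> S \<Longrightarrow> pos d < pos e \<Longrightarrow> f e = g e" and bd: "\<And>e. e \<in> S \<Longrightarrow> f e < G"
  shows "(\<Sum>e\<in>S. f e * G ^ pos e) < (\<Sum>e\<in>S. g e * G ^ pos e)"
proof -
  let ?hi = "{e \<in> S. pos d < pos e}" and ?lo = "{e \<in> S. pos e < pos d}"
  have S: "S = insert d (?hi \<union> ?lo)" using assms(2,3) by (auto simp: inj_on_def) (metis linorder_neqE_nat)
  have split: "(\<Sum>e\<in>S. h e) = h d + ((\<Sum>e\<in>?hi. h e) + (\<Sum>e\<in>?lo. h e))" for h :: "'b \<Rightarrow> nat"
    by (subst S, subst sum.insert, use assms(1) in simp, simp, subst sum.union_disjoint)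
      (use assms(1) in auto)
  have "(\<Sum>e\<in>?lo. f e * G ^ pos e) \<le> (\<Sum>e\<in>?lo. (G - 1) * G ^ pos e)"
    using bd by (intro sum_mono mult_right_mono) (fastforce simp: less_eq_Suc_le)+
  also have "\<dots> = (\<Sum>k\<in>pos ` ?lo. (G - 1) * G ^ k)"
    using assms(2) by (subst sum.reindex) (auto simp: inj_on_def)
  also have "\<dots> \<le> (\<Sum>k<pos d. (G - 1) * G ^ k)" by (rule sum_mono2) auto
  also have "\<dots> < G ^ pos d"
  proof -
    have G: "G > 0" using bd[OF assms(3)] by simp
    have "(\<Sum>k<m. (G - 1) * G ^ k) + 1 = G ^ m" for m
    proof (induction m)
      case (Suc m)
      have "(\<Sum>k<Suc m. (G - 1) * G ^ k) + 1 = G ^ m + (G - 1) * G ^ m" using Suc by simp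
      also have "\<dots> = (1 + (G - 1)) * G ^ m" by (simp only: distrib_right mult_1)
      finally show ?case using G by simp
    qed simp
    from this[of "pos d"] show ?thesis by linarith
  qed
  finally have lo: "(\<Sum>e\<in>?lo. f e * G ^ pos e) < G ^ pos d" .
  have hi: "(\<Sum>e\<in>?hi. f e * G ^ pos e) = (\<Sum>e\<in>?hi. g e * G ^ pos e)" by (rule sum.cong) (auto simp: eq)
  have "f d * G ^ pos d + G ^ pos d \<le> g d * G ^ pos d"
    using mult_le_mono1[of "Suc (f d)" "g d" "G ^ pos d"] assms(4) by simp
  then show ?thesis
    unfolding split[of "\<lambda>e. f e * G ^ pos e"] split[of "\<lambda>e. g e * G ^ pos e"] using lo hi by linarith
qed

lemma inj_on_card_less: "finite S \<Longrightarrow> inj_on (\<lambda>d::'b::linorder. card {e \<in> S. e < d}) S"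
  and card_less_mono: "finite S \<Longrightarrow> d \<in> S \<Longrightarrow> d < e \<Longrightarrow> card {x \<in> S. x < d} < card {x \<in> S. x < (e::'b)}"
proof -
  show *: "card {x \<in> S. x < d} < card {x \<in> S. x < e}" if "finite S" "d \<in> S" "d < e" for d e :: 'b
    using that by (intro psubset_card_mono) auto
  show "inj_on (\<lambda>d::'b. card {e \<in> S. e < d}) S" if "finite S"
  proof (rule inj_onI)
    fix x y assume "x \<in> S" "y \<in> S" "card {e \<in> S. e < x} = card {e \<in> S. e < y}"
    then show "x = y" using *[OF that, of x y] *[OF that, of y x] by (cases x y rule: linorder_cases) auto
  qed
qed

text \<open>
  A two-rowed tableau with letters \<open>K\<close> is given by the multiset \<open>N\<close> of its lower row. Reading the letters
  downwards, \<open>height\<close> counts the lower row minus the upper row, started at the difference \<open>\<delta>\<close> of the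
  right ends. The measure prefers large letters in the lower row until the height
  would become negative, and small ones below that point.
\<close>

context
  fixes par :: "'a::linorder \<Rightarrow> bit" and K :: "'a multiset" and \<delta> :: int
begin

definition height :: "'a multiset \<Rightarrow> 'a \<Rightarrow> int" where
  "height N d = \<delta> + (\<Sum>e\<in>{e \<in> set_mset K. d < e}. 2 * int (count N e) - int (count K e))"

text \<open>For sorted rows this says that the upper entries from \<open>e\<close> up start no
  further left than the lower entries above \<open>e\<close> (\<open>e\<close> positive) or from
  \<open>e\<close> up (\<open>e\<close> negative). Then no upper copy of \<open>e\<close> belongs to
  an inversion.\<close>

definition continues :: "'a multiset \<Rightarrow> 'a \<Rightarrow> bool" where
  "continues N e \<longleftrightarrow> (if par e = 0 then int (count K e - count N e) \<le> height N e
     else 0 \<le> height N e + 2 * int (count N e) - int (count K e))"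

definition alive :: "'a multiset \<Rightarrow> 'a \<Rightarrow> bool" where
  "alive N d \<longleftrightarrow> (\<forall>e\<in>set_mset K. d < e \<longrightarrow> continues N e)"

text \<open>Preference among the possible counts of \<open>d\<close>: while alive, few upper copies
  as long as the height admits them; beyond that, and once dead, few lower copies. The offset
  \<open>height + 1\<close> puts the second range above the first and still keeps the rank at most
  \<open>count K d\<close>.\<close>

definition letter_rank :: "'a multiset \<Rightarrow> 'a \<Rightarrow> nat" where
  "letter_rank N d = (if alive N d
     then if int (count K d - count N d) \<le> height N d then count K d - count N d
          else nat (height N d) + 1 + count N d
     else count N d)"

text \<open>Larger letters are more significant digits; the base exceeds every rank because ranks
  are bounded by counts.\<close>

definition row_measure :: "'a multiset \<Rightarrow> nat" where
  "row_measure N = (\<Sum>d\<in>set_mset K. letter_rank N d * (size K + 1) ^ card {e \<in> set_mset K. e < d})"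

lemma height_cong:
  "(\<And>e. e \<in># K \<Longrightarrow> d < e \<Longrightarrow> count N' e = count N e) \<Longrightarrow> height N' d = height N d"
  unfolding height_def by (auto intro!: sum.cong)

lemma continues_cong:
  "(\<And>e. e \<in># K \<Longrightarrow> d \<le> e \<Longrightarrow> count N' e = count N e) \<Longrightarrow> d \<in># K \<Longrightarrow> continues N' d \<longleftrightarrow> continues N d"
  using height_cong[of d N' N] unfolding continues_def by auto

lemma alive_cong:
  assumes "\<And>e. e \<in># K \<Longrightarrow> d < e \<Longrightarrow> count N' e = count N e"
  shows "alive N' d \<longleftrightarrow> alive N d"
  unfolding alive_def
  by (intro ball_cong imp_cong refl continues_cong) (use assms in auto)

lemma height_step:
  assumes "e \<in># K" "d < e" "\<And>x. x \<in># K \<Longrightarrow> d < x \<Longrightarrow> e \<le> x"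
  shows "height N d = height N e + 2 * int (count N e) - int (count K e)"
proof -
  have "{x \<in> set_mset K. d < x} = insert e {x \<in> set_mset K. e < x}" using assms by force
  then show ?thesis unfolding height_def by simp
qed

lemma height_next:
  assumes "height N d \<noteq> \<delta>"
  obtains e where "e \<in># K" "d < e" "\<And>x. x \<in># K \<Longrightarrow> d < x \<Longrightarrow> e \<le> x"
    "height N d = height N e + 2 * int (count N e) - int (count K e)"
proof -
  let ?A = "{x \<in> set_mset K. d < x}"
  have A: "finite ?A" "?A \<noteq> {}"
  proof -
    show "?A \<noteq> {}"
    proof
      assume "?A = {}"
      then have "height N d = \<delta>" unfolding height_def by (simp only: sum.empty add_0_right)
      with assms show False by simp
    qed
  qed simp
  have "Min ?A \<in># K" "d < Min ?A" using Min_in[OF A] by auto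
  moreover have "Min ?A \<le> x" if "x \<in># K" "d < x" for x using Min_le[OF A(1)] that by auto
  ultimately show thesis using that height_step by blast
qed

text \<open>The height at \<open>d\<close> is the one reached after the next larger letter, and
  continuing at that letter keeps it nonnegative.\<close>

lemma alive_height:
  assumes "\<delta> \<ge> 0" "alive N d" "N \<subseteq># K"
  shows "height N d \<ge> 0"
proof (cases "height N d = \<delta>")
  case False
  then obtain e where e: "e \<in># K" "d < e" and h: "height N d = height N e + 2 * int (count N e) - int (count K e)"
    by (rule height_next)
  have "continues N e" using assms(2) e by (simp add: alive_def)
  moreover have "count N e \<le> count K e" using assms(3) by (simp add: mset_subset_eq_count)
  ultimately show ?thesis unfolding continues_def h by (auto split: if_splits)
qed (use assms in simp)

lemma letter_rank_le:
  assumes "\<delta> \<ge> 0" "N \<subseteq># K"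
  shows "letter_rank N d \<le> count K d"
  using alive_height[OF assms(1) _ assms(2), of d] mset_subset_eq_count[OF assms(2), of d]
  unfolding letter_rank_def by auto

lemma row_measure_less:
  assumes \<delta>: "\<delta> \<ge> 0" and N: "N' \<subseteq># K" and d: "d \<in># K"
    and eq: "\<And>e. e \<in># K \<Longrightarrow> d < e \<Longrightarrow> count N' e = count N e"
    and less: "letter_rank N' d < letter_rank N d"
  shows "row_measure N' < row_measure N"
  unfolding row_measure_def
proof (rule lex_sum_less[OF _ _ d, of "\<lambda>d. card {e \<in> set_mset K. e < d}"])
  show "letter_rank N' d < letter_rank N d" by (rule less)
  show "inj_on (\<lambda>d. card {e \<in> set_mset K. e < d}) (set_mset K)" by (rule inj_on_card_less) simp
  fix e assume e: "e \<in># K"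
  have "letter_rank N' e \<le> count K e" by (rule letter_rank_le[OF \<delta> N])
  also have "\<dots> \<le> size K" by (rule count_le_size)
  finally show "letter_rank N' e < size K + 1" by simp
  assume "card {x \<in> set_mset K. x < d} < card {x \<in> set_mset K. x < e}"
  then have "d < e" using card_less_mono[OF finite_set_mset e, of d] by (cases d e rule: linorder_cases) auto
  then have "count N' x = count N x" if "e \<le> x" "x \<in># K" for x using eq that by auto
  then have "height N' e = height N e" "alive N' e = alive N e" "count N' e = count N e"
    using height_cong[of e N' N] alive_cong[of e N' N] e by auto
  then show "letter_rank N' e = letter_rank N e" by (simp add: letter_rank_def)
qed simp

text \<open>The three cases are the moves that occur: sending copies of \<open>d\<close> down so
  that the admissible range is kept or reached, raising copies where the range is already missed,
  and raising copies once dead.\<close>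

lemma row_measure_decreases:
  assumes \<delta>: "\<delta> \<ge> 0" and N: "N \<subseteq># K" "N' \<subseteq># K" and d: "d \<in># K"
    and eq: "\<And>e. e \<in># K \<Longrightarrow> d < e \<Longrightarrow> count N' e = count N e"
    and cases: "(alive N d \<and> count N d < count N' d \<and>
          (int (count K d - count N d) \<le> height N d \<or> int (count K d - count N' d) \<le> height N d)) \<or>
        (alive N d \<and> height N d < int (count K d - count N d) \<and> count N' d < count N d) \<or>
        (\<not> alive N d \<and> count N' d < count N d)"
  shows "row_measure N' < row_measure N"
proof (rule row_measure_less[OF \<delta> N(2) d])
  have h: "height N' d = height N d" "alive N' d = alive N d"
    using height_cong[of d N' N] alive_cong[of d N' N] eq by auto
  have le: "count N d \<le> count K d" "count N' d \<le> count K d"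
    using N by (simp_all add: mset_subset_eq_count)
  show "letter_rank N' d < letter_rank N d"
    using cases alive_height[OF \<delta> _ N(1), of d] le unfolding letter_rank_def h by auto
qed (rule eq)

end

subsection \<open>Straightening two rows\<close>

lemma count_image_mset_set:
  "finite A \<Longrightarrow> count (image_mset u (mset_set A)) e = card {i \<in> A. u i = e}"
proof -
  assume A: "finite A"
  have "u -` {e} \<inter> set_mset (mset_set A) = {i \<in> A. u i = e}" using A by auto
  then show ?thesis using A by (simp add: count_image_mset)
qed

lemma sum_card_fibers:
  assumes "finite A" "finite S" "u ` A \<subseteq> S"
  shows "(\<Sum>e\<in>{e \<in> S. P e}. card {i \<in> A. u i = e}) = card {i \<in> A. P (u i)}"
proof -
  have "card {i \<in> A. P (u i)} = (\<Sum>i\<in>{i \<in> A. P (u i)}. 1)" by simp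
  also have "\<dots> = (\<Sum>e\<in>{e \<in> S. P e}. \<Sum>i | i \<in> {i \<in> A. P (u i)} \<and> u i = e. 1)"
    using assms by (intro sum.group[symmetric]) auto
  also have "\<dots> = (\<Sum>e\<in>{e \<in> S. P e}. card {i \<in> A. u i = e})"
    by (intro sum.cong refl) (auto intro!: arg_cong[of _ _ card])
  finally show ?thesis by simp
qed

text \<open>\<open>Q\<close> is the property to be established for coefficient functions. Only an
  upper row without repeated negative letters has to be treated, since otherwise the function is
  zero.\<close>

locale two_row_labels =
  fixes par :: "'a::linorder \<Rightarrow> bit" and n1 n2 :: nat and u :: "nat \<Rightarrow> 'a" and q :: "nat \<Rightarrow> nat"
    and Q :: "(('a \<times> nat) multiset \<Rightarrow> int) \<Rightarrow> bool"
  assumes Q: "rat_closed Q"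
    and neg1: "i < n1 \<Longrightarrow> j < n1 \<Longrightarrow> i \<noteq> j \<Longrightarrow> u i = u j \<Longrightarrow> par (u i) = 0"
begin

abbreviation "n \<equiv> n1 + n2"
definition "K = image_mset u (mset_set {..<n})"
definition "low X = image_mset u (mset_set ({..<n} - X))"
abbreviation "N \<equiv> low {..<n1}"
abbreviation "R X \<equiv> two_rows par n n1 u q X"

lemma count_low: "count (low X) e = card {i \<in> {..<n} - X. u i = e}"
  by (simp add: low_def count_image_mset_set)

lemma count_K: "count K e = count N e + card {i \<in> {..<n1}. u i = e}"
proof -
  have "{i \<in> {..<n}. u i = e} = {i \<in> {..<n} - {..<n1}. u i = e} \<union> {i \<in> {..<n1}. u i = e}" by auto
  moreover have "card ({i \<in> {..<n} - {..<n1}. u i = e} \<union> {i \<in> {..<n1}. u i = e}) =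
      card {i \<in> {..<n} - {..<n1}. u i = e} + card {i \<in> {..<n1}. u i = e}"
    by (rule card_Un_disjoint) auto
  ultimately show ?thesis
    using count_image_mset_set[of "{..<n}" u e] unfolding count_low K_def by simp
qed

lemma low_subset: "low X \<subseteq># K"
  unfolding low_def K_def by (intro image_mset_subseteq_mono) (simp add: subset_imp_msubset_mset_set)

lemma in_K: "i < n \<Longrightarrow> u i \<in># K"
  by (auto simp: K_def)

text \<open>Relative to the initial placement, the labels in \<open>X - {..<n1}\<close> went up and
  those in \<open>{..<n1} - X\<close> went down. Additive on both sides to avoid truncated
  subtraction.\<close>

lemma count_low_exchange:
  assumes "X \<subseteq> {..<n}"
  shows "count (low X) e + card {j \<in> X - {..<n1}. u j = e} = count N e + card {i \<in> {..<n1} - X. u i = e}"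
proof -
  have fin: "finite X" using assms finite_subset by blast
  have "count (low X) e + card {j \<in> X - {..<n1}. u j = e} =
      card ({i \<in> {..<n} - X. u i = e} \<union> {j \<in> X - {..<n1}. u j = e})"
    unfolding count_low using fin by (subst card_Un_disjoint) auto
  also have "{i \<in> {..<n} - X. u i = e} \<union> {j \<in> X - {..<n1}. u j = e} =
      {i \<in> {..<n} - {..<n1}. u i = e} \<union> {i \<in> {..<n1} - X. u i = e}"
    using assms by auto
  also have "card \<dots> = count N e + card {i \<in> {..<n1} - X. u i = e}"
    unfolding count_low using fin by (subst card_Un_disjoint) auto
  finally show ?thesis .
qed

lemma card_exchange:
  assumes "X \<subseteq> {..<n}" "card X = n1"
  shows "card (X - {..<n1}) = card ({..<n1} - X)"
proof -
  have "finite X" using assms finite_subset by blast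
  then have "card X = card (X \<inter> {..<n1}) + card (X - {..<n1})" by (rule card_Int_Diff)
  moreover have "card {..<n1} = card ({..<n1} \<inter> X) + card ({..<n1} - X)"
    by (rule card_Int_Diff) simp
  ultimately show ?thesis using assms by (simp add: Int_commute)
qed

lemma two_rows_low_negative:
  assumes "X \<subseteq> {..<n}" "par e = 1" "count (low X) e \<ge> 2"
  shows "Q (R X)"
proof -
  have "\<not> card {i \<in> {..<n} - X. u i = e} \<le> Suc 0" using assms by (simp add: count_low)
  then obtain i j where "i \<in> {..<n} - X" "j \<in> {..<n} - X" "u i = e" "u j = e" "i \<noteq> j"
    by (subst (asm) card_le_Suc0_iff_eq) auto
  then have "R X = (\<lambda>_. 0)"
    using assms by (intro ext two_rows_repeated_negative[of i n j]) auto
  then show ?thesis using rat_closed_zero[OF Q] by simp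
qed

lemma two_rows_equal_letters:
  assumes X: "X \<subseteq> {..<n}" "card X = n1"
    and l: "\<And>i. i \<in> {..<n1} - X \<Longrightarrow> u i = d" "\<And>i. i \<in> X - {..<n1} \<Longrightarrow> u i = d"
    and d: "X \<noteq> {..<n1} \<Longrightarrow> par d = 0"
  shows "R X = R {..<n1}"
proof
  fix M
  have fin: "finite X" using X finite_subset by blast
  have diff: "par (u i) = 0" if "i \<in> {..<n1} - X" for i using that l d by auto
  have "mset_set X = mset_set (X \<inter> {..<n1}) + mset_set (X - {..<n1})"
    using fin by (subst mset_set_Union[symmetric]) (auto simp: Int_Diff_Un)
  moreover have "mset_set {..<n1} = mset_set (X \<inter> {..<n1}) + mset_set ({..<n1} - X)"
    using fin by (subst mset_set_Union[symmetric]) (auto simp: Int_commute Int_Diff_Un)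
  moreover have "image_mset u (mset_set (X - {..<n1})) = image_mset (\<lambda>_. d) (mset_set (X - {..<n1}))"
    "image_mset u (mset_set ({..<n1} - X)) = image_mset (\<lambda>_. d) (mset_set ({..<n1} - X))"
    using fin l by (auto intro!: image_mset_cong)
  ultimately have "image_mset u (mset_set {..<n1}) = image_mset u (mset_set X)"
    using card_exchange[OF X] by (simp add: image_mset_const_eq)
  then show "R X M = R {..<n1} M"
    using two_rows_same_letters[of "{..<n1}" n X u par n1 q M] X diff by simp
qed

end

text \<open>
  Here the lower row starts no further left than the upper one. One straightens at the largest letter \<open>c\<close>
  at which the height fails to continue: if \<open>c\<close> occurs in the lower row, the Garnir relation frees one
  copy of it together with the whole upper row; otherwise all labels between a suitable
  smaller letter \<open>d\<close> and \<open>c\<close> are exchanged.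
\<close>

locale inner_rows = two_row_labels +
  fixes \<delta> :: int
  assumes \<delta>: "\<delta> \<ge> 0"
    and columns: "card (q ` {..<n}) \<le> n1"
    and IH: "X \<subseteq> {..<n} \<Longrightarrow> card X = n1 \<Longrightarrow>
      row_measure par K \<delta> (low X) < row_measure par K \<delta> N \<Longrightarrow> Q (R X)"
begin

abbreviation "ht \<equiv> height K \<delta> N"

text \<open>The largest letter that moves is \<open>e\<close>, and it moves only down, within its
  admissible range. If \<open>e\<close> is negative, either the lower row repeats it and the
  function vanishes, or the upper row loses its only copy, and having none suits every nonnegative
  height.\<close>

lemma raise_alive:
  assumes X: "X \<subseteq> {..<n}" "card X = n1" and e: "alive par K \<delta> N e" "continues par K \<delta> N e"
    and i: "i < n1" "i \<notin> X" "u i = e"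
    and no: "\<And>j. j \<in> X - {..<n1} \<Longrightarrow> u j < e" "\<And>j. j \<in> {..<n1} - X \<Longrightarrow> u j \<le> e"
  shows "Q (R X)"
proof (cases "par e = 1 \<and> count (low X) e \<ge> 2")
  case False
  have eq: "count (low X) f = count N f" if "e < f" for f
  proof -
    have "{j \<in> X - {..<n1}. u j = f} = {}" "{j \<in> {..<n1} - X. u j = f} = {}" using no that by fastforce+
    then show ?thesis using count_low_exchange[OF X(1), of f] by (simp only: card.empty)
  qed
  have "{j \<in> X - {..<n1}. u j = e} = {}" using no by fastforce
  moreover have "card {j \<in> {..<n1} - X. u j = e} > 0" using i by (auto simp: card_gt_0_iff)
  ultimately have less: "count N e < count (low X) e"
    using count_low_exchange[OF X(1), of e] by (simp only: card.empty)
  have "e \<in># K" using i in_K by force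
  have alt: "int (count K e - count N e) \<le> ht e \<or> int (count K e - count (low X) e) \<le> ht e"
  proof (cases "par e = 0")
    case True
    then show ?thesis using e(2) by (simp add: continues_def)
  next
    case par: False
    then have "par e = 1" by (cases "par e") auto
    then have "count (low X) e = 1" "count N e = 0" using False less by linarith+
    moreover have "i = j" if "i < n1" "j < n1" "u i = e" "u j = e" for i j
      using neg1[of i j] that par by auto
    then have "card {j \<in> {..<n1}. u j = e} \<le> 1"
      by (subst One_nat_def, subst card_le_Suc0_iff_eq) auto
    ultimately have "count K e - count (low X) e = 0" unfolding count_K by simp
    then show ?thesis using alive_height[OF \<delta> e(1) low_subset] by simp
  qed
  show ?thesis
    by (rule IH[OF X], rule row_measure_decreases[OF \<delta> low_subset low_subset \<open>e \<in># K\<close>])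
      (use eq less alt e(1) in auto)
qed (use two_rows_low_negative X in blast)

text \<open>A lower copy of \<open>c\<close> and the whole upper row are \<open>n1 + 1\<close> free
  labels over at most \<open>n1\<close> columns. Either the copy stays, or an upper label replaces
  it: an equal letter gives the same function since \<open>c\<close> is positive, a larger one is
  covered by \<open>raise_alive\<close>, and with a smaller one the lower row loses a
  \<open>c\<close> where the admissible range was missed anyway.\<close>

lemma tie_step:
  assumes c: "c \<in># K" "alive par K \<delta> N c" "\<not> continues par K \<delta> N c" and p: "par c = 0" and y: "count N c > 0"
  shows "Q (R {..<n1})"
proof -
  have "{j \<in> {..<n} - {..<n1}. u j = c} \<noteq> {}" using y unfolding count_low by (metis card.empty less_irrefl)
  then obtain j0 where j0: "n1 \<le> j0" "j0 < n" "u j0 = c" by auto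
  let ?C = "{n1..<n} - {j0}"
  let ?T = "{X. X \<subseteq> {..<n} \<and> card X = n1 \<and> {} \<subseteq> X \<and> X \<inter> ?C = {}}"
  have "{..<n} - {} - ?C = insert j0 {..<n1}" using j0 by auto
  then have "card (q ` {..<n}) < card ({..<n} - {} - ?C)" using columns j0 by simp
  then have rel: "(\<Sum>X\<in>?T. R X M) = 0" for M
    by (intro two_rows_Garnir) auto
  show ?thesis
  proof (rule relation_step[OF Q, of ?T "{..<n1}" "\<lambda>_. 1" R])
    show "finite ?T" by (rule finite_subset[of _ "Pow {..<n}"]) auto
    show "{..<n1} \<in> ?T" by auto
    show "(\<Sum>X\<in>?T. 1 * R X M) = 0" for M using rel by simp
    fix X assume "X \<in> ?T"
    then have X: "X \<subseteq> {..<n}" "card X = n1" and XC: "X \<inter> ?C = {}" by auto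
    have fin: "finite X" using X(1) finite_subset by blast
    have up: "X - {..<n1} \<subseteq> {j0}"
    proof
      fix x assume "x \<in> X - {..<n1}"
      then have "x \<in> {n1..<n}" "x \<notin> ?C" using X(1) XC by auto
      then show "x \<in> {j0}" by blast
    qed
    show "((1::int) = 1 \<and> R X = R {..<n1}) \<or> Q (R X)"
    proof (cases "j0 \<in> X")
      case False
      then have "X \<subseteq> {..<n1}" using up by auto
      then have "X = {..<n1}" using X(2) by (intro card_subset_eq) auto
      then show ?thesis by simp
    next
      case True
      then have XB: "X - {..<n1} = {j0}" using up j0 by auto
      then have "card ({..<n1} - X) = 1" using card_exchange[OF X] by simp
      then obtain i where XA: "{..<n1} - X = {i}" by (metis card_1_singletonE)
      then have i: "i < n1" "i \<notin> X" by auto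
      consider "u i = c" | "c < u i" | "u i < c" by fastforce
      then show ?thesis
      proof cases
        case 1
        have "R X = R {..<n1}"
          by (rule two_rows_equal_letters[OF X, of c]) (use XA XB 1 j0 p in auto)
        then show ?thesis by simp
      next
        case 2
        have "alive par K \<delta> N (u i)" using c(2) 2 by (auto simp: alive_def)
        moreover have "continues par K \<delta> N (u i)" using c(2) 2 in_K[of i] i by (auto simp: alive_def)
        ultimately have "Q (R X)"
          by (rule raise_alive[OF X _ _ i refl]) (use XA XB 2 j0 in auto)
        then show ?thesis by simp
      next
        case 3
        have cnt: "count (low X) e + (if e = c then 1 else 0) = count N e + (if e = u i then 1 else 0)" for e
        proof -
          have "{j \<in> X - {..<n1}. u j = e} = (if e = c then {j0} else {})" using XB j0 by auto
          moreover have "{j \<in> {..<n1} - X. u j = e} = (if e = u i then {i} else {})" using XA by auto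
          ultimately show ?thesis using count_low_exchange[OF X(1), of e] by (simp split: if_splits)
        qed
        have "count (low X) e = count N e" if "c < e" for e using cnt[of e] 3 that by (auto split: if_splits)
        moreover have "count (low X) c < count N c" using cnt[of c] 3 by (auto split: if_splits)
        moreover have "ht c < int (count K c - count N c)" using c(3) p by (simp add: continues_def)
        ultimately have "Q (R X)"
          by (intro IH[OF X] row_measure_decreases[OF \<delta> low_subset low_subset c(1)]) (use c(2) in auto)
        then show ?thesis by simp
      qed
    qed
  qed simp
qed

text \<open>The upper labels in \<open>Z\<close> are exchanged against the lower labels in
  \<open>B\<close>, by inclusion-exclusion over \<open>Z\<close>. Terms that keep \<open>Z\<close>
  above either improve at another letter or only exchange copies of \<open>d\<close>; terms that
  lower part of \<open>Z\<close> improve at \<open>c\<close>.\<close>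

lemma gap_step:
  assumes c: "c \<in># K" "alive par K \<delta> N c" "\<not> continues par K \<delta> N c" "count N c = 0"
    and d: "d \<in># K" "d < c" "ht d \<le> - 1" "- ht d \<le> int (count N d)"
    and pd: "par d = 0 \<or> count K d = count N d"
  shows "Q (R {..<n1})"
proof -
  define Z where "Z = {i \<in> {..<n1}. d < u i \<and> u i \<le> c}"
  define Bm where "Bm = {j \<in> {..<n} - {..<n1}. d < u j \<and> u j < c}"
  \<comment> \<open>Exactly \<open>- ht d\<close> lower copies of \<open>d\<close> are freed. This
    gives \<open>m = card Z - ht c\<close>, so once \<open>m\<close> labels of \<open>Z\<close> have
    moved down, at most \<open>ht c\<close> copies of \<open>c\<close> stay above, which is what the
    height admits.\<close>
  have "nat (- ht d) \<le> card {j \<in> {..<n} - {..<n1}. u j = d}" using d(4) unfolding count_low by linarith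
  then obtain Bd where Bd: "Bd \<subseteq> {j \<in> {..<n} - {..<n1}. u j = d}" "card Bd = nat (- ht d)"
    by (rule obtain_subset_with_card_n)
  define B where "B = Bm \<union> Bd"
  define C where "C = {n1..<n} - B"
  define m where "m = card B"
  have Y: "{..<n} - {..<n1} = {n1..<n}" by auto
  have B: "B \<subseteq> {n1..<n}" using Bd(1) by (auto simp: B_def Bm_def)
  have finB: "finite B" using B finite_subset by blast
  have Bl: "d \<le> u j" "u j < c" if "j \<in> B" for j using that Bd(1) d(2) by (auto simp: B_def Bm_def)
  have BC: "B = {n1..<n} - C" using B by (auto simp: C_def)
  have Cm: "card C + m = n2"
    using B finB card_mono[OF _ B] by (simp add: C_def m_def card_Diff_subset)
  have CnZ: "C \<subseteq> {n1..<n}" "Z \<subseteq> {..<n1}" by (auto simp: C_def Z_def)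
  have htc: "ht c \<ge> 0" by (rule alive_height[OF \<delta> c(2) low_subset])
  have hKc: "ht c < int (count K c)"
    using c(3,4) by (auto simp: continues_def split: if_splits)
  have mZ: "int m = int (card Z) - ht c"
  proof -
    let ?S = "{e \<in> set_mset K. d < e \<and> e \<le> c}"
    have S: "{e \<in> set_mset K. d < e} = ?S \<union> {e \<in> set_mset K. c < e}" using d(2) by auto
    have "ht d = ht c + (\<Sum>e\<in>?S. 2 * int (count N e) - int (count K e))"
      unfolding height_def S by (subst sum.union_disjoint) auto
    also have "(\<Sum>e\<in>?S. 2 * int (count N e) - int (count K e)) =
        int (\<Sum>e\<in>?S. count N e) - int (\<Sum>e\<in>?S. card {i \<in> {..<n1}. u i = e})"
      unfolding of_nat_sum sum_subtractf[symmetric] by (rule sum.cong) (simp_all add: count_K)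
    also have "(\<Sum>e\<in>?S. card {i \<in> {..<n1}. u i = e}) = card Z"
      unfolding Z_def by (rule sum_card_fibers) (auto simp: K_def)
    also have "(\<Sum>e\<in>?S. count N e) = card {j \<in> {..<n} - {..<n1}. d < u j \<and> u j \<le> c}"
      unfolding count_low by (rule sum_card_fibers) (auto simp: K_def)
    also have "{j \<in> {..<n} - {..<n1}. d < u j \<and> u j \<le> c} = Bm"
    proof -
      have "{j \<in> {..<n} - {..<n1}. u j = c} = {}" using c(4) by (simp add: count_low)
      then show ?thesis unfolding Bm_def by (auto simp: order_le_less)
    qed
    finally have "ht d = ht c + int (card Bm) - int (card Z)" by simp
    moreover have "m = card Bm + card Bd"
      unfolding m_def B_def using Bd(1) by (intro card_Un_disjoint) (auto simp: Bm_def intro: finite_subset)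
    ultimately show ?thesis using Bd(2) d(3) by simp
  qed
  have finZ: "finite Z" by (simp add: Z_def)
  let ?T1 = "{X. X \<subseteq> {..<n} \<and> card X = n1 \<and> Z \<subseteq> X \<and> X \<inter> C = {}}"
  let ?T2 = "{V. V \<subseteq> Z \<and> card V = m}"
  \<comment> \<open>The two sides of the exchange become one relation over a disjoint union. Terms
    from the right side all have smaller measure, so their coefficients do not matter.\<close>
  let ?g = "case_sum R (\<lambda>V. R ({..<n} - (C \<union> V)))"
  let ?c = "case_sum (\<lambda>_. 1) (\<lambda>_. - ((- 1) ^ m)) :: nat set + nat set \<Rightarrow> int"
  have fin: "finite ?T1" "finite ?T2"
    using finZ by (auto intro: finite_subset[of _ "Pow {..<n}"] finite_subset[of _ "Pow Z"])
  have CX: "C \<inter> {..<n1} = {}" "C \<subseteq> {..<n}" by (auto simp: C_def)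
  have X0: "{..<n1} \<in> ?T1" using CnZ CX by auto
  have "Q (?g (Inl {..<n1}))"
  proof (rule relation_step[OF Q, of "?T1 <+> ?T2" _ ?c])
    show "finite (?T1 <+> ?T2)" using fin by simp
    show "Inl {..<n1} \<in> ?T1 <+> ?T2" using X0 by blast
    show "(\<Sum>x\<in>?T1 <+> ?T2. ?c x * ?g x M) = 0" for M
      using two_rows_inclusion_exclusion[OF refl CnZ columns Cm, where par = par and u = u and M = M]
      by (subst sum.Plus[OF fin]) (simp add: sum_negf flip: sum_distrib_left)
    fix x assume "x \<in> ?T1 <+> ?T2"
    then consider X where "x = Inl X" "X \<in> ?T1" | V where "x = Inr V" "V \<in> ?T2" by blast
    then show "?c x = 1 \<and> ?g x = ?g (Inl {..<n1}) \<or> Q (?g x)"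
    proof cases
      case (2 V)
      let ?X = "{..<n} - (C \<union> V)"
      have V: "V \<subseteq> Z" "card V = m" using 2 by auto
      have X: "?X \<subseteq> {..<n}" by auto
      have XB: "?X - {..<n1} = B" using V(1) unfolding BC by (auto simp: Z_def)
      have XA: "{..<n1} - ?X = V" using CX CnZ V by auto
      have finV: "finite V" using V finZ finite_subset by blast
      have "card ?X = n1"
      proof -
        have "C \<union> V \<subseteq> {..<n}" using CX V by (auto simp: Z_def)
        moreover have "card (C \<union> V) = card C + card V"
          using V CnZ CX finV by (intro card_Un_disjoint) (auto intro: finite_subset)
        ultimately show ?thesis using Cm V finV CnZ by (subst card_Diff_subset) (auto intro: finite_subset)
      qed
      moreover have "row_measure par K \<delta> (low ?X) < row_measure par K \<delta> N"
      proof (rule row_measure_decreases[OF \<delta> low_subset low_subset c(1)])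
        have cnt: "count (low ?X) e = count N e + card {i \<in> V. u i = e}" if "c \<le> e" for e
        proof -
          have "{j \<in> B. u j = e} = {}" using Bl that by fastforce
          then show ?thesis using count_low_exchange[OF X, of e] unfolding XA XB by (simp only: card.empty)
        qed
        show "count (low ?X) e = count N e" if "e \<in># K" "c < e" for e
        proof -
          have "{i \<in> V. u i = e} = {}" using V(1) that by (auto simp: Z_def)
          then show ?thesis using cnt[of e] that by (simp only: card.empty)
        qed
        have "{i \<in> {..<n1}. u i = c} \<subseteq> {i \<in> V. u i = c} \<union> (Z - V)" using d(2) by (auto simp: Z_def)
        then have "card {i \<in> {..<n1}. u i = c} \<le> card ({i \<in> V. u i = c} \<union> (Z - V))"
          using finV finZ by (intro card_mono) auto
        also have "\<dots> \<le> card {i \<in> V. u i = c} + card (Z - V)" by (rule card_Un_le)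
        also have "card (Z - V) = card Z - m" using V finV by (simp add: card_Diff_subset)
        finally have "int (count K c - count (low ?X) c) \<le> ht c"
          using cnt[of c] c(4) mZ htc unfolding count_K by simp
        moreover from this hKc have "count N c < count (low ?X) c" using c(4) by linarith
        ultimately show "(alive par K \<delta> N c \<and> count N c < count (low ?X) c \<and>
            (int (count K c - count N c) \<le> ht c \<or> int (count K c - count (low ?X) c) \<le> ht c)) \<or>
          (alive par K \<delta> N c \<and> ht c < int (count K c - count N c) \<and> count (low ?X) c < count N c) \<or>
          (\<not> alive par K \<delta> N c \<and> count (low ?X) c < count N c)"
          using c(2) by blast
      qed
      ultimately have "Q (R ?X)" by (intro IH X)
      then show ?thesis using 2 by simp
    next
      \<comment> \<open>Upper labels outside \<open>Z\<close>, with letters at most \<open>d\<close>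
        or above \<open>c\<close>, trade places with labels of \<open>B\<close>, with letters from
        \<open>d\<close> to below \<open>c\<close>. The largest moving letter decides: above
        \<open>c\<close> it goes down while alive; below \<open>c\<close> the reading is dead, and
        raising it helps.\<close>
      case (1 X)
      then have X: "X \<subseteq> {..<n}" "card X = n1" and ZX: "Z \<subseteq> X" and XC: "X \<inter> C = {}" by auto
      have finX: "finite X" using X finite_subset by blast
      have XB: "X - {..<n1} \<subseteq> B" using X(1) XC unfolding BC by auto
      have XA: "u i \<le> d \<or> c < u i" if "i \<in> {..<n1} - X" for i
        using that ZX by (auto simp: Z_def)
      have ce: "count (low X) e + card {j \<in> X - {..<n1}. u j = e} = count N e + card {i \<in> {..<n1} - X. u i = e}" for e
        by (rule count_low_exchange[OF X(1)])
      have dead: "\<not> alive par K \<delta> N e" if "e < c" for e using c(1,3) that by (auto simp: alive_def)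
      have drop: "Q (R X)" if e: "e \<in># K" "e < c" "count (low X) e < count N e"
        "\<And>f. f \<in># K \<Longrightarrow> e < f \<Longrightarrow> count (low X) f = count N f" for e
        by (rule IH[OF X], rule row_measure_decreases[OF \<delta> low_subset low_subset e(1)])
          (use e dead in auto)
      show ?thesis
      proof (cases "\<exists>i\<in>{..<n1} - X. c < u i")
        case True
        let ?e = "Max (u ` ({..<n1} - X))"
        have "?e \<in> u ` ({..<n1} - X)" using True by (intro Max_in) auto
        then obtain i where i: "i < n1" "i \<notin> X" "u i = ?e" by auto
        have le: "u j \<le> ?e" if "j \<in> {..<n1} - X" for j using that by (intro Max_ge) auto
        then have e: "c < ?e" using True by (meson order_less_le_trans)
        have "?e \<in># K" using in_K[of i] i by simp
        then have "Q (R X)"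
          using e c(2) le XB Bl(2) by (intro raise_alive[OF X _ _ i]) (auto simp: alive_def intro: order_less_trans)
        then show ?thesis using 1 by simp
      next
        case False
        then have A: "u i \<le> d" if "i \<in> {..<n1} - X" for i using XA[OF that] that by blast
        show ?thesis
        proof (cases "\<exists>j\<in>X - {..<n1}. d < u j")
          case True
          let ?e = "Max (u ` (X - {..<n1}))"
          have "?e \<in> u ` (X - {..<n1})" using True finX by (intro Max_in) auto
          then obtain j where "?e = u j" "j \<in> X - {..<n1}" by (rule imageE)
          then have j: "j \<in> X - {..<n1}" "u j = ?e" by simp_all
          have le: "u j \<le> ?e" if "j \<in> X - {..<n1}" for j using that finX by (intro Max_ge) auto
          then have e: "d < ?e" using True by (meson order_less_le_trans)
          have "?e < c" using Bl(2)[of j] XB j by auto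
          moreover have "?e \<in># K" using in_K[of j] j X(1) by force
          moreover have noA: "{i \<in> {..<n1} - X. u i = f} = {}" if "d < f" for f
            using A that by fastforce
          moreover have "card {i \<in> X - {..<n1}. u i = ?e} > 0" using j finX by (auto simp: card_gt_0_iff)
          ultimately have "Q (R X)"
          proof (intro drop[of ?e])
            have "{i \<in> {..<n1} - X. u i = ?e} = {}" using noA e by blast
            then show "count (low X) ?e < count N ?e"
              using ce[of ?e] \<open>card {i \<in> X - {..<n1}. u i = ?e} > 0\<close> by (simp only: card.empty)
            fix f assume f: "f \<in># K" "?e < f"
            have "{i \<in> X - {..<n1}. u i = f} = {}" using le f by fastforce
            moreover have "{i \<in> {..<n1} - X. u i = f} = {}" using noA e f by (meson order_less_trans)
            ultimately show "count (low X) f = count N f" using ce[of f] by (simp only: card.empty)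
          qed auto
          then show ?thesis using 1 by simp
        next
          case noB: False
          have Bd: "u j = d" if "j \<in> X - {..<n1}" for j
            using noB that Bl(1)[OF subsetD[OF XB that]] by force
          show ?thesis
          proof (cases "\<exists>i\<in>{..<n1} - X. u i < d")
            case True
            have "Q (R X)"
            proof (rule drop[OF d(1,2)])
              obtain i where "i \<in> {..<n1} - X" "u i \<noteq> d" using True by force
              then have "{i \<in> {..<n1} - X. u i = d} \<subset> {..<n1} - X" by blast
              then have "card {i \<in> {..<n1} - X. u i = d} < card ({..<n1} - X)" by (intro psubset_card_mono) auto
              moreover have "{j \<in> X - {..<n1}. u j = d} = X - {..<n1}" using Bd by auto
              ultimately show "count (low X) d < count N d" using ce[of d] card_exchange[OF X] by simp
              fix f assume f: "f \<in># K" "d < f"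
              have "{i \<in> X - {..<n1}. u i = f} = {}" using Bd f by fastforce
              moreover have "{i \<in> {..<n1} - X. u i = f} = {}" using A f by fastforce
              ultimately show "count (low X) f = count N f" using ce[of f] by (simp only: card.empty)
            qed
            then show ?thesis using 1 by simp
          next
            case no: False
            then have Ad: "u i = d" if "i \<in> {..<n1} - X" for i
              using no A[OF that] that by (metis order_le_less)
            \<comment> \<open>If \<open>d\<close> were negative, all its copies would be in the
              lower row, leaving no upper label to trade.\<close>
            have "par d = 0" if ne: "X \<noteq> {..<n1}"
            proof (rule ccontr)
              assume "par d \<noteq> 0"
              then have "card {i \<in> {..<n1}. u i = d} = 0" using pd count_K[of d] by simp
              then have "{..<n1} - X = {}" using Ad by auto
              then have "{..<n1} \<subseteq> X" by auto
              then show False using ne X(2) finX card_subset_eq[of X "{..<n1}"] by simp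
            qed
            then have "R X = R {..<n1}" using Ad Bd by (intro two_rows_equal_letters[OF X, of d]) auto
            then show ?thesis using 1 by simp
          qed
        qed
      qed
    qed
  qed simp
  then show ?thesis by simp
qed

end

text \<open>
  Here the lower row starts no further right than the upper one, and the classical Garnir exchange at
  an inversion moves larger letters into the lower row.
\<close>

locale shifted_rows = two_row_labels +
  fixes i1 i2 :: nat
  assumes i1: "i1 < n1" and i2: "i2 < n2"
    and upper: "i1 \<le> i \<Longrightarrow> i < n1 \<Longrightarrow> u i1 \<le> u i"
    and lower: "n1 \<le> j \<Longrightarrow> j \<le> n1 + i2 \<Longrightarrow> u j \<le> u (n1 + i2)"
    and inv: "pos_less par (u (n1 + i2)) (u i1)"
    and columns: "card (q ` {..<n}) \<le> n1 - i1 + i2"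
    and IH: "X \<subseteq> {..<n} \<Longrightarrow> card X = n1 \<Longrightarrow>
      (\<Sum>x\<in>#low X. card {y \<in> set_mset K. x < y}) < (\<Sum>x\<in>#N. card {y \<in> set_mset K. x < y}) \<Longrightarrow> Q (R X)"
begin

lemma shifted_step: "Q (R {..<n1})"
proof -
  let ?t = "u i1" and ?b = "u (n1 + i2)"
  let ?r = "\<lambda>x. card {y \<in> set_mset K. x < y}"
  let ?Z = "{..<i1}" and ?C = "{n1 + i2 + 1..<n}"
  let ?T = "{X. X \<subseteq> {..<n} \<and> card X = n1 \<and> ?Z \<subseteq> X \<and> X \<inter> ?C = {}}"
  have bt: "?b \<le> ?t" using inv by (auto simp: pos_less_def)
  have r_le: "?r y \<le> ?r x" if "x \<le> y" for x y using that by (intro card_mono) auto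
  have r_less: "?r y < ?r x" if "x < y" "y \<in># K" for x y
    using that by (intro psubset_card_mono) auto
  \<comment> \<open>These are \<open>n1 - i1 + i2 + 1\<close> labels, one more than the assumed
    bound on the number of columns.\<close>
  have "{..<n} - ?Z - ?C = {i1..<n1 + i2 + 1}" using i1 i2 by auto
  then have "card (q ` {..<n}) < card ({..<n} - ?Z - ?C)" using columns i1 by simp
  then have rel: "(\<Sum>X\<in>?T. R X M) = 0" for M
    using i1 i2 by (intro two_rows_Garnir) auto
  show ?thesis
  proof (rule relation_step[OF Q, of ?T "{..<n1}" "\<lambda>_. 1" R])
    show "finite ?T" by (rule finite_subset[of _ "Pow {..<n}"]) auto
    show "{..<n1} \<in> ?T" using i1 by auto
    show "(\<Sum>X\<in>?T. 1 * R X M) = 0" for M using rel by simp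
    fix X assume "X \<in> ?T"
    then have X: "X \<subseteq> {..<n}" "card X = n1" and XZ: "?Z \<subseteq> X" and XC: "X \<inter> ?C = {}" by auto
    let ?A = "{..<n1} - X" and ?B = "X - {..<n1}"
    have finX: "finite X" using X(1) finite_subset by blast
    have A: "?t \<le> u i" if "i \<in> ?A" for i
      using that XZ by (intro upper) (auto simp: subset_iff not_less[symmetric])
    have B: "u j \<le> ?b" if "j \<in> ?B" for j
    proof -
      have "j \<in> {..<n}" "j \<notin> ?C" using that X(1) XC by auto
      then show ?thesis using that by (intro lower) auto
    qed
    show "((1::int) = 1 \<and> R X = R {..<n1}) \<or> Q (R X)"
    proof (cases "(\<forall>i\<in>?A. u i = ?t) \<and> (\<forall>j\<in>?B. u j = ?t)")
      case True
      have "par ?t = 0" if "X \<noteq> {..<n1}"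
      proof -
        have "?B \<noteq> {}"
        proof
          assume "?B = {}"
          then have "X \<subseteq> {..<n1}" by auto
          then show False using that X(2) card_subset_eq[of "{..<n1}" X] by simp
        qed
        then have "?b = ?t" using True B bt by fastforce
        then show ?thesis using inv by (simp add: pos_less_def)
      qed
      then have "R X = R {..<n1}" using True by (intro two_rows_equal_letters[OF X, of ?t]) auto
      then show ?thesis by simp
    next
      case False
      have tK: "?t \<in># K" using in_K[of i1] i1 by simp
      have rA: "?r (u i) \<le> ?r ?t" if "i \<in> ?A" for i using A[OF that] by (rule r_le)
      have rB: "?r ?t \<le> ?r (u j)" if "j \<in> ?B" for j using B[OF that] bt by (intro r_le) simp
      have leA: "(\<Sum>i\<in>?A. ?r (u i)) \<le> card ?A * ?r ?t" using rA by (intro sum_bounded_above[of ?A _ "?r ?t", simplified]) auto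
      have leB: "card ?B * ?r ?t \<le> (\<Sum>j\<in>?B. ?r (u j))" using rB by (intro sum_bounded_below[of ?B "?r ?t", simplified]) auto
      \<comment> \<open>Labels going down have letters at least \<open>?t\<close>, labels going up
        at most \<open>?t\<close>, and there are equally many of each. One letter different from
        \<open>?t\<close> makes the comparison of rank sums strict.\<close>
      have "(\<Sum>i\<in>?A. ?r (u i)) < card ?A * ?r ?t \<or> card ?B * ?r ?t < (\<Sum>j\<in>?B. ?r (u j))"
      proof (cases "\<exists>i\<in>?A. u i \<noteq> ?t")
        case True
        then obtain i where i: "i \<in> ?A" "u i \<noteq> ?t" by blast
        then have "?r (u i) < ?r ?t" using A[OF i(1)] in_K[of i] by (intro r_less) auto
        then have "(\<Sum>i\<in>?A. ?r (u i)) < (\<Sum>i\<in>?A. ?r ?t)"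
          using rA i(1) by (intro sum_strict_mono_ex1) auto
        then show ?thesis by simp
      next
        case no: False
        then obtain j where j: "j \<in> ?B" "u j \<noteq> ?t" using False by blast
        then have "?r ?t < ?r (u j)" using B[OF j(1)] bt tK by (intro r_less) auto
        then have "(\<Sum>j\<in>?B. ?r ?t) < (\<Sum>j\<in>?B. ?r (u j))"
          using rB j(1) finX by (intro sum_strict_mono_ex1) auto
        then show ?thesis by simp
      qed
      then have less: "(\<Sum>i\<in>?A. ?r (u i)) < (\<Sum>j\<in>?B. ?r (u j))"
        using leA leB unfolding card_exchange[OF X] by linarith
      have lowsum: "(\<Sum>x\<in>#low Y. ?r x) = (\<Sum>i\<in>{..<n} - Y. ?r (u i))" for Y
        by (simp add: low_def image_mset.compositionality comp_def sum_unfold_sum_mset)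
      have "(\<Sum>i\<in>{..<n} - X. ?r (u i)) + (\<Sum>j\<in>?B. ?r (u j)) = (\<Sum>i\<in>({..<n} - X) \<union> ?B. ?r (u i))"
        using finX by (intro sum.union_disjoint[symmetric]) auto
      also have "({..<n} - X) \<union> ?B = ({..<n} - {..<n1}) \<union> ?A" using X(1) by auto
      also have "(\<Sum>i\<in>\<dots>. ?r (u i)) = (\<Sum>i\<in>{..<n} - {..<n1}. ?r (u i)) + (\<Sum>i\<in>?A. ?r (u i))"
        by (intro sum.union_disjoint) auto
      finally have "Q (R X)" using less by (intro IH[OF X]) (simp only: lowsum)
      then show ?thesis by simp
    qed
  qed simp
qed

end

section \<open>Choosing the letters to exchange when the lower row starts no further left\<close>

context inner_rows
begin

lemma height_labels:
  "ht d = \<delta> + int (card {j \<in> {..<n} - {..<n1}. d < u j}) - int (card {i \<in> {..<n1}. d < u i})"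
proof -
  let ?S = "{e \<in> set_mset K. d < e}"
  have "(\<Sum>e\<in>?S. 2 * int (count N e) - int (count K e)) =
      int (\<Sum>e\<in>?S. count N e) - int (\<Sum>e\<in>?S. card {i \<in> {..<n1}. u i = e})"
    unfolding of_nat_sum sum_subtractf[symmetric] by (rule sum.cong) (simp_all add: count_K)
  also have "(\<Sum>e\<in>?S. card {i \<in> {..<n1}. u i = e}) = card {i \<in> {..<n1}. d < u i}"
    by (rule sum_card_fibers) (auto simp: K_def)
  also have "(\<Sum>e\<in>?S. count N e) = card {j \<in> {..<n} - {..<n1}. d < u j}"
    unfolding count_low by (rule sum_card_fibers) (auto simp: K_def)
  finally show ?thesis unfolding height_def by simp
qed

lemma upper_negative: "par e = 1 \<Longrightarrow> card {i \<in> {..<n1}. u i = e} \<le> 1"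
proof -
  assume e: "par e = 1"
  have "i = j" if "i < n1" "j < n1" "u i = e" "u j = e" for i j
    using neg1[of i j] that e by auto
  then show ?thesis by (subst One_nat_def, subst card_le_Suc0_iff_eq) auto
qed

text \<open>The letter \<open>b\<close> guarantees that some letter from \<open>b\<close> up fails
  to continue; \<open>c\<close> is the largest of these. If \<open>tie_step\<close> does not apply,
  \<open>c\<close> is absent from the lower row. Then \<open>d\<close> is the largest letter below
  \<open>c\<close> whose lower copies can make up for a negative height, with \<open>b\<close>
  showing that one exists.\<close>

lemma inner_step:
  assumes neg2: "\<And>e. par e = 1 \<Longrightarrow> count N e \<le> 1"
    and b: "b \<in># K" "count N b \<ge> 1" "ht b + int (count N b) \<ge> 0" "par b = 0 \<or> count K b = count N b"
    and stop: "ht b < 0 \<or> (par b = 0 \<and> ht b < int (count K b - count N b))"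
  shows "Q (R {..<n1})"
proof -
  let ?cont = "continues par K \<delta> N"
  let ?F = "{e \<in> set_mset K. \<not> ?cont e}"
  have "\<exists>e\<in>?F. b \<le> e"
  proof (rule ccontr)
    assume no: "\<not> (\<exists>e\<in>?F. b \<le> e)"
    then have "alive par K \<delta> N b" by (auto simp: alive_def)
    then have "ht b \<ge> 0" by (rule alive_height[OF \<delta> _ low_subset])
    moreover have "?cont b" using no b(1) by auto
    ultimately show False using stop by (auto simp: continues_def)
  qed
  then obtain e0 where e0: "e0 \<in> ?F" "b \<le> e0" by blast
  define c where "c = Max ?F"
  have "c \<in> ?F" unfolding c_def using e0 by (intro Max_in) auto
  then have c: "c \<in># K" "\<not> ?cont c" by auto
  have cmax: "e \<le> c" if "e \<in> ?F" for e unfolding c_def using that by (intro Max_ge) auto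
  have bc: "b \<le> c" using cmax[OF e0(1)] e0(2) by simp
  have ca: "alive par K \<delta> N c" unfolding alive_def using cmax by fastforce
  have hc: "ht c \<ge> 0" by (rule alive_height[OF \<delta> ca low_subset])
  show ?thesis
  proof (cases "par c = 0 \<and> count N c > 0")
    case True
    then show ?thesis using tie_step[OF c(1) ca c(2)] by blast
  next
    case False
    have Nc: "count N c = 0"
    proof (cases "par c = 0")
      case neg: False
      then have "par c = 1" by (cases "par c") auto
      then have "card {i \<in> {..<n1}. u i = c} \<le> 1" by (rule upper_negative)
      moreover have "ht c + 2 * int (count N c) - int (count K c) < 0" using c(2) neg by (simp add: continues_def)
      ultimately show ?thesis using hc unfolding count_K by linarith
    qed (use False in \<open>simp add: count_eq_zero_iff\<close>)
    then have "b < c" using bc b(2) by (cases "b = c") auto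
    have hKc: "ht c < int (count K c)" using c(2) Nc by (auto simp: continues_def split: if_splits)
    let ?D = "{e \<in> set_mset K. e < c \<and> count N e \<ge> 1 \<and> ht e + int (count N e) \<ge> 0 \<and>
        (par e = 0 \<or> count K e = count N e)}"
    define d where "d = Max ?D"
    have "d \<in> ?D" unfolding d_def using b \<open>b < c\<close> by (intro Max_in) auto
    then have d: "d \<in># K" "d < c" "ht d + int (count N d) \<ge> 0" "par d = 0 \<or> count K d = count N d" by auto
    have dmax: "e \<le> d" if "e \<in> ?D" for e unfolding d_def using that by (intro Max_ge) auto
    have "ht d \<le> - 1"
    proof (rule ccontr)
      assume "\<not> ht d \<le> - 1"
      \<comment> \<open>Suppose the height at \<open>d\<close> were nonnegative. Past
        \<open>c\<close> the height is negative, so it must recover between \<open>c\<close> and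
        \<open>d\<close>: \<open>f\<close> is the first letter, reading downwards, where it has
        recovered, and its predecessor \<open>g\<close> in this reading meets the conditions on
        \<open>d\<close> while being larger.\<close>
      let ?E = "{e \<in> set_mset K. e < c \<and> d \<le> e \<and> ht e \<ge> 0}"
      define f where "f = Max ?E"
      have "d \<in> ?E" using d \<open>\<not> ht d \<le> - 1\<close> by auto
      then have "f \<in> ?E" unfolding f_def by (intro Max_in) auto
      then have f: "f < c" "d \<le> f" "ht f \<ge> 0" by auto
      have fmax: "e \<le> f" if "e \<in> ?E" for e unfolding f_def using that by (intro Max_ge) auto
      let ?G = "{x \<in> set_mset K. f < x}"
      define g where "g = Min ?G"
      have G: "finite ?G" "c \<in> ?G" using f c by auto
      then have "g \<in> ?G" unfolding g_def by (intro Min_in) auto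
      then have g: "g \<in># K" "f < g" by auto
      have gmin: "g \<le> x" if "x \<in># K" "f < x" for x unfolding g_def using G that by (intro Min_le) auto
      have step: "ht f = ht g + 2 * int (count N g) - int (count K g)"
        by (rule height_step[OF g gmin])
      show False
      proof (cases "g = c")
        case True
        then show False using step hKc Nc f(3) by simp
      next
        case False
        then have "g < c" using gmin[OF c(1) f(1)] by simp
        then have hg: "ht g < 0" using fmax[of g] g f by force
        have "count N g \<ge> 1" using step f(3) hg by linarith
        moreover have "ht g + int (count N g) \<ge> 0"
          using step f(3) unfolding count_K by linarith
        moreover have "par g = 0 \<or> count K g = count N g"
        proof (rule ccontr)
          assume n: "\<not> (par g = 0 \<or> count K g = count N g)"
          then have "par g = 1" by (cases "par g") auto
          then have "count N g \<le> 1" by (rule neg2)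
          moreover have "count K g \<noteq> count N g" using n by blast
          ultimately show False using step f(3) hg unfolding count_K by linarith
        qed
        ultimately have "g \<le> d" using g \<open>g < c\<close> by (intro dmax) auto
        then show False using f g by auto
      qed
    qed
    then show ?thesis using d by (intro gap_step[OF c(1) ca c(2) Nc]) auto
  qed
qed

end

section \<open>From rows of entries to labels\<close>

definition row_std :: "('a::linorder \<Rightarrow> bit) \<Rightarrow> 'a list \<Rightarrow> bool" where
  "row_std par w \<longleftrightarrow> sorted_wrt (pos_less par) w"

text \<open>A flippable inversion in terms of zero-based positions in rows starting at columns
  \<open>s1\<close> and \<open>s2\<close>; \<open>i1 > 0\<close> expresses that the upper cell has a
  left neighbour.\<close>

definition row_flip :: "('a::linorder \<Rightarrow> bit) \<Rightarrow> nat \<Rightarrow> nat \<Rightarrow> 'a list \<Rightarrow> 'a list \<Rightarrow> nat \<Rightarrow> nat \<Rightarrow> bool" where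
  "row_flip par s1 s2 w1 w2 i1 i2 \<longleftrightarrow> i1 < length w1 \<and> i2 < length w2 \<and> s1 + i1 = s2 + i2 \<and>
     pos_less par (w2 ! i2) (w1 ! i1) \<and> \<not> (i1 > 0 \<and> neg_less par (w2 ! i2) (w1 ! (i1 - 1)))"

definition rows_cf :: "('a::linorder \<Rightarrow> bit) \<Rightarrow> nat list \<Rightarrow> nat list \<Rightarrow> 'a list \<Rightarrow> 'a list \<Rightarrow>
    ('a \<times> nat) multiset \<Rightarrow> int" where
  "rows_cf par p1 p2 w1 w2 = cf (lp_sign par) (tab_poly par w1 p1 * tab_poly par w2 p2)"

lemma sorted_row_std:
  assumes "sorted w" "\<And>i j. i < length w \<Longrightarrow> j < length w \<Longrightarrow> i \<noteq> j \<Longrightarrow> w ! i = w ! j \<Longrightarrow> par (w ! i) = 0"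
  shows "row_std par w"
  unfolding row_std_def sorted_wrt_iff_nth_less
proof (intro allI impI)
  fix i j assume ij: "i < j" "j < length w"
  then have "w ! i \<le> w ! j" using assms(1) sorted_iff_nth_mono_less by blast
  then show "pos_less par (w ! i) (w ! j)"
    using assms(2)[of i j] ij unfolding pos_less_def by force
qed

text \<open>Take \<open>b\<close> in the lower cell of the inversion and compare starting columns.
  Flippability keeps the upper entries above \<open>b\<close> from starting left of the inversion,
  while the lower entries from \<open>b\<close> up have started by then:
  \<open>ht b + count N b\<close> is nonnegative. The upper entries from \<open>b\<close> up have
  also started there, the lower ones above \<open>b\<close> not yet: \<open>b\<close> fails to
  continue or its height is negative.\<close>

lemma inner_rows_letters:
  assumes w: "sorted w1" "sorted w2" "length w1 = n1" "length w2 = n2"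
    and std1: "row_std par w1" and std2: "row_std par w2"
    and s: "s1 \<le> s2" "s2 + n2 \<le> s1 + n1"
    and flip: "row_flip par s1 s2 w1 w2 i1 i2"
    and inner: "inner_rows par n1 n2 ((!) (w1 @ w2)) q Q (int (s1 + n1) - int (s2 + n2))"
  shows "Q (two_rows par (n1 + n2) n1 ((!) (w1 @ w2)) q {..<n1})"
proof -
  let ?u = "(!) (w1 @ w2)" and ?n = "n1 + n2"
  interpret inner_rows par n1 n2 ?u q Q "int (s1 + n1) - int (s2 + n2)" by (rule inner)
  define b where "b = w2 ! i2"
  have i: "i1 < n1" "i2 < n2" "s1 + i1 = s2 + i2" and bx: "pos_less par b (w1 ! i1)"
    and xb: "i1 > 0 \<Longrightarrow> \<not> neg_less par b (w1 ! (i1 - 1))"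
    using flip w unfolding row_flip_def b_def by auto
  have u1: "?u i = w1 ! i" if "i < n1" for i using that w by (simp add: nth_append)
  have u2: "?u (n1 + j) = w2 ! j" for j using w by (simp add: nth_append)
  have m1: "w1 ! i \<le> w1 ! j" if "i \<le> j" "j < n1" for i j
    using w that by (simp add: sorted_nth_mono)
  have m2: "w2 ! i \<le> w2 ! j" if "i \<le> j" "j < n2" for i j
    using w that by (simp add: sorted_nth_mono)
  have Y: "{j \<in> {..<?n} - {..<n1}. P (?u j)} = (+) n1 ` {j \<in> {..<n2}. P (w2 ! j)}" for P
  proof (intro equalityI subsetI)
    fix j assume j: "j \<in> {j \<in> {..<?n} - {..<n1}. P (?u j)}"
    then have "j = n1 + (j - n1)" by auto
    then show "j \<in> (+) n1 ` {j \<in> {..<n2}. P (w2 ! j)}"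
      using j u2[of "j - n1"] by (intro image_eqI[of _ _ "j - n1"]) auto
  qed (auto simp: u2)
  have cY: "card {j \<in> {..<?n} - {..<n1}. P (?u j)} = card {j \<in> {..<n2}. P (w2 ! j)}" for P
    unfolding Y by (rule card_image) simp
  have cX: "card {i \<in> {..<n1}. P (?u i)} = card {i \<in> {..<n1}. P (w1 ! i)}" for P
    by (rule arg_cong[of _ _ card]) (auto simp: u1)
  have Nb: "count N e = card {j \<in> {..<n2}. w2 ! j = e}" for e
    unfolding count_low using cY[of "\<lambda>a. a = e"] by simp
  have Kb: "count K e = count N e + card {i \<in> {..<n1}. w1 ! i = e}" for e
    unfolding count_K using cX[of "\<lambda>a. a = e"] by simp
  have hb: "ht b = int (s1 + n1) - int (s2 + n2) + int (card {j \<in> {..<n2}. b < w2 ! j}) -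
      int (card {i \<in> {..<n1}. b < w1 ! i})"
    unfolding height_labels using cY[of "\<lambda>a. b < a"] cX[of "\<lambda>a. b < a"] by simp
  have strict2: "w2 ! j < w2 ! k" if "j < k" "k < n2" "par (w2 ! j) = 1" for j k
  proof -
    have "pos_less par (w2 ! j) (w2 ! k)"
      using std2 that(1,2) w(4) unfolding row_std_def sorted_wrt_iff_nth_less by blast
    then show ?thesis using that(3) by (auto simp: pos_less_def)
  qed
  have "b \<in># K" using in_K[of "n1 + i2"] i u2 by (simp add: b_def)
  have sumX: "card {i \<in> {..<n1}. b < w1 ! i} + card {i \<in> {..<n1}. w1 ! i = b} = card {i \<in> {..<n1}. b \<le> w1 ! i}"
    by (subst card_Un_disjoint[symmetric]) (auto intro!: arg_cong[of _ _ card])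
  have sumY: "card {i \<in> {..<n2}. b < w2 ! i} + card {i \<in> {..<n2}. w2 ! i = b} = card {i \<in> {..<n2}. b \<le> w2 ! i}"
    by (subst card_Un_disjoint[symmetric]) (auto intro!: arg_cong[of _ _ card])
  have Yge: "{i2..<n2} \<subseteq> {i \<in> {..<n2}. b \<le> w2 ! i}" using m2 by (auto simp: b_def)
  have Ygt: "{i \<in> {..<n2}. b < w2 ! i} \<subseteq> {i2 + 1..<n2}"
  proof
    fix j assume j: "j \<in> {i \<in> {..<n2}. b < w2 ! i}"
    then have "\<not> j \<le> i2" using m2[of j i2] i by (auto simp: b_def)
    then show "j \<in> {i2 + 1..<n2}" using j by auto
  qed
  have Xge: "{i1..<n1} \<subseteq> {i \<in> {..<n1}. b \<le> w1 ! i}"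
  proof
    fix j assume "j \<in> {i1..<n1}"
    then have "w1 ! i1 \<le> w1 ! j" "j < n1" using m1[of i1 j] by auto
    then show "j \<in> {i \<in> {..<n1}. b \<le> w1 ! i}" using bx by (auto simp: pos_less_def)
  qed
  have Xgt: "{i \<in> {..<n1}. b < w1 ! i} \<subseteq> {i1..<n1}"
  proof
    fix j assume j: "j \<in> {i \<in> {..<n1}. b < w1 ! i}"
    have "i1 \<le> j"
    proof (rule ccontr)
      assume "\<not> i1 \<le> j"
      then have "w1 ! j \<le> w1 ! (i1 - 1)" "i1 > 0" using i m1[of j "i1 - 1"] by auto
      then show False using j xb by (auto simp: neg_less_def)
    qed
    then show "j \<in> {i1..<n1}" using j by auto
  qed
  have cards: "n2 - i2 \<le> card {i \<in> {..<n2}. b \<le> w2 ! i}" "card {i \<in> {..<n2}. b < w2 ! i} \<le> n2 - (i2 + 1)"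
    "n1 - i1 \<le> card {i \<in> {..<n1}. b \<le> w1 ! i}" "card {i \<in> {..<n1}. b < w1 ! i} \<le> n1 - i1"
    using card_mono[OF _ Yge] card_mono[OF _ Ygt] card_mono[OF _ Xge] card_mono[OF _ Xgt] by auto
  show ?thesis
  proof (rule inner_step[of b])
    fix e assume e: "par e = 1"
    have "i = j" if "i < n2" "j < n2" "w2 ! i = e" "w2 ! j = e" for i j
      using strict2[of i j] strict2[of j i] that e by (cases i j rule: linorder_cases) auto
    then show "count N e \<le> 1"
      unfolding Nb by (subst One_nat_def, subst card_le_Suc0_iff_eq) auto
  next
    show "b \<in># K" by fact
    have "i2 \<in> {j \<in> {..<n2}. w2 ! j = b}" using i by (simp add: b_def)
    then have "0 < card {j \<in> {..<n2}. w2 ! j = b}" by (subst card_gt_0_iff) auto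
    then show "count N b \<ge> 1" unfolding Nb by linarith
    show "ht b + int (count N b) \<ge> 0"
      unfolding hb Nb using cards sumY i s by linarith
    show "par b = 0 \<or> count K b = count N b"
    proof (cases "par b = 0")
      case False
      then have p: "par b = 1" by (cases "par b") auto
      have "w1 ! j \<noteq> b" if "j < n1" for j
      proof (cases "i1 \<le> j")
        case True
        then show ?thesis using m1[of i1 j] bx p that by (auto simp: pos_less_def)
      next
        case False
        then have "w1 ! j \<le> w1 ! (i1 - 1)" "i1 > 0" using i m1[of j "i1 - 1"] by auto
        then show ?thesis using xb p by (auto simp: neg_less_def)
      qed
      then show ?thesis unfolding Kb by auto
    qed simp
    then have "count K b - count N b = card {i \<in> {..<n1}. w1 ! i = b}"
      "par b = 0 \<or> card {i \<in> {..<n1}. w1 ! i = b} = 0"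
      unfolding Kb by auto
    moreover have "ht b < int (card {i \<in> {..<n1}. w1 ! i = b})"
      unfolding hb using cards sumX i s by linarith
    ultimately show "ht b < 0 \<or> (par b = 0 \<and> ht b < int (count K b - count N b))"
      by (metis of_nat_0)
  qed
qed

theorem two_row_spanning:
  fixes par :: "'a::linorder \<Rightarrow> bit"
  assumes Q: "rat_closed Q" and ends: "s2 + n2 \<le> s1 + n1"
    and base: "\<And>w1 w2. length w1 = n1 \<Longrightarrow> length w2 = n2 \<Longrightarrow> mset w1 + mset w2 = L \<Longrightarrow>
      row_std par w1 \<Longrightarrow> row_std par w2 \<Longrightarrow> (\<And>i1 i2. \<not> row_flip par s1 s2 w1 w2 i1 i2) \<Longrightarrow>
      Q (rows_cf par [s1..<s1 + n1] [s2..<s2 + n2] w1 w2)"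
    and w: "length w1 = n1" "length w2 = n2" "mset w1 + mset w2 = L"
  shows "Q (rows_cf par [s1..<s1 + n1] [s2..<s2 + n2] w1 w2)"
proof -
  let ?p1 = "[s1..<s1 + n1]" and ?p2 = "[s2..<s2 + n2]" and ?n = "n1 + n2"
  let ?\<delta> = "int (s1 + n1) - int (s2 + n2)"
  let ?q = "(!) (?p1 @ ?p2)"
  \<comment> \<open>For \<open>s1 > s2\<close> the measure counts, for each lower entry, the
    distinct letters above it; it drops when larger letters move down.\<close>
  define \<mu> where "\<mu> M = (if s1 \<le> s2 then row_measure par L ?\<delta> M
      else (\<Sum>x\<in>#M. card {y \<in> set_mset L. x < y}))" for M
  show ?thesis
    using w
  proof (induction "\<mu> (mset w2)" arbitrary: w1 w2 rule: less_induct)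
    case less
    let ?v1 = "sort w1" and ?v2 = "sort w2"
    let ?u = "(!) (?v1 @ ?v2)"
    let ?R = "two_rows par ?n n1 ?u ?q"
    have lv: "length ?v1 = n1" "length ?v2 = n2" using less.prems by simp_all
    have u1: "?u i = ?v1 ! i" if "i < n1" for i using that lv by (simp add: nth_append)
    have u2: "?u (n1 + j) = ?v2 ! j" for j using lv by (simp add: nth_append)
    have labels: "image_mset ?u (mset_set {..<?n}) = L"
    proof -
      have "map ?u [0..<?n] = ?v1 @ ?v2" by (rule nth_equalityI) (use lv in simp_all)
      then have "image_mset ?u (mset [0..<?n]) = mset ?v1 + mset ?v2" by (metis mset_append mset_map)
      then show ?thesis using less.prems by (simp add: atLeast0LessThan)
    qed
    have labels2: "image_mset ?u (mset_set ({..<?n} - {..<n1})) = mset w2"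
    proof -
      have "map ?u [n1..<?n] = ?v2" by (rule nth_equalityI) (use lv in \<open>simp_all add: nth_append\<close>)
      then have "image_mset ?u (mset [n1..<?n]) = mset ?v2" by (metis mset_map)
      moreover have "{..<?n} - {..<n1} = {n1..<?n}" by auto
      ultimately show ?thesis by simp
    qed
    have labels1: "image_mset ?u (mset_set {..<n1}) = mset w1"
    proof -
      have "map ?u [0..<n1] = ?v1" by (rule nth_equalityI) (use lv in \<open>simp_all add: nth_append\<close>)
      then have "image_mset ?u (mset [0..<n1]) = mset ?v1" by (metis mset_map)
      then show ?thesis by (simp add: atLeast0LessThan)
    qed
    \<comment> \<open>Rows and placements differ by a nonzero integer, a sign times factorials,
      which \<open>Q\<close> does not notice. In particular both rows may be sorted.\<close>
    have tr: "Q (rows_cf par ?p1 ?p2 x1 x2) \<longleftrightarrow> Q (?R X)"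
      if X: "X \<subseteq> {..<?n}" and x: "length x1 = n1" "length x2 = n2"
        "mset x1 = image_mset ?u (mset_set X)" "mset x2 = image_mset ?u (mset_set ({..<?n} - X))" for X x1 x2
    proof -
      obtain e where e: "unit_sign e" "\<And>M. ?R X M = e * (int (content_fact par x1) * int (content_fact par x2) *
          cf (lp_sign par) (tab_poly par x1 ?p1 * tab_poly par x2 ?p2) M)"
        by (rule two_rows_tab[OF x(1,2) _ _ X x(3,4), of ?p1 ?p2 par]) auto
      let ?k = "e * (int (content_fact par x1) * int (content_fact par x2))"
      have R: "?R X = (\<lambda>M. ?k * rows_cf par ?p1 ?p2 x1 x2 M)"
        using e(2) by (simp add: rows_cf_def fun_eq_iff mult.assoc)
      have "?k \<noteq> 0"
        using e(1) content_fact_pos[of par x1] content_fact_pos[of par x2] by (auto simp: unit_sign_def)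
      then show ?thesis
        unfolding R using rat_closed_scale[OF Q] rat_closed_divide[OF Q] by blast
    qed
    have IH: "Q (?R X)" if X: "X \<subseteq> {..<?n}" "card X = n1"
      and less': "\<mu> (image_mset ?u (mset_set ({..<?n} - X))) < \<mu> (mset w2)" for X
    proof -
      have fin: "finite X" using X finite_subset by blast
      let ?x1 = "map ?u (sorted_list_of_set X)" and ?x2 = "map ?u (sorted_list_of_set ({..<?n} - X))"
      have m: "mset ?x1 = image_mset ?u (mset_set X)" "mset ?x2 = image_mset ?u (mset_set ({..<?n} - X))"
        by (metis mset_map mset_sorted_list_of_multiset sorted_list_of_mset_set)+
      have l: "length ?x1 = n1" "length ?x2 = n2"
        using X fin by (simp_all add: card_Diff_subset)
      have "mset_set {..<?n} = mset_set X + mset_set ({..<?n} - X)"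
        using fin X by (subst mset_set_Union[symmetric]) (auto simp: Un_absorb1)
      then have "mset ?x1 + mset ?x2 = L" unfolding m labels[symmetric] by simp
      then have "Q (rows_cf par ?p1 ?p2 ?x1 ?x2)"
        using less' l unfolding m(2)[symmetric] by (intro less.hyps) auto
      then show ?thesis using tr[OF X(1) l m] by blast
    qed
    have v: "mset ?v1 = image_mset ?u (mset_set {..<n1})" "mset ?v2 = image_mset ?u (mset_set ({..<?n} - {..<n1}))"
      by (simp_all only: labels1 labels2 mset_sort)
    have X0: "{..<n1} \<subseteq> {..<?n}" by auto
    have "Q (?R {..<n1})"
    proof (cases "\<exists>i<?n. \<exists>j<?n. i \<noteq> j \<and> (i < n1 \<longleftrightarrow> j < n1) \<and> ?u i = ?u j \<and> par (?u i) = 1")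
      case True
      then obtain i j where "i < ?n" "j < ?n" "i \<noteq> j" "i < n1 \<longleftrightarrow> j < n1" "?u i = ?u j" "par (?u i) = 1" by blast
      then have "?R {..<n1} = (\<lambda>_. 0)"
        by (intro ext two_rows_repeated_negative[of i ?n j]) auto
      then show ?thesis using rat_closed_zero[OF Q] by simp
    next
      case False
      then have pos: "par (?u i) = 0" if "i < ?n" "j < ?n" "i \<noteq> j" "i < n1 \<longleftrightarrow> j < n1" "?u i = ?u j" for i j
        using that bit_not_zero_iff by blast
      have std1: "row_std par ?v1"
        using pos u1 lv by (intro sorted_row_std) (auto, metis trans_less_add1)
      have std2: "row_std par ?v2"
      proof (rule sorted_row_std)
        fix i j assume "i < length ?v2" "j < length ?v2" "i \<noteq> j" "?v2 ! i = ?v2 ! j"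
        then show "par (?v2 ! i) = 0" using pos[of "n1 + i" "n1 + j"] u2[of i] u2[of j] lv by simp
      qed simp
      show ?thesis
      proof (cases "\<exists>i1 i2. row_flip par s1 s2 ?v1 ?v2 i1 i2")
        case False
        have "Q (rows_cf par ?p1 ?p2 ?v1 ?v2)"
          using less.prems(3) False by (intro base lv std1 std2) auto
        then show ?thesis using tr[OF X0 lv v] by blast
      next
        case True
        then obtain i1 i2 where flip: "row_flip par s1 s2 ?v1 ?v2 i1 i2" by blast
        have lab: "two_row_labels par n1 ?u Q"
        proof (rule two_row_labels.intro[OF Q])
          fix i j assume "i < n1" "j < n1" "i \<noteq> j" "?u i = ?u j"
          then show "par (?u i) = 0" by (intro pos[of i j]) auto
        qed
        have KL: "two_row_labels.K n1 n2 ?u = L"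
          unfolding two_row_labels.K_def[OF lab] by (rule labels)
        have low: "two_row_labels.low n1 n2 ?u X = image_mset ?u (mset_set ({..<?n} - X))" for X
          unfolding two_row_labels.low_def[OF lab] ..
        have qim: "?q ` {..<?n} \<subseteq> {s1..<s1 + n1} \<union> {s2..<s2 + n2}"
          by (auto simp: nth_append)
        show ?thesis
        proof (cases "s1 \<le> s2")
          case le: True
          have "inner_rows par n1 n2 ?u ?q Q ?\<delta>"
          proof (intro inner_rows.intro lab inner_rows_axioms.intro)
            show "?\<delta> \<ge> 0" using ends by simp
            have "?q ` {..<?n} \<subseteq> {s1..<s1 + n1}" using qim le ends by force
            then have "card (?q ` {..<?n}) \<le> card {s1..<s1 + n1}" by (intro card_mono) auto
            then show "card (?q ` {..<?n}) \<le> n1" by simp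
            fix X assume "X \<subseteq> {..<?n}" "card X = n1"
              "row_measure par (two_row_labels.K n1 n2 ?u) ?\<delta> (two_row_labels.low n1 n2 ?u X)
               < row_measure par (two_row_labels.K n1 n2 ?u) ?\<delta> (two_row_labels.low n1 n2 ?u {..<n1})"
            then show "Q (?R X)" using le unfolding KL low labels2 by (intro IH) (simp_all add: \<mu>_def)
          qed
          from inner_rows_letters[OF _ _ lv std1 std2 le ends flip this] show ?thesis by simp
        next
          case gt: False
          have i: "i1 < n1" "i2 < n2" "s1 + i1 = s2 + i2" "pos_less par (?v2 ! i2) (?v1 ! i1)"
            using flip lv unfolding row_flip_def by auto
          have "shifted_rows par n1 n2 ?u ?q Q i1 i2"
          proof (intro shifted_rows.intro lab shifted_rows_axioms.intro)
            show "i1 < n1" "i2 < n2" by fact+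
            show "?u i1 \<le> ?u i" if "i1 \<le> i" "i < n1" for i
              using that lv by (simp add: u1 sorted_nth_mono)
            show "?u j \<le> ?u (n1 + i2)" if "n1 \<le> j" "j \<le> n1 + i2" for j
              using that lv i u2[of i2] u2[of "j - n1"] by (simp add: sorted_nth_mono)
            show "pos_less par (?u (n1 + i2)) (?u i1)" using i u1 u2 by simp
            have "?q ` {..<?n} \<subseteq> {s2..<s1 + n1}" using qim gt ends by force
            then have "card (?q ` {..<?n}) \<le> card {s2..<s1 + n1}" by (intro card_mono) auto
            \<comment> \<open>The columns run from \<open>s2\<close> to the right end
              \<open>s1 + n1\<close>, and \<open>s1 + i1 = s2 + i2\<close> converts their number to
              positions.\<close>
            then show "card (?q ` {..<?n}) \<le> n1 - i1 + i2" using i gt by simp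
            fix X assume "X \<subseteq> {..<?n}" "card X = n1"
              "(\<Sum>x\<in>#two_row_labels.low n1 n2 ?u X. card {y \<in> set_mset (two_row_labels.K n1 n2 ?u). x < y})
               < (\<Sum>x\<in>#two_row_labels.low n1 n2 ?u {..<n1}. card {y \<in> set_mset (two_row_labels.K n1 n2 ?u). x < y})"
            then show "Q (?R X)" using gt unfolding KL low labels2 by (intro IH) (simp_all add: \<mu>_def)
          qed
          then show ?thesis by (rule shifted_rows.shifted_step)
        qed
      qed
    qed
    then show ?case
      using tr[OF X0 less.prems(1,2)] labels1 labels2 by simp
  qed
qed

subsection \<open>Leading monomials\<close>

text \<open>
  The weight is large for small columns and, within a column, for small letters; the powers of \<open>G\<close>
  make it compare monomials lexicographically.
\<close>

definition weight :: "nat \<Rightarrow> ('a::linorder \<times> nat) set \<Rightarrow> 'a \<times> nat \<Rightarrow> nat" where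
  "weight G B x = G ^ card {y \<in> B. snd x < snd y \<or> (snd x = snd y \<and> fst x < fst y)}"

definition mweight :: "nat \<Rightarrow> ('a::linorder \<times> nat) set \<Rightarrow> ('a \<times> nat) multiset \<Rightarrow> nat" where
  "mweight G B M = (\<Sum>x\<in>#M. weight G B x)"

lemma weight_dominates:
  assumes "finite B" "(a', c') \<in> B" "c < c' \<or> (c = c' \<and> a < a')" "G > 0"
  shows "G * weight G B (a', c') \<le> weight G B (a, c)"
proof -
  let ?S = "\<lambda>x. {y \<in> B. snd x < snd y \<or> (snd x = snd y \<and> fst x < fst y)}"
  have "?S (a', c') \<subseteq> ?S (a, c)" "(a', c') \<in> ?S (a, c)" "(a', c') \<notin> ?S (a', c')"
    using assms(2,3) by auto
  then have "?S (a', c') \<subset> ?S (a, c)" by blast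
  then have "card (?S (a', c')) < card (?S (a, c))" using assms(1) by (intro psubset_card_mono) auto
  then have "Suc (card (?S (a', c'))) \<le> card (?S (a, c))" by simp
  then have "G ^ Suc (card (?S (a', c'))) \<le> G ^ card (?S (a, c))" using assms(4) by (intro power_increasing) auto
  then show ?thesis by (simp add: weight_def)
qed

lemma weight_pos: "G > 0 \<Longrightarrow> weight G B x > 0"
  by (simp add: weight_def)

text \<open>At the first position whose letter changes, the new letter is larger because the row
  increases weakly. From there on every factor is lighter by \<open>G\<close> than the diagonal
  factor at that position, and there are fewer than \<open>G\<close> of them.\<close>

lemma row_weight:
  assumes w: "row_std par w" and p: "sorted_wrt (<) p" "length p = length w"
    and \<sigma>: "\<sigma> permutes {..<length w}" and G: "length w < G"
    and B: "finite B" "set w \<times> set p \<subseteq> B"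
    and ne: "\<exists>i<length w. w ! \<sigma> i \<noteq> w ! i"
  shows "(\<Sum>i<length w. weight G B (w ! \<sigma> i, p ! i)) < (\<Sum>i<length w. weight G B (w ! i, p ! i))"
proof -
  let ?n = "length w" and ?v = "\<lambda>i. weight G B (w ! \<sigma> i, p ! i)" and ?d = "\<lambda>i. weight G B (w ! i, p ! i)"
  define i where "i = (LEAST i. i < ?n \<and> w ! \<sigma> i \<noteq> w ! i)"
  have i: "i < ?n" "w ! \<sigma> i \<noteq> w ! i" using LeastI_ex[OF ne] by (auto simp: i_def)
  have first: "w ! \<sigma> k = w ! k" if "k < i" for k
    using not_less_Least[of k "\<lambda>i. i < ?n \<and> w ! \<sigma> i \<noteq> w ! i"] that i by (auto simp: i_def)
  have lt: "\<sigma> k < ?n" if "k < ?n" for k using permutes_less[OF \<sigma>] that by simp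
  have le: "w ! j \<le> w ! k" if "j \<le> k" "k < ?n" for j k
  proof (cases "j = k")
    case False
    then have "pos_less par (w ! j) (w ! k)"
      using w that unfolding row_std_def sorted_wrt_iff_nth_less by simp
    then show ?thesis by (auto simp: pos_less_def)
  qed simp
  let ?x = "map (\<lambda>k. w ! \<sigma> k) [0..<?n]"
  have "mset ?x = mset w" using mset_map_permute[OF \<sigma>, of "(!) w"] by (simp add: comp_def map_nth)
  moreover have "take i ?x = take i w" by (rule nth_equalityI) (use i first in auto)
  ultimately have "mset (drop i ?x) = mset (drop i w)"
    by (metis add_left_cancel append_take_drop_id mset_append)
  moreover have "w ! \<sigma> i \<in> set (drop i ?x)"
    using i by (auto simp: in_set_conv_nth intro!: exI[of _ 0])
  ultimately have "w ! \<sigma> i \<in> set (drop i w)" by (metis set_mset_mset)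
  then obtain k where "k < ?n - i" "w ! \<sigma> i = w ! (i + k)" by (auto simp: in_set_conv_nth)
  then have "w ! i \<le> w ! \<sigma> i" using le[of i "i + k"] by simp
  then have gt: "w ! i < w ! \<sigma> i" using i(2) by (metis order.not_eq_order_implies_strict)
  have small: "G * ?v k \<le> ?d i" if "i \<le> k" "k < ?n" for k
  proof (rule weight_dominates[OF B(1)])
    show "(w ! \<sigma> k, p ! k) \<in> B" using that lt[of k] p(2) B(2) by auto
    have "p ! i < p ! k" if "i < k" using that \<open>k < ?n\<close> p by (simp add: sorted_wrt_iff_nth_less)
    then show "p ! i < p ! k \<or> (p ! i = p ! k \<and> w ! i < w ! \<sigma> k)" using gt that by (cases "i = k") auto
    show "G > 0" using G by simp
  qed
  have split: "(\<Sum>k<?n. h k) = (\<Sum>k<i. h k) + (\<Sum>k\<in>{i..<?n}. h k)" for h :: "nat \<Rightarrow> nat"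
    using i by (simp add: lessThan_atLeast0 sum.atLeastLessThan_concat)
  have "G * (\<Sum>k\<in>{i..<?n}. ?v k) \<le> (\<Sum>k\<in>{i..<?n}. ?d i)"
    unfolding sum_distrib_left using small by (intro sum_mono) auto
  also have "\<dots> \<le> ?n * ?d i" by simp
  also have "\<dots> < G * ?d i" using G weight_pos[of G B] by simp
  finally have "(\<Sum>k\<in>{i..<?n}. ?v k) < ?d i" by simp
  also have "?d i \<le> (\<Sum>k\<in>{i..<?n}. ?d k)" using i by (intro member_le_sum) auto
  finally show ?thesis unfolding split[of ?v] split[of ?d] using first by simp
qed

lemma keys_tab_poly:
  assumes "v \<in> Poly_Mapping.keys (tab_poly par w p)"
  obtains \<sigma> where "\<sigma> permutes {..<length w}" "letters v = map (\<lambda>i. (w ! \<sigma> i, p ! i)) [0..<length w]"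
proof -
  have "v \<in> Poly_Mapping.keys (tab_sum par w p)"
    using assms by (auto simp: in_keys_iff tab_poly_def Poly_Mapping.map.rep_eq when_def split: if_splits)
  then have "\<exists>\<sigma>\<in>{\<sigma>. \<sigma> permutes {..<length w}}. v \<in> Poly_Mapping.keys
     (word (map (\<lambda>i. (w ! \<sigma> i, p ! i)) [0..<length w]) ((- 1) ^ tab_sign_exp par w \<sigma>))"
    unfolding tab_sum_word using keys_sum by fast
  then show thesis using that by (auto split: if_splits)
qed

lemma lookup_of_nat_mult:
  "Poly_Mapping.lookup (of_nat n * (q :: 'g ncpoly)) u = int n * Poly_Mapping.lookup q u"
  by (induction n) (simp_all add: algebra_simps lookup_add)

text \<open>Negative letters of a row-standard row are distinct, so the permutations yielding the
  diagonal word are exactly those in \<open>stab\<close>. Their number is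
  \<open>content_fact\<close> and their signs agree; the division leaves a unit.\<close>

lemma lookup_tab_poly_diagonal:
  assumes w: "row_std par w" and p: "length p = length w"
  shows "unit_sign (Poly_Mapping.lookup (tab_poly par w p) (FWord (zip w p)))"
proof -
  let ?n = "length w" and ?e = "\<lambda>\<sigma>. (- 1 :: int) ^ tab_sign_exp par w \<sigma>"
  have z: "zip w p = map (\<lambda>i. (w ! i, p ! i)) [0..<?n]" using p by (intro nth_equalityI) auto
  have st: "{\<sigma>. \<sigma> permutes {..<?n} \<and> (\<forall>i<?n. w ! \<sigma> i = w ! i)} = stab par w"
  proof (intro equalityI subsetI)
    fix \<sigma> assume "\<sigma> \<in> {\<sigma>. \<sigma> permutes {..<?n} \<and> (\<forall>i<?n. w ! \<sigma> i = w ! i)}"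
    then have \<sigma>: "\<sigma> permutes {..<?n}" "\<And>i. i < ?n \<Longrightarrow> w ! \<sigma> i = w ! i" by auto
    have "\<sigma> i = i" if i: "i < ?n" "par (w ! i) = 1" for i
    proof (rule ccontr)
      have *: "j = k" if "j < ?n" "k < ?n" "w ! j = w ! k" "par (w ! j) = 1" for j k
        using w that unfolding row_std_def sorted_wrt_iff_nth_less pos_less_def
        by (metis bit_not_one_iff linorder_neqE_nat order_less_irrefl)
      assume "\<sigma> i \<noteq> i"
      then show False using *[of "\<sigma> i" i] \<sigma>(2)[OF i(1)] permutes_less[OF \<sigma>(1)] i by auto
    qed
    then show "\<sigma> \<in> stab par w" using \<sigma> by (simp add: stab_def)
  qed (auto simp: stab_def)
  have "Poly_Mapping.lookup (tab_sum par w p) (FWord (zip w p)) =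
      (\<Sum>\<sigma> | \<sigma> permutes {..<?n}. if \<forall>i<?n. w ! \<sigma> i = w ! i then ?e \<sigma> else 0)"
    unfolding tab_sum_word lookup_sum z
    by (rule sum.cong) (auto simp: lookup_single when_def)
  also have "\<dots> = (\<Sum>\<sigma>\<in>stab par w. ?e \<sigma>)"
    unfolding st[symmetric] by (simp add: sum.If_cases finite_permutations Collect_conj_eq Int_commute)
  also have "\<dots> = (\<Sum>\<sigma>\<in>stab par w. ?e id)"
  proof (rule sum.cong[OF refl])
    fix \<tau> assume "\<tau> \<in> stab par w"
    from tab_sign_exp_stab[OF permutes_id this] show "?e \<tau> = ?e id" by (simp only: comp_id)
  qed
  also have "\<dots> = int (content_fact par w) * ?e id" by (simp add: card_stab)
  finally have "int (content_fact par w) * Poly_Mapping.lookup (tab_poly par w p) (FWord (zip w p)) =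
      int (content_fact par w) * ?e id"
    unfolding content_fact_times_tab_poly[symmetric] lookup_of_nat_mult .
  then have "Poly_Mapping.lookup (tab_poly par w p) (FWord (zip w p)) = ?e id"
    using content_fact_pos[of par w] by simp
  then show ?thesis by (simp add: unit_sign_def minus_one_power_iff)
qed

text \<open>A word splits in only one way into factors of prescribed lengths, so a single pair of
  words contributes.\<close>

lemma lookup_mult_word:
  fixes p q :: "'g ncpoly"
  assumes "\<And>a'. a' \<in> Poly_Mapping.keys p \<Longrightarrow> length (letters a') = length (letters a)"
  shows "Poly_Mapping.lookup (p * q) (a + b) = Poly_Mapping.lookup p a * Poly_Mapping.lookup q b"
proof -
  have eq: "a' + b' = a + b \<longleftrightarrow> a' = a \<and> b' = b" if "a' \<in> Poly_Mapping.keys p" for a' b'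
    using assms[OF that] by (cases a; cases b; cases a'; cases b') (auto simp: plus_fword_def)
  have "p * q = (\<Sum>u\<in>Poly_Mapping.keys p. \<Sum>v\<in>Poly_Mapping.keys q.
      Poly_Mapping.single (u + v) (Poly_Mapping.lookup p u * Poly_Mapping.lookup q v))"
    by (subst ncpoly_expand[of p], subst ncpoly_expand[of q]) (simp add: sum_product mult_single)
  then have "Poly_Mapping.lookup (p * q) (a + b) = (\<Sum>u\<in>Poly_Mapping.keys p. \<Sum>v\<in>Poly_Mapping.keys q.
      if u = a \<and> v = b then Poly_Mapping.lookup p u * Poly_Mapping.lookup q v else 0)"
    by (simp add: lookup_sum lookup_single when_def eq)
  also have "\<dots> = (\<Sum>u\<in>Poly_Mapping.keys p. if u = a then Poly_Mapping.lookup p a * Poly_Mapping.lookup q b else 0)"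
  proof (rule sum.cong[OF refl])
    fix u
    have "(\<Sum>v\<in>Poly_Mapping.keys q. if u = a \<and> v = b then Poly_Mapping.lookup p u * Poly_Mapping.lookup q v else 0) =
        (\<Sum>v\<in>Poly_Mapping.keys q. if v = b then (if u = a then Poly_Mapping.lookup p a * Poly_Mapping.lookup q b else 0) else 0)"
      by (rule sum.cong) auto
    then show "(\<Sum>v\<in>Poly_Mapping.keys q. if u = a \<and> v = b then Poly_Mapping.lookup p u * Poly_Mapping.lookup q v else 0) =
        (if u = a then Poly_Mapping.lookup p a * Poly_Mapping.lookup q b else 0)"
      by (auto simp: in_keys_iff)
  qed
  finally show ?thesis by (auto simp: in_keys_iff)
qed

text \<open>Weights add under concatenation, so the diagonals of the rows together form the only
  heaviest word.\<close>

lemma leading_word: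
  fixes w :: "nat \<Rightarrow> 'a::linorder list" and p :: "nat \<Rightarrow> nat list"
  assumes "\<And>r. r \<in> set rs \<Longrightarrow> row_std par (w r) \<and> sorted_wrt (<) (p r) \<and> length (p r) = length (w r) \<and>
      length (w r) < G \<and> set (w r) \<times> set (p r) \<subseteq> B"
    and B: "finite B"
  defines "q \<equiv> prod_list (map (\<lambda>r. tab_poly par (w r) (p r)) rs)"
    and "d \<equiv> concat (map (\<lambda>r. zip (w r) (p r)) rs)"
  shows "unit_sign (Poly_Mapping.lookup q (FWord d))"
    and "v \<in> Poly_Mapping.keys q \<Longrightarrow> letters v = d \<or> mweight G B (mset (letters v)) < mweight G B (mset d)"
  using assms(1) unfolding q_def d_def
proof (induction rs arbitrary: v)
  case Nil
  case 1
  show ?case by (simp add: lookup_one zero_fword_def)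
next
  case Nil
  case 2
  then show ?case by (simp add: zero_fword_def)
next
  case (Cons r rs)
  let ?t = "tab_poly par (w r) (p r)" and ?q = "prod_list (map (\<lambda>r. tab_poly par (w r) (p r)) rs)"
  let ?d = "concat (map (\<lambda>r. zip (w r) (p r)) rs)"
  {
    case 1
    then have r: "row_std par (w r)" "length (p r) = length (w r)" by auto
    have len: "length (letters a') = length (letters (FWord (zip (w r) (p r))))"
      if "a' \<in> Poly_Mapping.keys ?t" for a'
      using that r(2) by (elim keys_tab_poly) simp
    have "FWord (concat (map (\<lambda>r. zip (w r) (p r)) (r # rs))) = FWord (zip (w r) (p r)) + FWord ?d"
      by (simp add: plus_fword_def)
    then have "Poly_Mapping.lookup (?t * ?q) (FWord (concat (map (\<lambda>r. zip (w r) (p r)) (r # rs)))) =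
        Poly_Mapping.lookup ?t (FWord (zip (w r) (p r))) * Poly_Mapping.lookup ?q (FWord ?d)"
      by (simp only: lookup_mult_word[OF len])
    then show ?case
      using lookup_tab_poly_diagonal[OF r] Cons.IH(1) 1 by (simp add: unit_sign_mult)
  next
    case 2
    then have r: "row_std par (w r)" "sorted_wrt (<) (p r)" "length (p r) = length (w r)"
      "length (w r) < G" "set (w r) \<times> set (p r) \<subseteq> B" by auto
    have "v \<in> Poly_Mapping.keys (?t * ?q)" using 2 by simp
    then obtain a b where v: "v = a + b" "a \<in> Poly_Mapping.keys ?t" "b \<in> Poly_Mapping.keys ?q"
      using keys_mult[of ?t ?q] by blast
    obtain \<sigma> where \<sigma>: "\<sigma> permutes {..<length (w r)}"
      "letters a = map (\<lambda>i. (w r ! \<sigma> i, p r ! i)) [0..<length (w r)]"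
      using keys_tab_poly[OF v(2)] .
    have z: "zip (w r) (p r) = map (\<lambda>i. (w r ! i, p r ! i)) [0..<length (w r)]"
      using r(3) by (intro nth_equalityI) auto
    have mw: "mweight G B (mset (map h [0..<m])) = (\<Sum>i<m. weight G B (h i))" for h m
      by (simp add: mweight_def image_mset.compositionality comp_def atLeast0LessThan sum_unfold_sum_mset)
    have a: "letters a = zip (w r) (p r) \<or> mweight G B (mset (letters a)) < mweight G B (mset (zip (w r) (p r)))"
    proof (cases "\<exists>i<length (w r). w r ! \<sigma> i \<noteq> w r ! i")
      case True
      then show ?thesis unfolding \<sigma>(2) z mw using row_weight[OF r(1,2,3) \<sigma>(1) r(4) B r(5)] by blast
    next
      case False
      then show ?thesis unfolding \<sigma>(2) z by simp
    qed
    have b: "letters b = ?d \<or> mweight G B (mset (letters b)) < mweight G B (mset ?d)"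
      using Cons.IH(2)[OF v(3)] 2 by simp
    have "mweight G B (mset (x @ y)) = mweight G B (mset x) + mweight G B (mset y)" for x y
      by (simp add: mweight_def)
    then show ?case using a b unfolding v(1) letters_plus by auto
  }
qed

lemma unit_sign_wsgn:
  "(\<And>x. s x = 1 \<Longrightarrow> count (mset u) x \<le> 1) \<Longrightarrow> unit_sign (wsgn s u)"
proof (induction u)
  case (Cons x u)
  have "count (mset u) y \<le> 1" if "s y = 1" for y 
  proof -
    have "count (mset u) y \<le> count (mset (x # u)) y" by simp
    then show ?thesis using Cons.prems[OF that] by linarith
  qed
  moreover have "unit_sign (prod_list (map (exch s x) v))" if "set v \<subseteq> set u" for v
    using that
  proof (induction v)
    case (Cons y v)
    have "x \<notin> set u" if "s x = 1" using Cons.prems \<open>\<And>y. s y = 1 \<Longrightarrow> count (mset (x # u)) y \<le> 1\<close>[OF that]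
      by (auto simp: count_eq_zero_iff)
    then have "unit_sign (exch s x y)" using Cons.prems by (auto simp: exch_def)
    then show ?case using Cons by (simp add: unit_sign_mult)
  qed simp
  ultimately show ?case using Cons.IH by (simp add: unit_sign_mult)
qed simp

subsection \<open>Tableaux\<close>

definition row_places :: "(nat \<times> nat) set \<Rightarrow> nat \<Rightarrow> nat list" where
  "row_places D r = sorted_list_of_set (row_columns D r)"

definition row_word :: "(nat \<times> nat) set \<Rightarrow> (nat \<times> nat \<Rightarrow> 'a) \<Rightarrow> nat \<Rightarrow> 'a list" where
  "row_word D T r = map (\<lambda>j. T (r, j)) (row_places D r)"

definition row_elem :: "('a \<Rightarrow> bit) \<Rightarrow> (nat \<times> nat) set \<Rightarrow> (nat \<times> nat \<Rightarrow> 'a) \<Rightarrow> nat \<Rightarrow> ('a \<times> nat) ncpoly" where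
  "row_elem par D T r = tab_poly par (row_word D T r) (row_places D r)"

text \<open>The representative of \<open>tableau_element\<close> in the free ring, on which
  coefficients are computed.\<close>

definition elem :: "('a \<Rightarrow> bit) \<Rightarrow> (nat \<times> nat) set \<Rightarrow> (nat \<times> nat \<Rightarrow> 'a) \<Rightarrow> ('a \<times> nat) ncpoly" where
  "elem par D T = prod_list (map (row_elem par D T) (sorted_list_of_set (fst ` D)))"

definition elem_cf :: "('a::linorder \<Rightarrow> bit) \<Rightarrow> (nat \<times> nat) set \<Rightarrow> (nat \<times> nat \<Rightarrow> 'a) \<Rightarrow> ('a \<times> nat) multiset \<Rightarrow> int" where
  "elem_cf par D T = cf (lp_sign par) (elem par D T)"

definition content :: "(nat \<times> nat) set \<Rightarrow> (nat \<times> nat \<Rightarrow> 'a) \<Rightarrow> ('a \<times> nat) multiset" where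
  "content D T = image_mset (\<lambda>c. (T c, snd c)) (mset_set D)"

lemma finite_row_columns: "finite D \<Longrightarrow> finite (row_columns D r)"
proof -
  assume "finite D"
  moreover have "row_columns D r = snd ` {c \<in> D. fst c = r}" by (force simp: row_columns_def)
  ultimately show ?thesis by simp
qed

lemma row_places_simps:
  assumes "finite D"
  shows "set (row_places D r) = row_columns D r" "sorted_wrt (<) (row_places D r)"
    "length (row_places D r) = card (row_columns D r)"
  using finite_row_columns[OF assms, of r] strict_sorted_list_of_set by (auto simp: row_places_def)

lemma length_row_word [simp]: "length (row_word D T r) = length (row_places D r)"
  by (simp add: row_word_def)

lemma row_std_row_word:
  assumes D: "finite D" and T: "row_standard par D T"
  shows "row_std par (row_word D T r)"
  unfolding row_std_def row_word_def sorted_wrt_map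
proof (rule sorted_wrt_mono_rel[OF _ row_places_simps(2)[OF D]])
  fix x y assume "x \<in> set (row_places D r)" "y \<in> set (row_places D r)" "x < y"
  then show "pos_less par (T (r, x)) (T (r, y))"
    using T by (simp add: row_places_simps(1)[OF D] row_columns_def row_standard_def)
qed

lemma content_diagonal:
  assumes D: "finite D"
  shows "mset (concat (map (\<lambda>r. zip (row_word D T r) (row_places D r)) (sorted_list_of_set (fst ` D)))) = content D T"
proof -
  let ?rs = "sorted_list_of_set (fst ` D)"
  let ?cs = "concat (map (\<lambda>r. map (Pair r) (row_places D r)) ?rs)"
  have d: "distinct (row_places D r)" for r unfolding row_places_def by simp
  have "x = y" if "x \<in> fst ` D" "map (Pair x) (row_places D x) = map (Pair y) (row_places D y)" for x y
  proof -
    have "row_columns D x \<noteq> {}" using that(1) by (auto simp: row_columns_def)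
    then have "row_places D x \<noteq> []" using row_places_simps(1)[OF D, of x] by auto
    then show ?thesis using that(2) by (cases "row_places D x"; cases "row_places D y") auto
  qed
  then have "inj_on (\<lambda>r. map (Pair r) (row_places D r)) (fst ` D)" by (intro inj_onI)
  then have "distinct ?cs"
    using D by (intro distinct_concat) (auto simp: d distinct_map inj_on_def)
  moreover have "set ?cs = D" using D by (force simp: row_places_simps row_columns_def)
  ultimately have cs: "mset ?cs = mset_set D" by (metis mset_set_set)
  have "zip (row_word D T r) (row_places D r) = map (\<lambda>c. (T c, snd c)) (map (Pair r) (row_places D r))" for r
    unfolding row_word_def by (intro nth_equalityI) auto
  then have "concat (map (\<lambda>r. zip (row_word D T r) (row_places D r)) ?rs) = map (\<lambda>c. (T c, snd c)) ?cs"
    by (simp add: map_concat comp_def)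
  then show ?thesis unfolding content_def cs[symmetric] by (metis mset_map)
qed

text \<open>The second claim excludes repeated odd generators because the diagonal word would
  otherwise be zero in the quotient.\<close>

lemma elem_leading:
  assumes D: "finite D" and T: "row_standard par D T" and B: "finite B" "T ` D \<times> snd ` D \<subseteq> B"
    and G: "card D < G"
  shows "elem_cf par D T M \<noteq> 0 \<Longrightarrow> M = content D T \<or> mweight G B M < mweight G B (content D T)"
    and "(\<And>x. lp_sign par x = 1 \<Longrightarrow> count (content D T) x \<le> 1) \<Longrightarrow> unit_sign (elem_cf par D T (content D T))"
proof -
  let ?rs = "sorted_list_of_set (fst ` D)" and ?w = "row_word D T" and ?p = "row_places D" and ?s = "lp_sign par"
  let ?d = "concat (map (\<lambda>r. zip (?w r) (?p r)) ?rs)"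
  have rows: "row_std par (?w r) \<and> sorted_wrt (<) (?p r) \<and> length (?p r) = length (?w r) \<and>
      length (?w r) < G \<and> set (?w r) \<times> set (?p r) \<subseteq> B" if "r \<in> set ?rs" for r
  proof -
    have sub: "Pair r ` row_columns D r \<subseteq> D" by (auto simp: row_columns_def)
    have "card (row_columns D r) = card (Pair r ` row_columns D r)" by (simp add: card_image inj_on_def)
    also have "\<dots> \<le> card D" using sub D by (intro card_mono) auto
    finally have "length (?w r) < G" using G by (simp add: row_places_simps[OF D])
    moreover have "set (?w r) \<times> set (?p r) \<subseteq> B"
    proof -
      have "set (?w r) \<times> set (?p r) \<subseteq> T ` D \<times> snd ` D"
        using sub by (force simp: row_word_def row_places_simps[OF D])
      then show ?thesis using B(2) by blast
    qed
    ultimately show ?thesis using row_std_row_word[OF D T] row_places_simps[OF D] by simp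
  qed
  have el: "elem par D T = prod_list (map (\<lambda>r. tab_poly par (?w r) (?p r)) ?rs)"
    unfolding elem_def row_elem_def ..
  note lead = leading_word[where rs = ?rs and w = ?w and p = ?p, OF rows B(1), folded el]
  have d: "mset ?d = content D T" by (rule content_diagonal[OF D])
  {
    assume "elem_cf par D T M \<noteq> 0"
    then obtain u where u: "u \<in> Poly_Mapping.keys (elem par D T)" "cw ?s (letters u) M \<noteq> 0"
      unfolding elem_cf_def cf_def by (metis (no_types, lifting) mult_zero_right sum.neutral)
    then have "mset (letters u) = M" by (auto simp: cw_def split: if_splits)
    then show "M = content D T \<or> mweight G B M < mweight G B (content D T)"
      using lead(2)[OF _ u(1)] d by auto
  }
  assume odd: "\<And>x. ?s x = 1 \<Longrightarrow> count (content D T) x \<le> 1"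
  have "cf ?s (elem par D T) (content D T) = (\<Sum>u\<in>{FWord ?d}. Poly_Mapping.lookup (elem par D T) u * cw ?s (letters u) (content D T))"
    unfolding cf_def
  proof (rule sum.mono_neutral_right)
    have "Poly_Mapping.lookup (elem par D T) (FWord ?d) \<noteq> 0" using lead(1) by (auto simp: unit_sign_def)
    then show "{FWord ?d} \<subseteq> Poly_Mapping.keys (elem par D T)" by (simp add: in_keys_iff)
    show "\<forall>u\<in>Poly_Mapping.keys (elem par D T) - {FWord ?d}.
        Poly_Mapping.lookup (elem par D T) u * cw ?s (letters u) (content D T) = 0"
    proof
      fix u assume u: "u \<in> Poly_Mapping.keys (elem par D T) - {FWord ?d}"
      then have "letters u \<noteq> ?d" by (metis DiffD2 fword.collapse singletonI)
      then have "mset (letters u) \<noteq> content D T" using lead(2)[of u] u d by force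
      then show "Poly_Mapping.lookup (elem par D T) u * cw ?s (letters u) (content D T) = 0" by (simp add: cw_def)
    qed
  qed simp
  also have "\<dots> = Poly_Mapping.lookup (elem par D T) (FWord ?d) * wsgn ?s ?d" by (simp add: cw_def d)
  finally show "unit_sign (elem_cf par D T (content D T))"
    unfolding elem_cf_def using lead(1) odd d by (simp add: unit_sign_mult unit_sign_wsgn)
qed

subsection \<open>Straight tableaux are determined by their column contents\<close>

lemma count_content: "finite D \<Longrightarrow> count (content D T) x = card {c \<in> D. (T c, snd c) = x}"
  unfolding content_def by (rule count_image_mset_set)

text \<open>Two equal positive entries in a column form an inversion, and it is flippable: the left
  neighbour of the upper one is strictly below it or equal and positive, so it cannot block. Hence
  the leading monomial of a straight tableau is not zero.\<close>

lemma straight_column_distinct: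
  assumes D: "is_shape D" and T: "straight par D T" and x: "lp_sign par x = 1"
  shows "count (content D T) x \<le> 1"
proof -
  have fin: "finite D" and pos: "(i, t) \<in> D \<Longrightarrow> t \<ge> 1" for i t using D by (auto simp: is_shape_def)
  have no: False if c: "(i, t) \<in> D" "(j, t) \<in> D" "i < j" "T (i, t) = T (j, t)" "par (T (i, t)) = 0" for i j t
  proof -
    have "inversion par D T i j t" using c by (simp add: inversion_def pos_less_def)
    then have "\<not> flippable par D T i j t" using T by (auto simp: straight_def)
    then have f: "(i, t - 1) \<in> D" "neg_less par (T (j, t)) (T (i, t - 1))" by (auto simp: flippable_def)
    then have "pos_less par (T (i, t - 1)) (T (i, t))"
      using T c(1) pos[OF c(1)] by (auto simp: straight_def row_standard_def)
    then show False using f(2) c(4,5) by (auto simp: pos_less_def neg_less_def)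
  qed
  have "c1 = c2" if c: "c1 \<in> D" "c2 \<in> D" "(T c1, snd c1) = x" "(T c2, snd c2) = x" for c1 c2
  proof -
    obtain i j t where ij: "c1 = (i, t)" "c2 = (j, t)" using c by (cases c1; cases c2) auto
    have "par (T (i, t)) = 0" "T (i, t) = T (j, t)" using c x ij by auto
    then show ?thesis using no[of i t j] no[of j t i] c ij by (cases i j rule: linorder_cases) auto
  qed
  then show ?thesis
    unfolding count_content[OF fin] using fin
    by (subst One_nat_def, subst card_le_Suc0_iff_eq) auto
qed

lemma pos_less_not_neg_less: "pos_less par a b \<Longrightarrow> neg_less par b a \<Longrightarrow> False"
  by (auto simp: pos_less_def neg_less_def)

text \<open>
  Reading the columns from left to right and each one downwards, a straight tableau always takes the
  smallest available letter that keeps the row standard.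
\<close>

lemma straight_first_difference:
  assumes D: "is_shape D" and S: "straight par D S" and T: "row_standard par D T"
    and cont: "content D S = content D T" and ne: "\<exists>c\<in>D. S c \<noteq> T c"
  obtains i t where "(i, t) \<in> D" "S (i, t) < T (i, t)"
    "\<And>r j. (r, j) \<in> D \<Longrightarrow> j < t \<or> (j = t \<and> r < i) \<Longrightarrow> S (r, j) = T (r, j)"
proof -
  have fin: "finite D" and pos: "(i, t) \<in> D \<Longrightarrow> t \<ge> 1" for i t using D by (auto simp: is_shape_def)
  let ?E = "prod.swap ` {c \<in> D. S c \<noteq> T c}"
  have E: "finite ?E" "?E \<noteq> {}" using fin ne by auto
  obtain t i where ti: "Min ?E = (t, i)" by fastforce
  then have "(t, i) \<in> ?E" using Min_in[OF E] by simp
  then have it: "(i, t) \<in> D" "S (i, t) \<noteq> T (i, t)" by auto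
  have first: "S (r, j) = T (r, j)" if "(r, j) \<in> D" "j < t \<or> (j = t \<and> r < i)" for r j
  proof (rule ccontr)
    assume "S (r, j) \<noteq> T (r, j)"
    then have "(j, r) \<in> ?E" using that by (intro image_eqI[of _ _ "(r, j)"]) auto
    then have "Min ?E \<le> (j, r)" by (rule Min_le[OF E(1)])
    then have "(t, i) \<le> (j, r)" unfolding ti .
    then show False using that(2) by auto
  qed
  let ?x = "T (i, t)"
  \<comment> \<open>The contents of column \<open>t\<close> agree and so do the entries above row
    \<open>i\<close>; the letter that \<open>T\<close> has here must therefore occur further down in
    \<open>S\<close>.\<close>
  have "\<exists>j. i < j \<and> (j, t) \<in> D \<and> S (j, t) = ?x"
  proof (rule ccontr)
    assume no: "\<not> (\<exists>j. i < j \<and> (j, t) \<in> D \<and> S (j, t) = ?x)"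
    have sub: "{c \<in> D. (S c, snd c) = (?x, t)} \<subseteq> {c \<in> D. (T c, snd c) = (?x, t)}"
    proof
      fix x assume "x \<in> {c \<in> D. (S c, snd c) = (?x, t)}"
      then obtain r where x: "x = (r, t)" "(r, t) \<in> D" "S (r, t) = ?x" by (cases x) auto
      then have "r < i" using no it(2) by (cases r i rule: linorder_cases) auto
      then show "x \<in> {c \<in> D. (T c, snd c) = (?x, t)}" using first[of r t] x by simp
    qed
    have "(i, t) \<in> {c \<in> D. (T c, snd c) = (?x, t)} - {c \<in> D. (S c, snd c) = (?x, t)}" using it by simp
    then have "{c \<in> D. (S c, snd c) = (?x, t)} \<subset> {c \<in> D. (T c, snd c) = (?x, t)}" using sub by blast
    then have "card {c \<in> D. (S c, snd c) = (?x, t)} < card {c \<in> D. (T c, snd c) = (?x, t)}"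
      using fin by (intro psubset_card_mono) auto
    then show False using cont count_content[OF fin, of S "(?x, t)"] count_content[OF fin, of T "(?x, t)"] by simp
  qed
  then obtain j where j: "i < j" "(j, t) \<in> D" "S (j, t) = ?x" by blast
  \<comment> \<open>A larger entry would form an inversion with that lower cell. Its left neighbour
    is shared with \<open>T\<close>, which is row-standard with \<open>?x\<close> in this place, so
    nothing would block the flip.\<close>
  have "S (i, t) < ?x"
  proof (rule ccontr)
    assume "\<not> S (i, t) < ?x"
    then have "?x < S (i, t)" using it(2) by simp
    then have "inversion par D S i j t" using j it(1) by (simp add: inversion_def pos_less_def)
    then have "\<not> flippable par D S i j t" using S by (auto simp: straight_def)
    then have f: "(i, t - 1) \<in> D" "neg_less par ?x (S (i, t - 1))" using j by (auto simp: flippable_def)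
    have "t - 1 < t" using pos[OF it(1)] by simp
    then have "S (i, t - 1) = T (i, t - 1)" using first[OF f(1)] by simp
    then have "neg_less par ?x (T (i, t - 1))" using f(2) by (simp only:)
    moreover have "pos_less par (T (i, t - 1)) ?x"
      using \<open>t - 1 < t\<close> T f(1) it(1) unfolding row_standard_def by blast
    ultimately show False by (rule pos_less_not_neg_less[rotated])
  qed
  then show thesis using that it(1) first by blast
qed

text \<open>Each of the two tableaux would have the smaller letter at the first difference.\<close>

lemma straight_unique:
  assumes D: "is_shape D" and S: "straight par D S" and T: "straight par D T"
    and cont: "content D S = content D T" and c: "c \<in> D"
  shows "S c = T c"
proof (rule ccontr)
  assume "S c \<noteq> T c"
  then have ne: "\<exists>c\<in>D. S c \<noteq> T c" "\<exists>c\<in>D. T c \<noteq> S c" using c by metis+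
  have std: "row_standard par D S" "row_standard par D T" using S T by (auto simp: straight_def)
  obtain i t where 1: "(i, t) \<in> D" "S (i, t) < T (i, t)"
    "\<And>r j. (r, j) \<in> D \<Longrightarrow> j < t \<or> (j = t \<and> r < i) \<Longrightarrow> S (r, j) = T (r, j)"
    using straight_first_difference[OF D S std(2) cont ne(1)] by blast
  obtain i' t' where 2: "(i', t') \<in> D" "T (i', t') < S (i', t')"
    "\<And>r j. (r, j) \<in> D \<Longrightarrow> j < t' \<or> (j = t' \<and> r < i') \<Longrightarrow> T (r, j) = S (r, j)"
    using straight_first_difference[OF D T std(1) cont[symmetric] ne(2)] by blast
  consider "t < t' \<or> (t = t' \<and> i < i')" | "t' < t \<or> (t' = t \<and> i' < i)" | "(i, t) = (i', t')" by force
  then show False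
    by cases (use 1 2 in \<open>force+\<close>)
qed

subsection \<open>Triangularity\<close>

definition straight_tableaux :: "('a::linorder \<Rightarrow> bit) \<Rightarrow> (nat \<times> nat) set \<Rightarrow> 'a set \<Rightarrow> (nat \<times> nat \<Rightarrow> 'a) set" where
  "straight_tableaux par D A = {S \<in> D \<rightarrow>\<^sub>E A. straight par D S}"

lemma finite_straight_tableaux: "finite D \<Longrightarrow> finite A \<Longrightarrow> finite (straight_tableaux par D A)"
  unfolding straight_tableaux_def by (rule finite_subset[of _ "D \<rightarrow>\<^sub>E A"]) (auto intro: finite_PiE)

text \<open>At the content of a heaviest term no other term contributes: a lighter one cannot reach
  this weight, and an equally heavy one would have the same content and so be the same tableau. The
  clause on all heaviest terms serves \<open>straightening_step\<close>, where the sum is a multiple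
  of one given element.\<close>

lemma leading_coefficient:
  assumes D: "is_shape D" and F: "finite F" "F \<subseteq> straight_tableaux par D A"
    and B: "finite B" "A \<times> snd ` D \<subseteq> B" and G: "card D < G"
    and S0: "S0 \<in> F" "c S0 \<noteq> 0"
  shows "\<exists>S e. S \<in> F \<and> c S \<noteq> 0 \<and> unit_sign e \<and>
    (\<forall>S'\<in>F. c S' \<noteq> 0 \<longrightarrow> mweight G B (content D S') \<le> mweight G B (content D S)) \<and>
    (\<forall>S'\<in>F. c S' \<noteq> 0 \<longrightarrow> mweight G B (content D S') = mweight G B (content D S) \<longrightarrow>
      (\<Sum>R\<in>F. c R * elem_cf par D R (content D S')) \<noteq> 0) \<and>
    (\<Sum>S'\<in>F. c S' * elem_cf par D S' (content D S)) = e * c S"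
proof -
  have fin: "finite D" using D by (simp add: is_shape_def)
  let ?wt = "\<lambda>S. mweight G B (content D S)"
  let ?F = "{S \<in> F. c S \<noteq> 0}"
  define m where "m = Max (?wt ` ?F)"
  have ne: "finite ?F" "?F \<noteq> {}" using F S0 by auto
  have max: "?wt S \<le> m" if "S \<in> F" "c S \<noteq> 0" for S
    unfolding m_def using that ne by (intro Max_ge) auto
  have st: "S \<in> D \<rightarrow>\<^sub>E A" "straight par D S" "row_standard par D S" "S ` D \<times> snd ` D \<subseteq> B" if "S \<in> F" for S
  proof -
    show 1: "S \<in> D \<rightarrow>\<^sub>E A" and "straight par D S" using that F by (auto simp: straight_tableaux_def)
    then show "row_standard par D S" by (simp add: straight_def)
    have "S ` D \<subseteq> A" using 1 by auto
    then show "S ` D \<times> snd ` D \<subseteq> B" using B(2) by blast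
  qed
  have sum: "\<exists>e. unit_sign e \<and> (\<Sum>R\<in>F. c R * elem_cf par D R (content D S)) = e * c S"
    if S: "S \<in> F" "c S \<noteq> 0" "?wt S = m" for S
  proof -
    have "(\<Sum>R\<in>F. c R * elem_cf par D R (content D S)) = (\<Sum>R\<in>{S}. c R * elem_cf par D R (content D S))"
    proof (rule sum.mono_neutral_right)
      show "\<forall>R\<in>F - {S}. c R * elem_cf par D R (content D S) = 0"
      proof
        fix R assume R: "R \<in> F - {S}"
        show "c R * elem_cf par D R (content D S) = 0"
        proof (rule ccontr)
          assume a: "c R * elem_cf par D R (content D S) \<noteq> 0"
          then have "content D S = content D R \<or> ?wt S < ?wt R"
            using R by (intro elem_leading(1)[OF fin st(3) B(1) st(4) G]) auto
          then have "content D S = content D R" using max[of R] R a S(3) by auto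
          then have "S c = R c" if "c \<in> D" for c
            using straight_unique[OF D st(2)[OF S(1)] st(2)] R that by blast
          then have "S = R" using st(1)[OF S(1)] st(1)[of R] R by (intro PiE_ext[of S D "\<lambda>_. A" R]) auto
          then show False using R by blast
        qed
      qed
    qed (use F S in auto)
    moreover have "unit_sign (elem_cf par D S (content D S))"
      using straight_column_distinct[OF D st(2)[OF S(1)]]
      by (intro elem_leading(2)[OF fin st(3)[OF S(1)] B(1) st(4)[OF S(1)] G]) auto
    ultimately show ?thesis by (intro exI[of _ "elem_cf par D S (content D S)"]) simp
  qed
  have "m \<in> ?wt ` ?F" unfolding m_def using ne by (intro Max_in) auto
  then obtain S where S: "S \<in> F" "c S \<noteq> 0" "?wt S = m" by auto
  from sum[OF S] obtain e where e: "unit_sign e" "(\<Sum>R\<in>F. c R * elem_cf par D R (content D S)) = e * c S" by blast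
  have "(\<Sum>R\<in>F. c R * elem_cf par D R (content D S')) \<noteq> 0" if S': "S' \<in> F" "c S' \<noteq> 0" "?wt S' = ?wt S" for S'
  proof -
    obtain e' where "unit_sign e'" "(\<Sum>R\<in>F. c R * elem_cf par D R (content D S')) = e' * c S'"
      using sum[OF S'(1,2)] S'(3) S(3) by auto
    then show ?thesis using S'(2) by (auto simp: unit_sign_def)
  qed
  moreover have "?wt S' \<le> ?wt S" if "S' \<in> F" "c S' \<noteq> 0" for S' using max[OF that] S(3) by simp
  ultimately show ?thesis using S(1,2) e by (intro exI[of _ S] exI[of _ e] conjI ballI impI) simp_all
qed

text \<open>Rational combinations with denominators cleared; confining the letters to a finite
  \<open>A\<close> keeps the sum finite over an infinite alphabet.\<close>

definition rat_span :: "('a::linorder \<Rightarrow> bit) \<Rightarrow> (nat \<times> nat) set \<Rightarrow> 'a set \<Rightarrow> (('a \<times> nat) multiset \<Rightarrow> int) \<Rightarrow> bool" where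
  "rat_span par D A x \<longleftrightarrow> (\<exists>k c. k \<noteq> 0 \<and>
     (\<forall>M. k * x M = (\<Sum>S\<in>straight_tableaux par D A. c S * elem_cf par D S M)))"

lemma rat_closed_rat_span: "rat_closed (rat_span par D A)"
  unfolding rat_closed_def
proof (intro conjI allI impI)
  show "rat_span par D A (\<lambda>_. 0)"
    unfolding rat_span_def by (intro exI[of _ 1] exI[of _ "\<lambda>_. 0"]) simp
next
  fix x y assume "rat_span par D A x" "rat_span par D A y"
  then obtain k c l d where k: "k \<noteq> 0" "\<And>M. k * x M = (\<Sum>S\<in>straight_tableaux par D A. c S * elem_cf par D S M)"
    and l: "l \<noteq> 0" "\<And>M. l * y M = (\<Sum>S\<in>straight_tableaux par D A. d S * elem_cf par D S M)"
    unfolding rat_span_def by blast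
  have "(k * l) * (x M + y M) = (\<Sum>S\<in>straight_tableaux par D A. (l * c S + k * d S) * elem_cf par D S M)" for M
  proof -
    have "(k * l) * (x M + y M) = l * (k * x M) + k * (l * y M)" by (simp add: algebra_simps)
    then show ?thesis unfolding k l by (simp add: sum_distrib_left sum.distrib algebra_simps)
  qed
  then show "rat_span par D A (\<lambda>M. x M + y M)" using k(1) l(1) unfolding rat_span_def
    by (intro exI[of _ "k * l"] exI[of _ "\<lambda>S. l * c S + k * d S"]) simp
next
  fix a x assume "rat_span par D A x"
  then obtain k c where k: "k \<noteq> 0" "\<And>M. k * x M = (\<Sum>S\<in>straight_tableaux par D A. c S * elem_cf par D S M)"
    unfolding rat_span_def by blast
  have "k * (a * x M) = (\<Sum>S\<in>straight_tableaux par D A. (a * c S) * elem_cf par D S M)" for M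
    using k(2)[of M] by (simp add: mult.left_commute[of k] sum_distrib_left mult.assoc)
  then show "rat_span par D A (\<lambda>M. a * x M)" using k(1) unfolding rat_span_def by metis
next
  fix a x assume "a \<noteq> 0" "rat_span par D A (\<lambda>M. a * x M)"
  then obtain k c where k: "k \<noteq> 0" "\<And>M. k * (a * x M) = (\<Sum>S\<in>straight_tableaux par D A. c S * elem_cf par D S M)"
    unfolding rat_span_def by blast
  then show "rat_span par D A x" using \<open>a \<noteq> 0\<close> unfolding rat_span_def
    by (intro exI[of _ "k * a"] exI[of _ c]) (simp add: mult.assoc)
qed

text \<open>If \<open>k\<close> failed to divide some coefficient, reducing all of them modulo
  \<open>k\<close> would leave a nonzero combination with all values divisible by \<open>k\<close>.
  But one of its values is, up to sign, a nonzero residue.\<close>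

lemma rat_span_integral:
  assumes D: "is_shape D" and A: "finite A" and x: "rat_span par D A x"
  obtains c where "\<And>M. x M = (\<Sum>S\<in>straight_tableaux par D A. c S * elem_cf par D S M)"
proof -
  let ?I = "straight_tableaux par D A"
  have fin: "finite D" using D by (simp add: is_shape_def)
  obtain k c where k: "k \<noteq> 0" "\<And>M. k * x M = (\<Sum>S\<in>?I. c S * elem_cf par D S M)"
    using x unfolding rat_span_def by blast
  have "k dvd c S" if S: "S \<in> ?I" for S
  proof (rule ccontr)
    assume "\<not> k dvd c S"
    then have "c S mod k \<noteq> 0" by (simp add: dvd_eq_mod_eq_0)
    have B: "finite (A \<times> snd ` D)" using A fin by simp
    obtain S' e where S': "c S' mod k \<noteq> 0" "unit_sign e"
      "(\<Sum>R\<in>?I. (c R mod k) * elem_cf par D R (content D S')) = e * (c S' mod k)"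
      using leading_coefficient[where c = "\<lambda>S. c S mod k",
          OF D finite_straight_tableaux[OF fin A] order_refl B order_refl lessI S \<open>c S mod k \<noteq> 0\<close>] by blast
    have mod: "(\<Sum>R\<in>?I. (c R mod k) * elem_cf par D R M) =
        k * (x M - (\<Sum>R\<in>?I. (c R div k) * elem_cf par D R M))" for M
    proof -
      have "(\<Sum>R\<in>?I. c R * elem_cf par D R M) =
          (\<Sum>R\<in>?I. (c R mod k) * elem_cf par D R M) + k * (\<Sum>R\<in>?I. (c R div k) * elem_cf par D R M)"
        unfolding sum_distrib_left sum.distrib[symmetric]
      proof (rule sum.cong[OF refl])
        fix R
        have "c R = c R mod k + k * (c R div k)" by simp
        then show "c R * elem_cf par D R M = (c R mod k) * elem_cf par D R M + k * ((c R div k) * elem_cf par D R M)"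
          by (metis distrib_right mult.assoc)
      qed
      then show ?thesis using k(2)[of M] by (simp add: right_diff_distrib)
    qed
    have "k dvd e * (c S' mod k)" unfolding S'(3)[symmetric] mod by (rule dvd_triv_left)
    then have "k dvd c S' mod k" using S'(2) by (auto simp: unit_sign_def)
    then show False using S'(1) by (metis dvd_imp_mod_0 mod_mod_trivial)
  qed
  then have cS: "c S = k * (c S div k)" if "S \<in> ?I" for S using that by simp
  have "x M = (\<Sum>S\<in>?I. (c S div k) * elem_cf par D S M)" for M
  proof -
    have "k * x M = (\<Sum>S\<in>?I. k * ((c S div k) * elem_cf par D S M))"
      unfolding k(2) using cS by (intro sum.cong) (auto simp: mult.assoc[symmetric])
    then show ?thesis using k(1) by (simp flip: sum_distrib_left)
  qed
  then show thesis by (rule that)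
qed

subsection \<open>Reordering rows and entries of rows\<close>

lemma tab_poly_Nil [simp]: "tab_poly par [] [] = 1"
proof -
  have "{\<sigma> :: nat \<Rightarrow> nat. \<sigma> permutes {}} = {id}" by auto
  then have "tab_sum par [] [] = 1" by (simp add: tab_sum_def tab_sign_exp_def)
  then show ?thesis using content_fact_times_tab_poly[of par "[]" "[]"] by (simp add: content_fact_def)
qed

text \<open>A single row is treated as a pair whose lower row is empty, so that the symmetries of
  placements apply to it.\<close>

lemma tab_poly_two_rows:
  assumes "mset w = mset w'" "length p = length w"
  obtains e where "unit_sign e" "\<And>M. two_rows par (length w) (length w) ((!) w) ((!) p) {..<length w} M =
    e * (int (content_fact par w') * cf (lp_sign par) (tab_poly par w' p) M)"
proof -
  have l: "length w' = length w" using assms(1) by (metis size_mset)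
  have m: "mset w' = image_mset ((!) w) (mset_set {..<length w})"
    using assms(1) by (metis map_nth mset_map mset_upt atLeast0LessThan)
  obtain e where "unit_sign e" "\<And>M. two_rows par (length w + 0) (length w) ((!) w) ((!) (p @ [])) {..<length w} M =
     e * (int (content_fact par w') * int (content_fact par []) *
       cf (lp_sign par) (tab_poly par w' p * tab_poly par [] []) M)"
    by (rule two_rows_tab[OF l _ assms(2), of "[]" 0 "[]" "{..<length w}" "(!) w" par]) (use m in auto)
  then show thesis using that by (simp add: content_fact_def)
qed

lemma content_fact_cong:
  assumes "mset w = mset w'"
  shows "content_fact par w = content_fact par w'"
proof -
  have "set w = set w'" by (rule mset_eq_setD[OF assms])
  moreover have "count_list w a = count_list w' a" for a
    using arg_cong[OF assms, of "\<lambda>N. count N a"] by (simp add: count_mset)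
  ultimately show ?thesis by (simp add: content_fact_def)
qed

lemma tab_poly_permute:
  assumes "mset w = mset w'" "length p = length w"
  obtains e where "unit_sign e" "\<And>M. cf (lp_sign par) (tab_poly par w p) M = e * cf (lp_sign par) (tab_poly par w' p) M"
proof -
  let ?R = "two_rows par (length w) (length w) ((!) w) ((!) p) {..<length w}"
  obtain e where e: "unit_sign e" "\<And>M. ?R M = e * (int (content_fact par w) * cf (lp_sign par) (tab_poly par w p) M)"
    using tab_poly_two_rows[OF refl assms(2), where par = par] by blast
  obtain e' where e': "unit_sign e'" "\<And>M. ?R M = e' * (int (content_fact par w') * cf (lp_sign par) (tab_poly par w' p) M)"
    using tab_poly_two_rows[OF assms, where par = par] by blast
  have "cf (lp_sign par) (tab_poly par w p) M = (e * e') * cf (lp_sign par) (tab_poly par w' p) M" for M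
  proof -
    have "e * (int (content_fact par w) * cf (lp_sign par) (tab_poly par w p) M) =
        e' * (int (content_fact par w) * cf (lp_sign par) (tab_poly par w' p) M)"
      using e(2) e'(2) content_fact_cong[OF assms(1), of par] by metis
    then show ?thesis using e(1) e'(1) content_fact_pos[of par w] by (auto simp: unit_sign_def)
  qed
  then show thesis using that e(1) e'(1) unit_sign_mult by blast
qed

lemma tab_poly_repeated_negative:
  assumes "i < length w" "j < length w" "i \<noteq> j" "w ! i = w ! j" "par (w ! i) = 1" "length p = length w"
  shows "cf (lp_sign par) (tab_poly par w p) M = 0"
proof -
  obtain e where e: "unit_sign e" "\<And>M. two_rows par (length w) (length w) ((!) w) ((!) p) {..<length w} M =
    e * (int (content_fact par w) * cf (lp_sign par) (tab_poly par w p) M)"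
    using tab_poly_two_rows[OF refl assms(6), where par = par] by blast
  have "two_rows par (length w) (length w) ((!) w) ((!) p) {..<length w} M = 0"
    using assms by (intro two_rows_repeated_negative[of i _ j]) auto
  then show ?thesis using e content_fact_pos[of par w] by (auto simp: unit_sign_def)
qed

lemma cf_prod_list_scaled:
  assumes "\<And>r. r \<in> set rs \<Longrightarrow> \<exists>e. unit_sign e \<and> (\<forall>M. cf s (f r) M = e * cf s (g r) M)"
  shows "\<exists>e. unit_sign e \<and> (\<forall>M. cf s (prod_list (map f rs)) M = e * cf s (prod_list (map g rs)) M)"
  using assms
proof (induction rs)
  case Nil
  then show ?case by (intro exI[of _ 1]) simp
next
  case (Cons r rs)
  obtain e where e: "unit_sign e" "\<And>M. cf s (f r) M = e * cf s (g r) M" using Cons.prems by auto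
  obtain e' where e': "unit_sign e'" "\<And>M. cf s (prod_list (map f rs)) M = e' * cf s (prod_list (map g rs)) M"
    using Cons by auto
  show ?case
    using cf_mult_scaled[of s "f r" e "g r", OF e(2) e'(2)] e(1) e'(1)
    by (intro exI[of _ "e * e'"]) (simp add: unit_sign_mult)
qed

lemma cf_prod_list_zero:
  assumes "r \<in> set rs" "\<And>M. cf s (f r) M = 0"
  shows "cf s (prod_list (map f rs)) M = 0"
  using assms(1)
proof (induction rs arbitrary: M)
  case (Cons r' rs)
  show ?case
  proof (cases "r = r'")
    case True
    have "cf s (f r' * prod_list (map f rs)) M = 0 * 1 * cf s (1 * prod_list (map f rs)) M"
      by (rule cf_mult_scaled) (use True assms(2) in auto)
    then show ?thesis by simp
  next
    case False
    then have "cf s (prod_list (map f rs)) M = 0" for M using Cons by auto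
    then have "cf s (f r' * prod_list (map f rs)) M = 1 * 0 * cf s (f r' * 1) M"
      by (intro cf_mult_scaled) auto
    then show ?thesis by simp
  qed
qed simp

section \<open>Rows commute up to sign\<close>

definition oddc :: "('g \<Rightarrow> bit) \<Rightarrow> 'g multiset \<Rightarrow> nat" where
  "oddc s M = size {#x \<in># M. s x = 1#}"

lemma cross_swap: "cross s M N = (- 1) ^ (oddc s M * oddc s N) * cross s N M"
proof (induction M)
  case empty
  then show ?case by (simp add: cross_def oddc_def)
next
  case (add x M)
  have 1: "cross s N (add_mset x M) = (\<Prod>y\<in>#N. exch s y x) * cross s N M"
    by (simp add: cross_def prod_mset.distrib)
  have 2: "(\<Prod>y\<in>#N. exch s x y) = (- 1) ^ ((if s x = 1 then 1 else 0) * oddc s N) * (\<Prod>y\<in>#N. exch s y x)"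
    by (induction N) (auto simp: oddc_def exch_swap[of s _ x])
  have "cross s (add_mset x M) N = (\<Prod>y\<in>#N. exch s x y) * cross s M N" by (simp add: cross_def)
  also have "\<dots> = (- 1) ^ (oddc s (add_mset x M) * oddc s N) * cross s N (add_mset x M)"
    unfolding 1 2 add.IH by (simp add: oddc_def power_add)
  finally show ?case .
qed

definition homogeneous :: "('g \<Rightarrow> bit) \<Rightarrow> 'g ncpoly \<Rightarrow> bool \<Rightarrow> bool" where
  "homogeneous s q b \<longleftrightarrow> (\<forall>u\<in>Poly_Mapping.keys q. odd (oddc s (mset (letters u))) = b)"

lemma cf_mult_commute:
  assumes "homogeneous s p a" "homogeneous s q b"
  shows "cf s (p * q) M = (if a \<and> b then - 1 else 1) * cf s (q * p) M"
proof -
  have "cf s (p * q) M = (\<Sum>u\<in>Poly_Mapping.keys p. \<Sum>v\<in>Poly_Mapping.keys q. (if a \<and> b then - 1 else 1) *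
     (Poly_Mapping.lookup q v * Poly_Mapping.lookup p u * cw s (letters v @ letters u) M))"
    unfolding cf_mult
  proof (intro sum.cong refl)
    fix u v assume "u \<in> Poly_Mapping.keys p" "v \<in> Poly_Mapping.keys q"
    then have "odd (oddc s (mset (letters u))) = a" "odd (oddc s (mset (letters v))) = b"
      using assms by (auto simp: homogeneous_def)
    then have "(- 1 :: int) ^ (oddc s (mset (letters u)) * oddc s (mset (letters v))) = (if a \<and> b then - 1 else 1)"
      by (auto simp: minus_one_power_iff)
    then have "cw s (letters u @ letters v) M = (if a \<and> b then - 1 else 1) * cw s (letters v @ letters u) M"
      using cross_swap[of s "mset (letters u)" "mset (letters v)"]
      by (simp add: cw_def wsgn_append union_commute)
    then show "Poly_Mapping.lookup p u * Poly_Mapping.lookup q v * cw s (letters u @ letters v) M =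
        (if a \<and> b then - 1 else 1) * (Poly_Mapping.lookup q v * Poly_Mapping.lookup p u * cw s (letters v @ letters u) M)"
      by simp
  qed
  also have "\<dots> = (if a \<and> b then - 1 else 1) * cf s (q * p) M"
    unfolding cf_mult by (subst sum.swap) (simp add: sum_distrib_left)
  finally show ?thesis .
qed

lemma homogeneous_mult: "homogeneous s p a \<Longrightarrow> homogeneous s q b \<Longrightarrow> homogeneous s (p * q) (a \<noteq> b)"
  unfolding homogeneous_def
proof
  fix u assume h: "\<forall>u\<in>Poly_Mapping.keys p. odd (oddc s (mset (letters u))) = a"
    "\<forall>u\<in>Poly_Mapping.keys q. odd (oddc s (mset (letters u))) = b" and "u \<in> Poly_Mapping.keys (p * q)"
  then obtain x y where "u = x + y" "x \<in> Poly_Mapping.keys p" "y \<in> Poly_Mapping.keys q"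
    using keys_mult[of p q] by blast
  then show "odd (oddc s (mset (letters u))) = (a \<noteq> b)" using h by (auto simp: oddc_def)
qed

lemma homogeneous_prod_list:
  "(\<And>q. q \<in> set L \<Longrightarrow> \<exists>b. homogeneous s q b) \<Longrightarrow> \<exists>b. homogeneous s (prod_list L) b"
proof (induction L)
  case Nil
  have "homogeneous s 1 False" by (auto simp: homogeneous_def oddc_def zero_fword_def)
  then show ?case by auto
next
  case (Cons q L)
  obtain a where "homogeneous s q a" using Cons.prems by auto
  moreover obtain b where "homogeneous s (prod_list L) b" using Cons by auto
  ultimately show ?case using homogeneous_mult by fastforce
qed

lemma cf_prod_list_perm:
  assumes "mset L = mset L'" "\<And>q. q \<in> set L \<Longrightarrow> \<exists>b. homogeneous s q b"
  shows "\<exists>e. unit_sign e \<and> (\<forall>M. cf s (prod_list L) M = e * cf s (prod_list L') M)"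
  using assms
proof (induction L arbitrary: L')
  case Nil
  then show ?case by (intro exI[of _ 1]) simp
next
  case (Cons x L)
  then have "x \<in> set L'" by (metis list.set_intros(1) mset_eq_setD)
  then obtain ys zs where L': "L' = ys @ x # zs" by (meson split_list)
  then have "mset L = mset (ys @ zs)" using Cons.prems(1) by simp
  then obtain e where e: "unit_sign e" "\<And>M. cf s (prod_list L) M = e * cf s (prod_list (ys @ zs)) M"
    using Cons.IH[of "ys @ zs"] Cons.prems(2) by auto
  have set: "set (x # L) = set L'" using Cons.prems(1) by (metis mset_eq_setD)
  obtain a where a: "homogeneous s x a" using Cons.prems(2) by auto
  have "\<exists>b. homogeneous s q b" if "q \<in> set ys" for q
    by (rule Cons.prems(2)) (use that set L' in auto)
  then obtain b where b: "homogeneous s (prod_list ys) b" using homogeneous_prod_list by blast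
  let ?e = "if a \<and> b then - 1 else 1 :: int"
  have "cf s (prod_list (x # L)) M = e * ?e * cf s (prod_list L') M" for M
  proof -
    have "cf s (x * prod_list L) M = 1 * e * cf s (x * prod_list (ys @ zs)) M"
      by (rule cf_mult_scaled) (use e in auto)
    also have "x * prod_list (ys @ zs) = (x * prod_list ys) * prod_list zs" by (simp add: mult.assoc)
    also have "cf s ((x * prod_list ys) * prod_list zs) M = ?e * 1 * cf s ((prod_list ys * x) * prod_list zs) M"
      by (rule cf_mult_scaled[OF cf_mult_commute[OF a b]]) simp
    finally show ?thesis by (simp add: L' mult.assoc)
  qed
  then show ?case using e(1) by (intro exI[of _ "e * ?e"]) (use unit_sign_mult[of e ?e] in \<open>simp add: unit_sign_def\<close>)
qed

text \<open>Every word of the row uses each entry once, so its number of odd generators is the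
  number of positive entries.\<close>

lemma homogeneous_tab_poly:
  "\<exists>b. homogeneous (lp_sign par) (tab_poly par w p) b"
proof -
  have "oddc (lp_sign par) (mset (letters u)) = size {#a \<in># mset w. par a = 0#}"
    if u: "u \<in> Poly_Mapping.keys (tab_poly par w p)" for u
  proof -
    obtain \<sigma> where \<sigma>: "\<sigma> permutes {..<length w}" "letters u = map (\<lambda>i. (w ! \<sigma> i, p ! i)) [0..<length w]"
      using keys_tab_poly[OF u] .
    have "oddc (lp_sign par) (mset (letters u)) = size (filter_mset (\<lambda>a. par a = 0) (image_mset fst (mset (letters u))))"
      unfolding oddc_def filter_mset_image_mset size_image_mset
      by (rule arg_cong[of _ _ size], rule filter_mset_cong[OF refl]) (simp add: comp_def split_beta lp_sign_def)
    also have "image_mset fst (mset (letters u)) = mset (map ((!) w \<circ> \<sigma>) [0..<length w])"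
      unfolding \<sigma>(2) by (simp add: image_mset.compositionality comp_def)
    also have "\<dots> = mset w" unfolding mset_map_permute[OF \<sigma>(1)] by (simp add: map_nth)
    finally show ?thesis .
  qed
  then show ?thesis
    unfolding homogeneous_def by (intro exI[of _ "odd (size {#a \<in># mset w. par a = 0#})"]) simp
qed

subsection \<open>Spanning\<close>

lemma row_columns_interval:
  assumes D: "finite D" "row_convex D" and ne: "row_columns D r \<noteq> {}"
  obtains s m where "row_columns D r = {s..<s + m}" "Max (row_columns D r) + 1 = s + m"
proof -
  let ?C = "row_columns D r"
  have C: "finite ?C" by (rule finite_row_columns[OF D(1)])
  have in1: "Min ?C \<in> ?C" "Max ?C \<in> ?C" using C ne by auto
  have "?C = {Min ?C..Max ?C}"
  proof (intro equalityI subsetI)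
    fix j assume j: "j \<in> {Min ?C..Max ?C}"
    show "j \<in> ?C"
    proof (cases "j = Min ?C \<or> j = Max ?C")
      case True
      then show ?thesis using in1 by auto
    next
      case False
      then have "Min ?C < j" "j < Max ?C" using j by auto
      then show ?thesis using in1 D(2) unfolding row_convex_def row_columns_def by blast
    qed
  qed (use C in auto)
  moreover have "Min ?C \<le> Max ?C" using C ne by auto
  then have "{Min ?C..Max ?C} = {Min ?C..<Min ?C + (Max ?C + 1 - Min ?C)}"
    "Max ?C + 1 = Min ?C + (Max ?C + 1 - Min ?C)" by auto
  ultimately show thesis using that by metis
qed

lemma row_elem_cong:
  assumes "row_columns D r = row_columns D' r" "\<And>j. j \<in> row_columns D r \<Longrightarrow> T (r, j) = S (r, j)" "finite D"
  shows "row_elem par D T r = row_elem par D' S r"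
proof -
  have "row_places D r = row_places D' r" using assms(1) by (simp add: row_places_def)
  moreover have "row_word D T r = row_word D' S r"
    unfolding row_word_def calculation[symmetric]
    by (rule map_cong) (use assms row_places_simps(1)[OF assms(3)] in auto)
  ultimately show ?thesis by (simp add: row_elem_def)
qed

text \<open>\<open>two_row_spanning\<close> is applied to membership in the span itself; its base
  case consists of pairs of rows that are straight tableaux of the two-rowed shape
  \<open>E\<close>.\<close>

lemma two_row_rat_span:
  fixes par :: "'a::linorder \<Rightarrow> bit"
  assumes D: "is_shape D" "row_convex D" and ij: "i < j" "row_columns D i \<noteq> {}" "row_columns D j \<noteq> {}"
  defines "E \<equiv> {c \<in> D. fst c = i \<or> fst c = j}"
  assumes T: "T \<in> E \<rightarrow>\<^sub>E A" and A: "finite A"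
  shows "rat_span par E A (elem_cf par E T)"
proof -
  have fin: "finite D" using D by (simp add: is_shape_def)
  then have finE: "finite E" by (simp add: E_def)
  obtain s1 n1 where r1: "row_columns D i = {s1..<s1 + n1}" "Max (row_columns D i) + 1 = s1 + n1"
    by (rule row_columns_interval[OF fin D(2) ij(2)])
  obtain s2 n2 where r2: "row_columns D j = {s2..<s2 + n2}" "Max (row_columns D j) + 1 = s2 + n2"
    by (rule row_columns_interval[OF fin D(2) ij(3)])
  have "Max (row_columns D j) \<le> Max (row_columns D i)" using D(2) ij unfolding row_convex_def by blast
  then have ends: "s2 + n2 \<le> s1 + n1" using r1(2) r2(2) by linarith
  have cE: "row_columns E i = {s1..<s1 + n1}" "row_columns E j = {s2..<s2 + n2}"
    unfolding r1(1)[symmetric] r2(1)[symmetric] by (auto simp: E_def row_columns_def)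
  have pE: "row_places E i = [s1..<s1 + n1]" "row_places E j = [s2..<s2 + n2]"
    unfolding row_places_def cE by simp_all
  have mE: "(i, k) \<in> E \<longleftrightarrow> k \<in> {s1..<s1 + n1}" "(j, k) \<in> E \<longleftrightarrow> k \<in> {s2..<s2 + n2}" for k
    using cE by (auto simp: row_columns_def)
  have rowsE: "c \<in> E \<Longrightarrow> fst c = i \<or> fst c = j" for c by (auto simp: E_def)
  have "fst ` E = {i, j}" using ij mE cE
    by (auto simp: E_def row_columns_def image_iff)
  then have rs: "sorted_list_of_set (fst ` E) = [i, j]" using ij(1) by simp
  have el: "elem_cf par E S = rows_cf par [s1..<s1 + n1] [s2..<s2 + n2] (row_word E S i) (row_word E S j)" for S
    unfolding elem_cf_def elem_def rows_cf_def rs row_elem_def by (simp add: pE)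
  have wE: "row_word E S i = map (\<lambda>k. S (i, k)) [s1..<s1 + n1]" "row_word E S j = map (\<lambda>k. S (j, k)) [s2..<s2 + n2]" for S
    unfolding row_word_def pE by simp_all
  let ?L = "mset (row_word E T i) + mset (row_word E T j)"
  have LA: "set_mset ?L \<subseteq> A" using T mE unfolding wE by auto
  show ?thesis
    unfolding el
  proof (rule two_row_spanning[OF rat_closed_rat_span ends, of ?L par])
    show "length (row_word E T i) = n1" "length (row_word E T j) = n2" unfolding wE by simp_all
    show "mset (row_word E T i) + mset (row_word E T j) = ?L" ..
  next
    fix w1 w2 :: "'a list"
    assume l: "length w1 = n1" "length w2 = n2" and L: "mset w1 + mset w2 = ?L"
      and std: "row_std par w1" "row_std par w2" and nf: "\<And>i1 i2. \<not> row_flip par s1 s2 w1 w2 i1 i2"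
    define S where "S c = (if c \<in> E then if fst c = i then w1 ! (snd c - s1) else w2 ! (snd c - s2) else undefined)" for c
    have Si: "S (i, k) = w1 ! (k - s1)" if "k \<in> {s1..<s1 + n1}" for k using that mE by (simp add: S_def)
    have Sj: "S (j, k) = w2 ! (k - s2)" if "k \<in> {s2..<s2 + n2}" for k using that mE ij by (simp add: S_def)
    have w: "row_word E S i = w1" "row_word E S j = w2"
      unfolding wE by (rule nth_equalityI; use l Si Sj in simp)+
    have "set w1 \<subseteq> A" "set w2 \<subseteq> A" using LA unfolding L[symmetric] by auto
    then have "w1 ! k \<in> A" if "k < n1" for k using that l by auto
    moreover have "w2 ! k \<in> A" if "k < n2" for k using that l \<open>set w2 \<subseteq> A\<close> by auto
    ultimately have SA: "S \<in> E \<rightarrow>\<^sub>E A"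
    proof (intro PiE_I)
      fix c assume a: "\<And>k. k < n1 \<Longrightarrow> w1 ! k \<in> A" "\<And>k. k < n2 \<Longrightarrow> w2 ! k \<in> A" and c: "c \<in> E"
      obtain r k where rk: "c = (r, k)" by fastforce
      then consider "r = i" | "r = j" using rowsE[OF c] by auto
      then show "S c \<in> A"
      proof cases
        case 1
        then have "k \<in> {s1..<s1 + n1}" using c rk mE by simp
        then show ?thesis using Si[of k] a(1)[of "k - s1"] rk 1 by auto
      next
        case 2
        then have "k \<in> {s2..<s2 + n2}" using c rk mE by simp
        then show ?thesis using Sj[of k] a(2)[of "k - s2"] rk 2 by auto
      qed
    qed (simp add: S_def)
    have "row_standard par E S"
      unfolding row_standard_def
    proof (intro allI impI, elim conjE)
      fix r k l' assume c: "(r, k) \<in> E" "(r, l') \<in> E" "k < l'"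
      consider "r = i" | "r = j" using rowsE[OF c(1)] by auto
      then show "pos_less par (S (r, k)) (S (r, l'))"
      proof cases
        case 1
        then have k: "k \<in> {s1..<s1 + n1}" "l' \<in> {s1..<s1 + n1}" using c mE by auto
        then have "pos_less par (w1 ! (k - s1)) (w1 ! (l' - s1))"
          using std(1) l c(3) unfolding row_std_def sorted_wrt_iff_nth_less by auto
        then show ?thesis using Si k 1 by simp
      next
        case 2
        then have k: "k \<in> {s2..<s2 + n2}" "l' \<in> {s2..<s2 + n2}" using c mE by auto
        then have "pos_less par (w2 ! (k - s2)) (w2 ! (l' - s2))"
          using std(2) l c(3) unfolding row_std_def sorted_wrt_iff_nth_less by auto
        then show ?thesis using Sj k 2 by simp
      qed
    qed
    moreover have "\<not> (inversion par E S r r' k \<and> flippable par E S r r' k)" for r r' k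
    proof
      assume a: "inversion par E S r r' k \<and> flippable par E S r r' k"
      then have "r < r'" "(r, k) \<in> E" "(r', k) \<in> E" by (auto simp: inversion_def)
      then have r: "r = i" "r' = j" using rowsE[of "(r, k)"] rowsE[of "(r', k)"] ij(1) by auto
      then have k: "k \<in> {s1..<s1 + n1}" "k \<in> {s2..<s2 + n2}"
        using \<open>(r, k) \<in> E\<close> \<open>(r', k) \<in> E\<close> mE by auto
      have "pos_less par (w2 ! (k - s2)) (w1 ! (k - s1))"
        using a Si[OF k(1)] Sj[OF k(2)] r by (simp add: inversion_def)
      \<comment> \<open>Since the row is an interval, a positive position \<open>k - s1\<close>
        means that the cell to the left belongs to the shape.\<close>
      then have "k - s1 > 0 \<and> neg_less par (w2 ! (k - s2)) (w1 ! (k - s1 - 1))"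
        using nf[of "k - s1" "k - s2"] k l unfolding row_flip_def by auto
      moreover from this k have k1: "k - 1 \<in> {s1..<s1 + n1}" by auto
      moreover have "k - 1 - s1 = k - s1 - 1" by simp
      ultimately have "(i, k - 1) \<in> E \<and> neg_less par (S (j, k)) (S (i, k - 1))"
        using Si[OF k1] Sj[OF k(2)] mE by simp
      then show False using a r by (simp add: flippable_def)
    qed
    ultimately have S: "S \<in> straight_tableaux par E A" using SA by (auto simp: straight_tableaux_def straight_def)
    have I: "finite (straight_tableaux par E A)" by (rule finite_straight_tableaux[OF finE A])
    have "(\<Sum>R\<in>straight_tableaux par E A. (if R = S then 1 else 0) * elem_cf par E R M) = 1 * elem_cf par E S M" for M
    proof -
      have "(\<Sum>R\<in>straight_tableaux par E A. (if R = S then 1 else 0) * elem_cf par E R M) =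
          (\<Sum>R\<in>straight_tableaux par E A. if R = S then elem_cf par E S M else 0)" by (rule sum.cong) auto
      then show ?thesis using S I by simp
    qed
    then have "rat_span par E A (elem_cf par E S)"
      unfolding rat_span_def by (intro exI[of _ 1] exI[of _ "\<lambda>R. if R = S then 1 else 0"]) simp
    then show "rat_span par E A (rows_cf par [s1..<s1 + n1] [s2..<s2 + n2] w1 w2)"
      unfolding el w .
  qed
qed

text \<open>Breaks ties between tableaux with the same column contents.\<close>

definition cell_rank :: "(nat \<times> nat) set \<Rightarrow> 'a::linorder set \<Rightarrow> (nat \<times> nat \<Rightarrow> 'a) \<Rightarrow> nat" where
  "cell_rank D A T = (\<Sum>c\<in>D. card {b \<in> A. b < T c} *
     (card A + 1) ^ card {d \<in> D. prod.swap c < prod.swap d})"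

lemma cell_rank_less:
  fixes S T :: "nat \<times> nat \<Rightarrow> 'a::linorder"
  assumes D: "finite D" and A: "finite A" and S: "S ` D \<subseteq> A" and it: "(i, t) \<in> D" "S (i, t) < T (i, t)"
    and eq: "\<And>r j. (r, j) \<in> D \<Longrightarrow> j < t \<or> (j = t \<and> r < i) \<Longrightarrow> S (r, j) = T (r, j)"
  shows "cell_rank D A S < cell_rank D A T"
proof -
  let ?pos = "\<lambda>c. card {d \<in> D. prod.swap c < prod.swap d}"
  have mono: "?pos d < ?pos c" if "d \<in> D" "prod.swap c < prod.swap d" for c d
    using that D by (intro psubset_card_mono) auto
  show ?thesis
    unfolding cell_rank_def
  proof (rule lex_sum_less[OF D _ it(1), of ?pos])
    show "inj_on ?pos D"
    proof (rule inj_onI)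
      fix c d assume cd: "c \<in> D" "d \<in> D" "?pos c = ?pos d"
      then have "\<not> prod.swap c < prod.swap d" "\<not> prod.swap d < prod.swap c"
        using mono[of d c] mono[of c d] by auto
      then have "prod.swap c = prod.swap d" by (metis linorder_neqE)
      then show "c = d" by (metis swap_swap)
    qed
    have "S (i, t) \<in> A" using S it(1) by auto
    then show "card {b \<in> A. b < S (i, t)} < card {b \<in> A. b < T (i, t)}"
      by (rule card_less_mono[OF A _ it(2)])
    fix c assume c: "c \<in> D"
    show "card {b \<in> A. b < S c} < card A + 1" using A by (simp add: less_Suc_eq_le card_mono)
    assume less: "?pos (i, t) < ?pos c"
    obtain r j where rj: "c = (r, j)" by fastforce
    have "\<not> (t, i) < (j, r)" using mono[OF c, of "(i, t)"] less rj by auto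
    moreover have "(j, r) \<noteq> (t, i)" using less rj by auto
    ultimately have "j < t \<or> (j = t \<and> r < i)" by auto
    then show "card {b \<in> A. b < S c} = card {b \<in> A. b < T c}" using eq[of r j] c rj by simp
  qed
qed

abbreviation tab_weight :: "(nat \<times> nat) set \<Rightarrow> 'a::linorder set \<Rightarrow> (nat \<times> nat \<Rightarrow> 'a) \<Rightarrow> nat" where
  "tab_weight D A T \<equiv> mweight (card D + 1) (A \<times> snd ` D) (content D T)"

text \<open>The two rows of one flippable inversion are expanded into straight pairs. No new tableau
  has heavier column contents, and at equal contents the straight pair precedes the old one in the
  column reading order, which lowers \<open>cell_rank\<close>.\<close>

lemma straightening_step:
  fixes par :: "'a::linorder \<Rightarrow> bit"
  assumes D: "is_shape D" "row_convex D" and A: "finite A"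
    and T: "T \<in> D \<rightarrow>\<^sub>E A" "row_standard par D T" "\<not> straight par D T"
    and Q: "rat_closed Q"
    and IH: "\<And>S. S \<in> D \<rightarrow>\<^sub>E A \<Longrightarrow> row_standard par D S \<Longrightarrow> tab_weight D A S < tab_weight D A T \<or>
        (tab_weight D A S = tab_weight D A T \<and> cell_rank D A S < cell_rank D A T) \<Longrightarrow> Q (elem_cf par D S)"
  shows "Q (elem_cf par D T)"
proof -
  have fin: "finite D" using D by (simp add: is_shape_def)
  let ?s = "lp_sign par" and ?G = "card D + 1" and ?B = "A \<times> snd ` D"
  have B: "finite ?B" using A fin by simp
  obtain i j k where inv: "inversion par D T i j k" "flippable par D T i j k" using T by (auto simp: straight_def)
  then have ij: "i < j" "(i, k) \<in> D" "(j, k) \<in> D" by (auto simp: inversion_def)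
  define E where "E = {c \<in> D. fst c = i \<or> fst c = j}"
  have ED: "E \<subseteq> D" and finE: "finite E" using fin by (auto simp: E_def)
  have E: "is_shape E" using D(1) fin by (auto simp: is_shape_def E_def)
  let ?T = "restrict T E" and ?I = "straight_tableaux par E A"
  have I: "finite ?I" by (rule finite_straight_tableaux[OF finE A])
  have TE: "?T \<in> E \<rightarrow>\<^sub>E A" using T(1) ED by auto
  have Tstd: "row_standard par E ?T" using T(2) ED unfolding row_standard_def by auto
  have "inversion par E ?T i j k" using inv(1) by (simp add: inversion_def E_def)
  moreover have "flippable par E ?T i j k"
    using inv(2) ij by (auto simp: flippable_def E_def)
  ultimately have Tns: "\<not> straight par E ?T" by (auto simp: straight_def)
  have "rat_span par E A (elem_cf par E ?T)"
    unfolding E_def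
    by (rule two_row_rat_span[OF D ij(1)]) (use ij TE A in \<open>auto simp: row_columns_def E_def\<close>)
  then obtain m c where m: "m \<noteq> 0" "\<And>M. m * elem_cf par E ?T M = (\<Sum>S\<in>?I. c S * elem_cf par E S M)"
    unfolding rat_span_def by blast
  have BE: "A \<times> snd ` E \<subseteq> ?B" "?T ` E \<times> snd ` E \<subseteq> ?B" using ED TE by (auto simp: image_subset_iff)
  have GE: "card E < ?G" using card_mono[OF fin ED] by simp
  define wt where "wt S = mweight ?G ?B (content E S)" for S
  \<comment> \<open>The heaviest terms of the expansion survive in the sum, so their contents occur
    as monomials of the element of \<open>?T\<close>, whose leading monomial is
    \<open>content E ?T\<close>.\<close>
  have tri: "wt S < wt ?T \<or> content E S = content E ?T" if S: "S \<in> ?I" "c S \<noteq> 0" for S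
  proof -
    have "\<exists>S e. S \<in> ?I \<and> c S \<noteq> 0 \<and> unit_sign e \<and> (\<forall>S'\<in>?I. c S' \<noteq> 0 \<longrightarrow> wt S' \<le> wt S) \<and>
        (\<forall>S'\<in>?I. c S' \<noteq> 0 \<longrightarrow> wt S' = wt S \<longrightarrow> (\<Sum>R\<in>?I. c R * elem_cf par E R (content E S')) \<noteq> 0) \<and>
        (\<Sum>S'\<in>?I. c S' * elem_cf par E S' (content E S)) = e * c S"
      unfolding wt_def by (rule leading_coefficient[where c = c, OF E I order_refl B BE(1) GE S])
    then obtain S0 where S0: "S0 \<in> ?I" "c S0 \<noteq> 0"
      "\<And>S'. S' \<in> ?I \<Longrightarrow> c S' \<noteq> 0 \<Longrightarrow> wt S' \<le> wt S0"
      "\<And>S'. S' \<in> ?I \<Longrightarrow> c S' \<noteq> 0 \<Longrightarrow> wt S' = wt S0 \<Longrightarrow> (\<Sum>R\<in>?I. c R * elem_cf par E R (content E S')) \<noteq> 0"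
      by (elim exE conjE) (rule that; blast)
    have lead: "content E S' = content E ?T \<or> wt S' < wt ?T" if "S' \<in> ?I" "c S' \<noteq> 0" "wt S' = wt S0" for S'
    proof -
      have "elem_cf par E ?T (content E S') \<noteq> 0" using S0(4)[OF that] m(2)[of "content E S'"] by auto
      then show ?thesis
        unfolding wt_def by (rule elem_leading(1)[OF finE Tstd B BE(2) GE])
    qed
    show ?thesis
    proof (cases "wt S = wt S0")
      case False
      then have "wt S < wt S0" using S0(3)[OF S] by simp
      moreover have "wt S0 \<le> wt ?T" using lead[OF S0(1,2) refl] by (auto simp: wt_def)
      ultimately show ?thesis by simp
    qed (use lead[OF S] in auto)
  qed
  define up where "up S c = (if c \<in> E then S c else T c)" for S c
  have upT: "up ?T = T" by (auto simp: up_def)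
  have upE: "up S \<in> D \<rightarrow>\<^sub>E A" if "S \<in> E \<rightarrow>\<^sub>E A" for S
    using that T(1) ED by (auto simp: up_def PiE_iff extensional_def)
  have cont: "content D (up S) = content E S + content (D - E) T" for S
  proof -
    have "mset_set D = mset_set E + mset_set (D - E)"
      using fin ED finE by (subst mset_set_Union[symmetric]) (auto simp: Un_absorb1)
    moreover have "image_mset (\<lambda>c. (up S c, snd c)) (mset_set E) = content E S"
      "image_mset (\<lambda>c. (up S c, snd c)) (mset_set (D - E)) = content (D - E) T"
      unfolding content_def using finE fin by (auto intro!: image_mset_cong simp: up_def)
    ultimately show ?thesis by (simp add: content_def)
  qed
  have tw: "tab_weight D A (up S) = wt S + mweight ?G ?B (content (D - E) T)" for S
    unfolding cont wt_def by (simp add: mweight_def)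
  have better: "Q (elem_cf par D (up S))" if S: "S \<in> ?I" "c S \<noteq> 0" for S
  proof (rule IH)
    have SE: "S \<in> E \<rightarrow>\<^sub>E A" "straight par E S" using S by (auto simp: straight_tableaux_def)
    show 1: "up S \<in> D \<rightarrow>\<^sub>E A" by (rule upE[OF SE(1)])
    have "row_standard par E S" using SE(2) by (simp add: straight_def)
    then show "row_standard par D (up S)"
      using T(2) unfolding row_standard_def up_def E_def by simp
    show "tab_weight D A (up S) < tab_weight D A T \<or>
        (tab_weight D A (up S) = tab_weight D A T \<and> cell_rank D A (up S) < cell_rank D A T)"
    proof (cases "wt S < wt ?T")
      case True
      then show ?thesis using tw[of S] tw[of ?T] unfolding upT by simp
    next
      case False
      then have ct: "content E S = content E ?T" using tri[OF S] by blast
      have "S \<noteq> ?T" using Tns SE(2) by blast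
      then have "\<exists>c\<in>E. S c \<noteq> ?T c" using SE(1) TE PiE_ext by blast
      then obtain i' t where it: "(i', t) \<in> E" "S (i', t) < ?T (i', t)"
        "\<And>r j. (r, j) \<in> E \<Longrightarrow> j < t \<or> (j = t \<and> r < i') \<Longrightarrow> S (r, j) = ?T (r, j)"
        using straight_first_difference[OF E SE(2) Tstd ct] by blast
      have "cell_rank D A (up S) < cell_rank D A T"
      proof (rule cell_rank_less[OF fin A])
        show "up S ` D \<subseteq> A" using 1 by auto
        show "(i', t) \<in> D" "up S (i', t) < T (i', t)" using it(1,2) ED by (auto simp: up_def)
        show "up S (r, j') = T (r, j')" if "(r, j') \<in> D" "j' < t \<or> (j' = t \<and> r < i')" for r j'
          using it(3)[of r j'] that by (auto simp: up_def)
      qed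
      moreover have "wt S = wt ?T" unfolding wt_def ct ..
      ultimately show ?thesis using tw[of S] tw[of ?T] unfolding upT by simp
    qed
  qed
  let ?rest = "prod_list (map (row_elem par D T) (sorted_list_of_set (fst ` D - {i, j})))"
  \<comment> \<open>The rows \<open>i\<close> and \<open>j\<close> are brought to the front, with a
    sign that may depend on \<open>S\<close>; the remaining rows are common to all terms.\<close>
  have split: "\<exists>e. unit_sign e \<and> (\<forall>M. elem_cf par D (up S) M = e * cf ?s (elem par E S * ?rest) M)" for S
  proof -
    let ?f = "row_elem par D (up S)"
    have mset_sls: "mset (sorted_list_of_set X) = mset_set X" for X :: "nat set"
      by (metis mset_sorted_list_of_multiset sorted_list_of_mset_set)
    have colsE: "row_columns D r = row_columns E r" if "r \<in> {i, j}" for r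
      using that by (auto simp: row_columns_def E_def)
    have fE: "?f r = row_elem par E S r" if "r \<in> {i, j}" for r
      using that by (intro row_elem_cong colsE[OF that] fin) (auto simp: up_def E_def row_columns_def)
    have fT: "?f r = row_elem par D T r" if "r \<notin> {i, j}" for r
      using that by (intro row_elem_cong refl fin) (auto simp: up_def E_def)
    have "fst ` E = {i, j}" using ij by (force simp: E_def)
    then have rs: "sorted_list_of_set (fst ` E) = [i, j]" using ij(1) by simp
    have "i \<in> fst ` D" "j \<in> fst ` D" using ij by force+
    then have "mset_set (fst ` D) = mset_set ({i, j} \<union> (fst ` D - {i, j}))" by (simp add: insert_absorb Un_absorb1)
    also have "\<dots> = mset_set {i, j} + mset_set (fst ` D - {i, j})" using fin by (intro mset_set_Union) auto
    finally have "mset_set (fst ` D) = {#i, j#} + mset_set (fst ` D - {i, j})" using ij(1) by simp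
    then have "mset (map ?f (sorted_list_of_set (fst ` D))) =
        mset (map ?f ([i, j] @ sorted_list_of_set (fst ` D - {i, j})))"
      by (simp add: mset_sls)
    then have "\<exists>e. unit_sign e \<and> (\<forall>M. cf ?s (prod_list (map ?f (sorted_list_of_set (fst ` D)))) M =
        e * cf ?s (prod_list (map ?f ([i, j] @ sorted_list_of_set (fst ` D - {i, j})))) M)"
      by (rule cf_prod_list_perm) (use homogeneous_tab_poly in \<open>auto simp: row_elem_def\<close>)
    moreover have "map ?f (sorted_list_of_set (fst ` D - {i, j})) = map (row_elem par D T) (sorted_list_of_set (fst ` D - {i, j}))"
      using fin by (intro map_cong refl fT) auto
    moreover have "elem par E S = ?f i * ?f j" unfolding elem_def rs by (simp add: fE)
    ultimately show ?thesis unfolding elem_cf_def elem_def[of par D] by (simp add: mult.assoc)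
  qed
  obtain e where e: "unit_sign (e S)" "elem_cf par D (up S) M = e S * cf ?s (elem par E S * ?rest) M" for S M
    using split by metis
  have rel: "m * cf ?s (elem par E ?T * ?rest) M = (\<Sum>S\<in>?I. c S * cf ?s (elem par E S * ?rest) M)" for M
  proof -
    have "cf ?s (of_int m * elem par E ?T) = cf ?s (\<Sum>S\<in>?I. of_int (c S) * elem par E S)"
      using m(2) by (simp add: fun_eq_iff cf_of_int_mult cf_sum elem_cf_def)
    then have "cf ?s (of_int m * elem par E ?T * ?rest) = cf ?s ((\<Sum>S\<in>?I. of_int (c S) * elem par E S) * ?rest)"
      by (rule cf_mult_cong_left)
    then have "cf ?s (of_int m * (elem par E ?T * ?rest)) M = cf ?s (\<Sum>S\<in>?I. of_int (c S) * (elem par E S * ?rest)) M"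
      by (simp add: mult.assoc sum_distrib_right)
    then show ?thesis by (simp add: cf_of_int_mult cf_sum)
  qed
  let ?J = "{S \<in> ?I. c S \<noteq> 0}"
  have "m * elem_cf par D T M = (\<Sum>S\<in>?J. (e ?T * c S * e S) * elem_cf par D (up S) M)" for M
  proof -
    have "m * elem_cf par D T M = e ?T * (m * cf ?s (elem par E ?T * ?rest) M)"
      using e(2)[of ?T M] unfolding upT by simp
    also have "\<dots> = (\<Sum>S\<in>?I. e ?T * (c S * cf ?s (elem par E S * ?rest) M))"
      unfolding rel by (simp add: sum_distrib_left)
    also have "\<dots> = (\<Sum>S\<in>?I. (e ?T * c S * e S) * elem_cf par D (up S) M)"
    proof (rule sum.cong[OF refl])
      fix S
      show "e ?T * (c S * cf ?s (elem par E S * ?rest) M) = (e ?T * c S * e S) * elem_cf par D (up S) M"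
        unfolding e(2)[of S M] using e(1)[of S] by (auto simp: unit_sign_def)
    qed
    also have "\<dots> = (\<Sum>S\<in>?J. (e ?T * c S * e S) * elem_cf par D (up S) M)"
      using I by (intro sum.mono_neutral_right) auto
    finally show ?thesis .
  qed
  moreover have "Q (\<lambda>M. \<Sum>S\<in>?J. (e ?T * c S * e S) * elem_cf par D (up S) M)"
    using better by (intro rat_closed_sum[OF Q]) auto
  ultimately have "Q (\<lambda>M. m * elem_cf par D T M)" by simp
  then show ?thesis by (rule rat_closed_divide[OF Q m(1)])
qed

lemma sort_rows:
  fixes par :: "'a::linorder \<Rightarrow> bit"
  assumes D: "finite D" and T: "T \<in> D \<rightarrow>\<^sub>E A"
  obtains "elem_cf par D T = (\<lambda>_. 0)"
  | T' e where "T' \<in> D \<rightarrow>\<^sub>E A" "row_standard par D T'" "unit_sign e"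
      "\<And>M. elem_cf par D T M = e * elem_cf par D T' M"
proof (cases "\<exists>r\<in>fst ` D. \<exists>i<length (row_word D T r). \<exists>j<length (row_word D T r). i \<noteq> j \<and>
    row_word D T r ! i = row_word D T r ! j \<and> par (row_word D T r ! i) = 1")
  case True
  then obtain r i j where r: "r \<in> fst ` D" "i < length (row_word D T r)" "j < length (row_word D T r)" "i \<noteq> j"
    "row_word D T r ! i = row_word D T r ! j" "par (row_word D T r ! i) = 1" by blast
  have "cf (lp_sign par) (row_elem par D T r) M = 0" for M
    unfolding row_elem_def by (rule tab_poly_repeated_negative[of i _ j]) (use r in auto)
  then have "elem_cf par D T = (\<lambda>_. 0)"
    unfolding elem_cf_def elem_def using r(1) D by (intro ext cf_prod_list_zero[of r]) auto
  then show thesis by (rule that(1))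
next
  case False
  define idx where "idx r j = (LEAST k. k < length (row_places D r) \<and> row_places D r ! k = j)" for r j
  have idx: "idx r (row_places D r ! k) = k" if "k < length (row_places D r)" for r k
    unfolding idx_def
  proof (rule Least_equality)
    have d: "distinct (row_places D r)" by (simp add: row_places_def)
    show "k \<le> l" if "l < length (row_places D r) \<and> row_places D r ! l = row_places D r ! k" for l
      using that d \<open>k < length (row_places D r)\<close> by (metis nth_eq_iff_index_eq order_refl)
  qed (use that in simp)
  define T' where "T' c = (if c \<in> D then sort (row_word D T (fst c)) ! idx (fst c) (snd c) else undefined)" for c
  have cell: "\<exists>k<length (row_places D (fst c)). row_places D (fst c) ! k = snd c" if "c \<in> D" for c
  proof -
    have "snd c \<in> set (row_places D (fst c))" using that by (simp add: row_places_simps[OF D] row_columns_def)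
    then show ?thesis by (simp add: in_set_conv_nth)
  qed
  have inD: "(r, row_places D r ! k) \<in> D" if "k < length (row_places D r)" for r k
    using nth_mem[OF that] by (simp add: row_places_simps[OF D] row_columns_def)
  have w: "row_word D T' r = sort (row_word D T r)" for r
    by (rule nth_equalityI) (use inD idx in \<open>auto simp: row_word_def T'_def\<close>)
  have wA: "set (row_word D T r) \<subseteq> A" for r
    using T by (auto simp: row_word_def row_places_simps[OF D] row_columns_def)
  have "T' \<in> D \<rightarrow>\<^sub>E A"
  proof (rule PiE_I)
    fix c assume c: "c \<in> D"
    then obtain k where k: "k < length (row_places D (fst c))" "row_places D (fst c) ! k = snd c" using cell by blast
    then have "T' c = sort (row_word D T (fst c)) ! k" using c idx[OF k(1)] by (simp add: T'_def)
    also have "\<dots> \<in> set (row_word D T (fst c))" using k(1) nth_mem[of k "sort (row_word D T (fst c))"] by simp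
    finally show "T' c \<in> A" using wA by blast
  qed (simp add: T'_def)
  moreover have "row_standard par D T'"
    unfolding row_standard_def
  proof (intro allI impI, elim conjE)
    fix r j l assume c: "(r, j) \<in> D" "(r, l) \<in> D" "j < l"
    obtain a where a: "a < length (row_places D r)" "row_places D r ! a = j" using cell[OF c(1)] by auto
    obtain b where b: "b < length (row_places D r)" "row_places D r ! b = l" using cell[OF c(2)] by auto
    have ab: "a < b"
    proof (rule ccontr)
      assume "\<not> a < b"
      then have "b < a \<or> a = b" by auto
      then show False
        using row_places_simps(2)[OF D, of r] a b c(3) unfolding sorted_wrt_iff_nth_less by fastforce
    qed
    have "row_std par (sort (row_word D T r))"
    proof (rule sorted_row_std)
      fix x y assume xy: "x < length (sort (row_word D T r))" "y < length (sort (row_word D T r))" "x \<noteq> y"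
        "sort (row_word D T r) ! x = sort (row_word D T r) ! y"
      have "r \<in> fst ` D" using c(1) by force
      obtain \<pi> where p: "\<pi> permutes {..<length (row_word D T r)}" "permute_list \<pi> (row_word D T r) = sort (row_word D T r)"
        using mset_eq_permutation[of "sort (row_word D T r)" "row_word D T r"] by auto
      have nth: "sort (row_word D T r) ! z = row_word D T r ! \<pi> z" "\<pi> z < length (row_word D T r)"
        if "z < length (row_word D T r)" for z
        using that p permute_list_nth[OF p(1) that] permutes_less[OF p(1), of z] by auto
      have "\<pi> x \<noteq> \<pi> y" using permutes_inj[OF p(1)] xy(3) by (auto dest: injD)
      moreover have "par (row_word D T r ! a) \<noteq> 1" if "a < length (row_word D T r)" "b < length (row_word D T r)"
        "a \<noteq> b" "row_word D T r ! a = row_word D T r ! b" for a b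
        using False \<open>r \<in> fst ` D\<close> that by blast
      ultimately have "par (row_word D T r ! \<pi> x) \<noteq> 1"
        using nth[of x] nth[of y] xy by simp
      then show "par (sort (row_word D T r) ! x) = 0" using nth[of x] xy by (cases "par (row_word D T r ! \<pi> x)") auto
    qed simp
    then have "pos_less par (row_word D T' r ! a) (row_word D T' r ! b)"
      using ab b(1) unfolding w row_std_def sorted_wrt_iff_nth_less by simp
    then show "pos_less par (T' (r, j)) (T' (r, l))" using a b by (simp add: row_word_def)
  qed
  moreover have "\<exists>e. unit_sign e \<and> (\<forall>M. elem_cf par D T M = e * elem_cf par D T' M)"
    unfolding elem_cf_def elem_def
  proof (rule cf_prod_list_scaled)
    fix r
    obtain e where "unit_sign e" "\<And>M. cf (lp_sign par) (tab_poly par (row_word D T r) (row_places D r)) M =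
        e * cf (lp_sign par) (tab_poly par (row_word D T' r) (row_places D r)) M"
      using tab_poly_permute[of "row_word D T r" "row_word D T' r" "row_places D r"] unfolding w by auto
    then show "\<exists>e. unit_sign e \<and> (\<forall>M. cf (lp_sign par) (row_elem par D T r) M =
        e * cf (lp_sign par) (row_elem par D T' r) M)"
      unfolding row_elem_def by blast
  qed
  ultimately show thesis using that(2) by blast
qed

theorem straight_spanning:
  fixes par :: "'a::linorder \<Rightarrow> bit"
  assumes D: "is_shape D" "row_convex D" and A: "finite A" and T: "T \<in> D \<rightarrow>\<^sub>E A"
  shows "rat_span par D A (elem_cf par D T)"
proof -
  have fin: "finite D" using D by (simp add: is_shape_def)
  have std: "rat_span par D A (elem_cf par D T)" if "T \<in> D \<rightarrow>\<^sub>E A" "row_standard par D T" for T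
    using that
  proof (induction T rule: wf_induct_rule[OF wf_measures[of "[tab_weight D A, cell_rank D A]"]])
    case (1 T)
    show ?case
    proof (cases "straight par D T")
      case False
      show ?thesis
        by (rule straightening_step[OF D A 1(2,3) False rat_closed_rat_span])
          (use 1(1) in \<open>auto simp: in_measures\<close>)
    next
      case True
      then have S: "T \<in> straight_tableaux par D A" using 1 by (simp add: straight_tableaux_def)
      have "(\<Sum>R\<in>straight_tableaux par D A. (if R = T then 1 else 0) * elem_cf par D R M) = 1 * elem_cf par D T M" for M
      proof -
        have "(\<Sum>R\<in>straight_tableaux par D A. (if R = T then 1 else 0) * elem_cf par D R M) =
            (\<Sum>R\<in>straight_tableaux par D A. if R = T then elem_cf par D T M else 0)" by (rule sum.cong) auto
        then show ?thesis using S finite_straight_tableaux[OF fin A] by simp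
      qed
      then show ?thesis
        unfolding rat_span_def by (intro exI[of _ 1] exI[of _ "\<lambda>R. if R = T then 1 else 0"]) simp
    qed
  qed
  from fin T show ?thesis
  proof (cases rule: sort_rows[where par = par])
    case 1
    then show ?thesis using rat_closed_zero[OF rat_closed_rat_span, of par D A] by simp
  next
    case (2 T' e)
    then have "elem_cf par D T = (\<lambda>M. e * elem_cf par D T' M)" by auto
    then show ?thesis using rat_closed_scale[OF rat_closed_rat_span std[OF 2(1,2)]] by simp
  qed
qed

subsection \<open>Passing to the flagged letterplace ring\<close>

lemma free_ring_add_pow:
  assumes q: "q \<in> carrier (free_ring X)"
  shows "[k] \<cdot>\<^bsub>free_ring X\<^esub> q = of_int k * q" and "of_int k * q \<in> carrier (free_ring X)"
proof -
  interpret ring "free_ring X" by (rule free_ring_is_ring)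
  have nat: "[n] \<cdot>\<^bsub>free_ring X\<^esub> q = of_nat n * q" for n :: nat
    by (induction n) (simp_all add: add_pow_def nat_pow_def algebra_simps free_ring_def)
  have closed: "[n] \<cdot>\<^bsub>free_ring X\<^esub> q \<in> carrier (free_ring X)" for n :: nat
    using q by simp
  show 1: "[k] \<cdot>\<^bsub>free_ring X\<^esub> q = of_int k * q"
  proof (cases "k < 0")
    case True
    have "[k] \<cdot>\<^bsub>free_ring X\<^esub> q = \<ominus>\<^bsub>free_ring X\<^esub> ([nat (- k)] \<cdot>\<^bsub>free_ring X\<^esub> q)"
      using True by (simp only: add_pow_def int_pow_def2 a_inv_def if_True)
    also have "\<dots> = - (of_nat (nat (- k)) * q)"
      using free_ring_uminus[OF closed[of "nat (- k)"]] by (simp add: nat)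
    also have "\<dots> = - (of_int (- k) * q)" using True by (simp only: of_nat_nat)
    finally show ?thesis by simp
  next
    case False
    then have "[k] \<cdot>\<^bsub>free_ring X\<^esub> q = [nat k] \<cdot>\<^bsub>free_ring X\<^esub> q" by (simp only: add_pow_def int_pow_def2 if_False)
    also have "\<dots> = of_int k * q" using False by (simp only: nat of_nat_nat)
    finally show ?thesis .
  qed
  show "of_int k * q \<in> carrier (free_ring X)" unfolding 1[symmetric] using q by simp
qed

lemma free_ring_sum_closed:
  "(\<And>i. i \<in> F \<Longrightarrow> q i \<in> carrier (free_ring X)) \<Longrightarrow> (\<Sum>i\<in>F. q i) \<in> carrier (free_ring X)"
proof (induction F rule: infinite_finite_induct)
  case (insert i F)
  interpret ring "free_ring X" by (rule free_ring_is_ring)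
  show ?case using insert a_closed[of "q i" "\<Sum>i\<in>F. q i"] by simp
qed (use ring.ring_simprules(2)[OF free_ring_is_ring] in simp_all)

text \<open>Combinations in a quotient are pulled back to finite sums in the free ring, where
  coefficients are available.\<close>

lemma int_combination_hom:
  assumes h: "ring_hom_ring (free_ring X) S h" and fin: "finite {i \<in> I. c i \<noteq> 0}"
    and q: "\<And>i. i \<in> I \<Longrightarrow> q i \<in> carrier (free_ring X)"
  shows "int_combination S I (\<lambda>i. h (q i)) c = h (\<Sum>i\<in>{i \<in> I. c i \<noteq> 0}. of_int (c i) * q i)"
proof -
  interpret ring_hom_ring "free_ring X" S h by (rule h)
  have pow: "[k] \<cdot>\<^bsub>S\<^esub> h x = h (of_int k * x)" if "x \<in> carrier (free_ring X)" for k :: int and x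
    using group_hom.hom_int_pow[OF a_group_hom, of x k] that free_ring_add_pow(1)[OF that, of k]
    by (simp add: add_pow_def)
  have "(\<Oplus>\<^bsub>S\<^esub>i\<in>F. [c i] \<cdot>\<^bsub>S\<^esub> h (q i)) = h (\<Sum>i\<in>F. of_int (c i) * q i)" if "finite F" "F \<subseteq> I" for F
    using that
  proof (induction F)
    case empty
    then show ?case using hom_zero by simp
  next
    case (insert i F)
    have cl: "of_int (c j) * q j \<in> carrier (free_ring X)" if "j \<in> I" for j
      by (rule free_ring_add_pow(2)[OF q[OF that]])
    have sum: "(\<Sum>j\<in>F. of_int (c j) * q j) \<in> carrier (free_ring X)"
      using insert cl by (intro free_ring_sum_closed) auto
    have "(\<Oplus>\<^bsub>S\<^esub>j\<in>insert i F. [c j] \<cdot>\<^bsub>S\<^esub> h (q j)) = [c i] \<cdot>\<^bsub>S\<^esub> h (q i) \<oplus>\<^bsub>S\<^esub> (\<Oplus>\<^bsub>S\<^esub>j\<in>F. [c j] \<cdot>\<^bsub>S\<^esub> h (q j))"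
      using insert q by (intro S.finsum_insert) auto
    also have "\<dots> = h (of_int (c i) * q i) \<oplus>\<^bsub>S\<^esub> h (\<Sum>j\<in>F. of_int (c j) * q j)"
      using insert q pow by auto
    also have "\<dots> = h (of_int (c i) * q i + (\<Sum>j\<in>F. of_int (c j) * q j))"
      using hom_add[OF cl sum, of i] insert by simp
    finally show ?case using insert by simp
  qed
  then show ?thesis unfolding int_combination_def using fin by auto
qed

context
  fixes par :: "'a::linorder \<Rightarrow> bit" and P :: "nat set"
begin

abbreviation (input) "lp_ring \<equiv> free_ring (UNIV \<times> P :: ('a \<times> nat) set)"

lemma lp_class_hom: "ring_hom_ring lp_ring (letterplace par P) (lp_class par P)"
  using ideal.rcos_ring_hom_ring[OF super_ideal_ideal]
  by (simp add: letterplace_def free_super_ring_def lp_class_def super_class_def[abs_def])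

lemma flag_gens_carrier:
  "{lp_class par P (fvar (l, p)) | l p. p \<in> P \<and> l > f p} \<subseteq> carrier (letterplace par P)"
proof -
  interpret ring_hom_ring lp_ring "letterplace par P" "lp_class par P" by (rule lp_class_hom)
  show ?thesis by auto
qed

lemma flag_ideal_ideal: "ideal (flag_ideal par P f) (letterplace par P)"
proof -
  interpret ring_hom_ring lp_ring "letterplace par P" "lp_class par P" by (rule lp_class_hom)
  show ?thesis unfolding flag_ideal_def by (rule S.genideal_ideal[OF flag_gens_carrier])
qed

lemma flag_class_hom: "ring_hom_ring lp_ring (flag_ring par P f) (\<lambda>q. flag_map par P f (lp_class par P q))"
proof -
  interpret h: ring_hom_ring lp_ring "letterplace par P" "lp_class par P" by (rule lp_class_hom)
  interpret g: ring_hom_ring "letterplace par P" "flag_ring par P f" "flag_map par P f"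
    using ideal.rcos_ring_hom_ring[OF flag_ideal_ideal]
    by (simp add: flag_ring_def flag_map_def[abs_def])
  show ?thesis
    using ring_hom_trans[OF h.homh g.homh] h.R.ring_axioms g.S.ring_axioms
    by (intro ring_hom_ringI2) (simp_all add: comp_def)
qed

lemma lp_class_eqI:
  assumes "q \<in> carrier lp_ring" "r \<in> carrier lp_ring" "cf (lp_sign par) q = cf (lp_sign par) r"
  shows "lp_class par P q = lp_class par P r"
proof -
  interpret I: ideal "super_ideal (UNIV \<times> P) (lp_sign par)" lp_ring by (rule super_ideal_ideal)
  have neg: "- r \<in> carrier lp_ring" using assms(2) by (simp add: carrier_free_ring)
  have "q + - r \<in> carrier lp_ring" using I.a_closed[OF assms(1) neg] by simp
  then have m: "q - r \<in> super_ideal (UNIV \<times> P) (lp_sign par)"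
    using assms(3) by (intro super_idealI) (simp_all add: cf_diff)
  have "q \<in> super_ideal (UNIV \<times> P) (lp_sign par) +>\<^bsub>lp_ring\<^esub> r"
    unfolding a_r_coset_def' by (rule UN_I[OF m]) simp
  then show ?thesis
    unfolding lp_class_def super_class_def using I.a_repr_independence[OF _ assms(2) I.a_subgroup] by simp
qed

text \<open>The polynomials without coefficients at monomials inside the flags form an ideal
  containing the supercommutativity relations. Its image contains the generators of the flag ideal,
  hence the whole flag ideal.\<close>

lemma flag_ideal_cf:
  assumes "q \<in> carrier lp_ring" "lp_class par P q \<in> flag_ideal par P f" and M: "\<And>x. x \<in># M \<Longrightarrow> fst x \<le> f (snd x)"
  shows "cf (lp_sign par) q M = 0"
proof -
  let ?F = "\<lambda>M. \<forall>x. x \<in># M \<longrightarrow> fst x \<le> f (snd x)"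
  let ?I = "super_ideal (UNIV \<times> P) (lp_sign par)" and ?K = "cf_null (UNIV \<times> P) (lp_sign par) ?F"
  have sub: "?F N" if "?F M" "N \<subseteq># M" for M N using that by (auto dest: mset_subset_eqD)
  have K: "ideal ?K lp_ring" using sub by (rule ideal_cf_null)
  have IK: "?I \<subseteq> ?K" using sub by (rule super_ideal_cf_null)
  interpret I: ideal ?I lp_ring by (rule super_ideal_ideal)
  interpret h: ring_hom_ring lp_ring "letterplace par P" "lp_class par P" by (rule lp_class_hom)
  have img: "ideal (lp_class par P ` ?K) (letterplace par P)"
    using ring.ring_ideal_imp_quot_ideal[OF free_ring_is_ring super_ideal_ideal K]
    by (simp add: letterplace_def free_super_ring_def lp_class_def[abs_def] super_class_def[abs_def])
  have "flag_ideal par P f \<subseteq> lp_class par P ` ?K"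
    unfolding flag_ideal_def
  proof (rule h.S.genideal_minimal[OF img], clarify)
    fix l p assume "p \<in> P" "l > f p"
    then have "fvar (l, p) \<in> ?K"
      by (auto simp: cf_null_def fvar_def cf_single cw_def carrier_free_ring)
    then show "lp_class par P (fvar (l, p)) \<in> lp_class par P ` ?K" by (rule imageI)
  qed
  then obtain k where k: "k \<in> ?K" "lp_class par P q = lp_class par P k" using assms(2) by blast
  then have "q \<in> ?I +>\<^bsub>lp_ring\<^esub> k"
    using I.a_rcos_self[OF assms(1)] by (simp add: lp_class_def super_class_def)
  then obtain i where "i \<in> ?I" "q = i + k" unfolding a_r_coset_def' by auto
  then have "q \<in> ?K"
    using additive_subgroup.a_closed[OF ideal.axioms(1)[OF K], of i k] IK k(1) by auto
  then show ?thesis using M by (auto simp: cf_null_def)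
qed

lemma flag_map_eq_zero:
  assumes "q \<in> carrier lp_ring"
  shows "flag_map par P f (lp_class par P q) = \<zero>\<^bsub>flag_ring par P f\<^esub> \<longleftrightarrow> lp_class par P q \<in> flag_ideal par P f"
proof -
  interpret h: ring_hom_ring lp_ring "letterplace par P" "lp_class par P" by (rule lp_class_hom)
  interpret J: ideal "flag_ideal par P f" "letterplace par P" by (rule flag_ideal_ideal)
  have z: "\<zero>\<^bsub>flag_ring par P f\<^esub> = flag_ideal par P f" by (simp add: flag_ring_def FactRing_def)
  have "lp_class par P q \<in> flag_map par P f (lp_class par P q)"
    unfolding flag_map_def using assms by (intro J.a_rcos_self) simp
  then show ?thesis unfolding z flag_map_def using J.a_rcos_const by auto
qed

lemma row_elem_carrier:
  assumes "finite D" "snd ` D \<subseteq> P"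
  shows "row_elem par D T r \<in> carrier lp_ring"
  unfolding carrier_free_ring
proof
  fix u assume "u \<in> Poly_Mapping.keys (row_elem par D T r)"
  then obtain \<sigma> where \<sigma>: "letters u = map (\<lambda>i. (row_word D T r ! \<sigma> i, row_places D r ! i)) [0..<length (row_word D T r)]"
    unfolding row_elem_def by (rule keys_tab_poly)
  have "set (row_places D r) \<subseteq> P"
    using assms by (auto simp: row_places_simps row_columns_def)
  then show "set (letters u) \<subseteq> UNIV \<times> P" unfolding \<sigma> by auto
qed

lemma prod_list_carrier:
  "(\<And>r. r \<in> set rs \<Longrightarrow> g r \<in> carrier lp_ring) \<Longrightarrow> prod_list (map g rs) \<in> carrier lp_ring"
proof (induction rs)
  case Nil
  then show ?case by (auto simp: carrier_free_ring zero_fword_def)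
next
  case (Cons r rs)
  interpret ring lp_ring by (rule free_ring_is_ring)
  show ?case using Cons m_closed[of "g r" "prod_list (map g rs)"] by simp
qed

lemma elem_carrier:
  assumes "finite D" "snd ` D \<subseteq> P"
  shows "elem par D T \<in> carrier lp_ring"
  unfolding elem_def using row_elem_carrier[OF assms] by (rule prod_list_carrier)

lemma tableau_element_elem:
  assumes D: "finite D" "snd ` D \<subseteq> P"
  shows "tableau_element par P D T = lp_class par P (elem par D T)"
proof -
  interpret h: ring_hom_ring lp_ring "letterplace par P" "lp_class par P" by (rule lp_class_hom)
  have r: "row_tab par P D T r = lp_class par P (row_elem par D T r)" for r
    by (simp add: row_tab_def tab_def row_elem_def row_word_def row_places_def Let_def)
  have "foldr (\<lambda>r x. row_tab par P D T r \<otimes>\<^bsub>letterplace par P\<^esub> x) rs \<one>\<^bsub>letterplace par P\<^esub> =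
      lp_class par P (prod_list (map (row_elem par D T) rs))" for rs
  proof (induction rs)
    case Nil
    then show ?case using h.hom_one by simp
  next
    case (Cons r' rs)
    then show ?case
      using h.hom_mult[OF row_elem_carrier[OF D, of T r'] prod_list_carrier[of rs "row_elem par D T"]] row_elem_carrier[OF D]
      by (simp add: r)
  qed
  then show ?thesis unfolding tableau_element_def elem_def by simp
qed

text \<open>
  If an entry exceeds its flag, then so do all entries to its right with respect to all columns to its
  left, and there is no room for them in the remaining columns.
\<close>

lemma unflagged_row_vanishes:
  assumes D: "finite D" "snd ` D \<subseteq> P" and f: "mono_on P f"
    and T: "row_standard par D T" and c: "(r, j) \<in> D" "f j < T (r, j)"
  shows "lp_class par P (elem par D T) \<in> flag_ideal par P f"
proof -
  interpret h: ring_hom_ring lp_ring "letterplace par P" "lp_class par P" by (rule lp_class_hom)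
  let ?J = "flag_ideal par P f"
  define V where "V = {q \<in> carrier lp_ring. lp_class par P q \<in> ?J}"
  have "ideal V lp_ring"
    unfolding V_def using h.ideal_vimage[OF flag_ideal_ideal] .
  then interpret V: ideal V lp_ring .
  have Vl: "x * q \<in> V" and Vr: "q * x \<in> V" if "q \<in> V" "x \<in> carrier lp_ring" for q x
    using V.I_l_closed[OF that] V.I_r_closed[OF that] by simp_all
  have Vsum: "(\<Sum>i\<in>F. q i) \<in> V" if "\<And>i. i \<in> F \<Longrightarrow> q i \<in> V" for F :: "('a \<times> nat) fword set" and q
    using that
  proof (induction F rule: infinite_finite_induct)
    case (insert i F)
    then show ?case using additive_subgroup.a_closed[OF V.is_additive_subgroup, of "q i" "\<Sum>i\<in>F. q i"] by simp
  qed (use additive_subgroup.zero_closed[OF V.is_additive_subgroup] in simp_all)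
  have gen: "fvar (l, p) \<in> V" if "p \<in> P" "f p < l" for l p
  proof -
    have "lp_class par P (fvar (l, p)) \<in> ?J"
      unfolding flag_ideal_def using that h.S.genideal_self[OF flag_gens_carrier, of f] by blast
    moreover have "fvar (l, p) \<in> carrier lp_ring" using that(1) by simp
    ultimately show ?thesis unfolding V_def by blast
  qed
  let ?w = "row_word D T r" and ?p = "row_places D r"
  have pP: "set ?p \<subseteq> P" using D by (auto simp: row_places_simps row_columns_def)
  have "j \<in> set ?p" using c D by (simp add: row_places_simps row_columns_def)
  then obtain a where a: "a < length ?p" "?p ! a = j" by (auto simp: in_set_conv_nth)
  have wa: "?w ! a = T (r, j)" using a by (simp add: row_word_def)
  have le: "?w ! x \<le> ?w ! y" if "x \<le> y" "y < length ?w" for x y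
  proof (cases "x = y")
    case False
    then have "pos_less par (?w ! x) (?w ! y)"
      using row_std_row_word[OF D(1) T, of r] that unfolding row_std_def sorted_wrt_iff_nth_less by simp
    then show ?thesis by (auto simp: pos_less_def)
  qed simp
  have row: "row_elem par D T r \<in> V"
  proof -
    have "word (letters u) (Poly_Mapping.lookup (row_elem par D T r) u) \<in> V"
      if u: "u \<in> Poly_Mapping.keys (row_elem par D T r)" for u
    proof -
      obtain \<sigma> where \<sigma>: "\<sigma> permutes {..<length ?w}" "letters u = map (\<lambda>i. (?w ! \<sigma> i, ?p ! i)) [0..<length ?w]"
        using u unfolding row_elem_def by (rule keys_tab_poly)
      \<comment> \<open>Pigeonhole: the \<open>a + 1\<close> positions up to \<open>a\<close> cannot
        all draw their letters from the \<open>a\<close> positions before \<open>a\<close>.\<close>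
      have "\<exists>b\<le>a. a \<le> \<sigma> b"
      proof (rule ccontr)
        assume "\<not> (\<exists>b\<le>a. a \<le> \<sigma> b)"
        then have "\<sigma> ` {..a} \<subseteq> {..<a}" by auto
        then have "card (\<sigma> ` {..a}) \<le> card {..<a}" by (intro card_mono) auto
        moreover have "card (\<sigma> ` {..a}) = card {..a}"
          using permutes_inj[OF \<sigma>(1)] by (intro card_image) (auto intro: inj_on_subset)
        ultimately show False by simp
      qed
      then obtain b where b: "b \<le> a" "a \<le> \<sigma> b" by blast
      then have bl: "b < length ?w" "\<sigma> b < length ?w" using a permutes_less[OF \<sigma>(1), of b] by auto
      have "f (?p ! b) \<le> f (?p ! a)"
      proof (cases "b = a")
        case False
        then have "?p ! b < ?p ! a"
          using row_places_simps(2)[OF D(1), of r] b(1) a(1) unfolding sorted_wrt_iff_nth_less by simp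
        then show ?thesis using f pP a(1) bl by (intro mono_onD[of P f]) (auto intro: nth_mem)
      qed simp
      also have "\<dots> < ?w ! a" using c(2) a(2) wa by simp
      also have "\<dots> \<le> ?w ! \<sigma> b" using le[OF b(2) bl(2)] .
      finally have big: "f (?p ! b) < ?w ! \<sigma> b" .
      have "letters u ! b = (?w ! \<sigma> b, ?p ! b)" using bl by (simp add: \<sigma>(2))
      then obtain x y where xy: "letters u = x @ (?w ! \<sigma> b, ?p ! b) # y"
        using id_take_nth_drop[of b "letters u"] bl \<sigma>(2) by auto
      have "set (letters u) \<subseteq> UNIV \<times> P" using row_elem_carrier[OF D, of T r] u by (simp add: carrier_free_ring)
      then have "set x \<subseteq> UNIV \<times> P" "set y \<subseteq> UNIV \<times> P" unfolding xy by auto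
      then have cx: "word x k \<in> carrier lp_ring" and cy: "word y 1 \<in> carrier lp_ring" for k by simp_all
      have "?p ! b \<in> P" using pP bl by (auto intro: nth_mem)
      then have "word x (Poly_Mapping.lookup (row_elem par D T r) u) * fvar (?w ! \<sigma> b, ?p ! b) * word y 1 \<in> V"
        by (intro Vr Vl gen big cx cy)
      moreover have "word x k * fvar g * word y 1 = word (x @ g # y) k" for g k
        unfolding fvar_def word_mult by simp
      ultimately show ?thesis unfolding xy by metis
    qed
    then have "(\<Sum>u\<in>Poly_Mapping.keys (row_elem par D T r). word (letters u) (Poly_Mapping.lookup (row_elem par D T r) u)) \<in> V"
      by (intro Vsum)
    then show ?thesis using ncpoly_expand[of "row_elem par D T r"] by simp
  qed
  have "r \<in> set (sorted_list_of_set (fst ` D))" using c(1) D(1) by force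
  then obtain xs ys where "sorted_list_of_set (fst ` D) = xs @ r # ys" by (meson split_list)
  then have elem: "elem par D T = prod_list (map (row_elem par D T) xs) * (row_elem par D T r * prod_list (map (row_elem par D T) ys))"
    unfolding elem_def by simp
  have others: "prod_list (map (row_elem par D T) rs) \<in> carrier lp_ring" for rs
    using row_elem_carrier[OF D] by (rule prod_list_carrier)
  have "elem par D T \<in> V"
    unfolding elem by (rule Vl[OF Vr[OF row others] others])
  then show ?thesis unfolding V_def by blast
qed

end

theorem theorem6p2:
  fixes par :: "'a::linorder \<Rightarrow> bit"
    and D :: "(nat \<times> nat) set"
    and P :: "nat set"
    and f :: "nat \<Rightarrow> 'a"
  assumes "is_shape D"
    and "row_convex D"
    and "finite P"
    and "0 \<notin> P"
    and "snd ` D \<subseteq> P"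
    and "mono_on P f"
  shows "int_basis (flag_ring par P f)
           {T \<in> tableaux D. flagged f D T \<and> straight par D T}
           (\<lambda>T. flag_map par P f (tableau_element par P D T))
           (flagged_super_schur par P f D)"
proof -
  let ?X = "UNIV \<times> P :: ('a \<times> nat) set" and ?s = "lp_sign par" and ?E = "elem par D"
  let ?\<pi> = "\<lambda>q. flag_map par P f (lp_class par P q)"
  let ?I = "{T \<in> tableaux D. flagged f D T \<and> straight par D T}"
  have fin: "finite D" using assms(1) by (simp add: is_shape_def)
  have te: "tableau_element par P D T = lp_class par P (?E T)" for T
    by (rule tableau_element_elem[OF fin assms(5)])
  have E: "?E T \<in> carrier (free_ring ?X)" for T by (rule elem_carrier[OF fin assms(5)])
  have cE: "of_int k * ?E T \<in> carrier (free_ring ?X)" for k T by (rule free_ring_add_pow(2)[OF E])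
  have csum: "(\<Sum>T\<in>F. of_int (c T) * ?E T) \<in> carrier (free_ring ?X)" for F and c :: "_ \<Rightarrow> int"
    by (rule free_ring_sum_closed[OF cE])
  interpret h: ring_hom_ring "free_ring ?X" "letterplace par P" "lp_class par P" by (rule lp_class_hom)
  interpret g: ring_hom_ring "free_ring ?X" "flag_ring par P f" ?\<pi> by (rule flag_class_hom)
  have comb: "int_combination (flag_ring par P f) J (\<lambda>T. flag_map par P f (tableau_element par P D T)) c =
      ?\<pi> (\<Sum>T\<in>{T \<in> J. c T \<noteq> 0}. of_int (c T) * ?E T)" if "finite {T \<in> J. c T \<noteq> 0}" for J c
    unfolding te by (rule int_combination_hom[OF flag_class_hom that E])
  have comb': "int_combination (letterplace par P) J (tableau_element par P D) c =
      lp_class par P (\<Sum>T\<in>{T \<in> J. c T \<noteq> 0}. of_int (c T) * ?E T)" if "finite {T \<in> J. c T \<noteq> 0}" for J c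
    using int_combination_hom[OF lp_class_hom that E] by (simp add: te[abs_def])
  \<comment> \<open>The alphabet may be infinite; each finite combination lives over a finite set of
    letters, where weights and spans are finite.\<close>
  have letters: "\<exists>A. finite A \<and> F \<subseteq> D \<rightarrow>\<^sub>E A" if "finite F" "F \<subseteq> tableaux D" for F :: "(nat \<times> nat \<Rightarrow> 'a) set"
    using that fin by (intro exI[of _ "\<Union>T\<in>F. T ` D"]) (auto simp: tableaux_def PiE_iff extensional_def)
  have cfsum: "cf ?s (\<Sum>T\<in>F. of_int (c T) * ?E T) M = (\<Sum>T\<in>F. c T * elem_cf par D T M)" for F c M
    by (simp add: cf_sum cf_of_int_mult elem_cf_def)
  have "int_independent (flag_ring par P f) ?I (\<lambda>T. flag_map par P f (tableau_element par P D T))"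
    unfolding int_independent_def
  proof (intro allI impI, elim conjE, rule ccontr)
    fix c assume c: "finite {T \<in> ?I. c T \<noteq> 0}"
      "int_combination (flag_ring par P f) ?I (\<lambda>T. flag_map par P f (tableau_element par P D T)) c = \<zero>\<^bsub>flag_ring par P f\<^esub>"
      and ne: "\<not> (\<forall>T\<in>?I. c T = 0)"
    let ?F = "{T \<in> ?I. c T \<noteq> 0}"
    have mem: "lp_class par P (\<Sum>T\<in>?F. of_int (c T) * ?E T) \<in> flag_ideal par P f"
      using c(2) unfolding comb[OF c(1)] flag_map_eq_zero[OF csum] .
    have zero: "(\<Sum>T\<in>?F. c T * elem_cf par D T M) = 0" if "\<And>x. x \<in># M \<Longrightarrow> fst x \<le> f (snd x)" for M
      unfolding cfsum[symmetric] by (rule flag_ideal_cf[OF csum mem that])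
    obtain A where A: "finite A" "?F \<subseteq> D \<rightarrow>\<^sub>E A" using letters[OF c(1)] by auto
    then have F: "?F \<subseteq> straight_tableaux par D A" by (auto simp: straight_tableaux_def)
    have B: "finite (A \<times> snd ` D)" using A(1) fin by simp
    obtain S0 where S0: "S0 \<in> ?F" "c S0 \<noteq> 0" using ne by auto
    obtain S e where S: "S \<in> ?F" "c S \<noteq> 0" "unit_sign e"
      "(\<Sum>T\<in>?F. c T * elem_cf par D T (content D S)) = e * c S"
      using leading_coefficient[where c = c, OF assms(1) c(1) F B order_refl lessI S0] by blast
    \<comment> \<open>The leading monomial of a flagged tableau involves only generators inside the
      flags, so an element of the flag ideal has no coefficient there.\<close>
    have "(\<Sum>T\<in>?F. c T * elem_cf par D T (content D S)) = 0"
      using S(1) fin by (intro zero) (auto simp: content_def flagged_def)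
    then show False using S by (auto simp: unit_sign_def)
  qed
  moreover have "int_span (flag_ring par P f) ?I (\<lambda>T. flag_map par P f (tableau_element par P D T)) =
      flagged_super_schur par P f D"
  proof (intro equalityI subsetI)
    fix x assume "x \<in> int_span (flag_ring par P f) ?I (\<lambda>T. flag_map par P f (tableau_element par P D T))"
    then obtain c where c: "finite {T \<in> ?I. c T \<noteq> 0}" "x = ?\<pi> (\<Sum>T\<in>{T \<in> ?I. c T \<noteq> 0}. of_int (c T) * ?E T)"
      unfolding int_span_def using comb by auto
    define d where "d T = (if T \<in> ?I then c T else 0)" for T
    have F: "{T \<in> tableaux D. d T \<noteq> 0} = {T \<in> ?I. c T \<noteq> 0}" by (auto simp: d_def)
    have "(\<Sum>T\<in>{T \<in> tableaux D. d T \<noteq> 0}. of_int (d T) * ?E T) = (\<Sum>T\<in>{T \<in> ?I. c T \<noteq> 0}. of_int (c T) * ?E T)"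
      unfolding F by (rule sum.cong) (auto simp: d_def)
    then have "x = flag_map par P f (int_combination (letterplace par P) (tableaux D) (tableau_element par P D) d)"
      using c(1) comb'[of "tableaux D" d] unfolding F c(2) by simp
    moreover have "finite {T \<in> tableaux D. d T \<noteq> 0}" unfolding F by (rule c(1))
    ultimately show "x \<in> flagged_super_schur par P f D"
      unfolding flagged_super_schur_def super_schur_def int_span_def by blast
  next
    fix x assume "x \<in> flagged_super_schur par P f D"
    then obtain c where c: "finite {T \<in> tableaux D. c T \<noteq> 0}"
      "x = ?\<pi> (\<Sum>T\<in>{T \<in> tableaux D. c T \<noteq> 0}. of_int (c T) * ?E T)"
      unfolding flagged_super_schur_def super_schur_def int_span_def using comb' by auto
    let ?F = "{T \<in> tableaux D. c T \<noteq> 0}"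
    obtain A where A: "finite A" "?F \<subseteq> D \<rightarrow>\<^sub>E A" using letters[OF c(1)] by auto
    let ?S = "straight_tableaux par D A"
    have finS: "finite ?S" by (rule finite_straight_tableaux[OF fin A(1)])
    have "\<exists>d. \<forall>M. elem_cf par D T M = (\<Sum>S\<in>?S. d S * elem_cf par D S M)" if T: "T \<in> ?F" for T
    proof -
      have "T \<in> D \<rightarrow>\<^sub>E A" using A(2) T by blast
      from straight_spanning[OF assms(1,2) A(1) this] show ?thesis
        by (rule rat_span_integral[OF assms(1) A(1)]) blast
    qed
    then have "\<forall>T\<in>?F. \<exists>d. \<forall>M. elem_cf par D T M = (\<Sum>S\<in>?S. d S * elem_cf par D S M)" by (rule ballI)
    from bchoice[OF this] obtain d where
      "\<forall>T\<in>?F. \<forall>M. elem_cf par D T M = (\<Sum>S\<in>?S. d T S * elem_cf par D S M)" by (rule exE)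
    then have d: "elem_cf par D T M = (\<Sum>S\<in>?S. d T S * elem_cf par D S M)" if "T \<in> ?F" for T M
      using that by (blast dest: bspec)
    define a where "a S = (\<Sum>T\<in>?F. c T * d T S)" for S
    have eq: "cf ?s (\<Sum>T\<in>?F. of_int (c T) * ?E T) = cf ?s (\<Sum>S\<in>?S. of_int (a S) * ?E S)"
    proof
      fix M
      have "(\<Sum>T\<in>?F. c T * elem_cf par D T M) = (\<Sum>T\<in>?F. \<Sum>S\<in>?S. c T * d T S * elem_cf par D S M)"
        by (rule sum.cong) (simp_all add: d sum_distrib_left mult.assoc)
      also have "\<dots> = (\<Sum>S\<in>?S. a S * elem_cf par D S M)"
        unfolding a_def by (subst sum.swap) (simp add: sum_distrib_right)
      finally show "cf ?s (\<Sum>T\<in>?F. of_int (c T) * ?E T) M = cf ?s (\<Sum>S\<in>?S. of_int (a S) * ?E S) M"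
        unfolding cfsum .
    qed
    have x: "x = ?\<pi> (\<Sum>S\<in>?S. of_int (a S) * ?E S)"
      unfolding c(2) by (rule arg_cong[OF lp_class_eqI[OF csum csum eq]])
    define b where "b S = (if S \<in> ?S then a S else 0)" for S
    let ?G = "{S \<in> ?I. b S \<noteq> 0}"
    have GS: "?G \<subseteq> ?S" by (auto simp: b_def)
    then have finG: "finite ?G" using finS finite_subset by blast
    \<comment> \<open>The terms outside \<open>?G\<close> have zero coefficient or belong to an
      unflagged straight tableau; the latter is row-standard, so its image vanishes.\<close>
    have zero: "?\<pi> (of_int (a S) * ?E S) = \<zero>\<^bsub>flag_ring par P f\<^esub>" if S: "S \<in> ?S - ?G" for S
    proof (cases "a S = 0")
      case False
      have st: "straight par D S" "S \<in> tableaux D" using S by (auto simp: straight_tableaux_def tableaux_def PiE_iff)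
      then have "\<not> flagged f D S" using S False by (auto simp: b_def)
      then obtain r j where "(r, j) \<in> D" "f j < S (r, j)" by (auto simp: flagged_def)
      then have "lp_class par P (?E S) \<in> flag_ideal par P f"
        using st by (intro unflagged_row_vanishes[OF fin assms(5,6)]) (auto simp: straight_def)
      then have "?\<pi> (?E S) = \<zero>\<^bsub>flag_ring par P f\<^esub>" unfolding flag_map_eq_zero[OF E] .
      then have "[a S] \<cdot>\<^bsub>flag_ring par P f\<^esub> ?\<pi> (?E S) = \<zero>\<^bsub>flag_ring par P f\<^esub>" by simp
      moreover have "?\<pi> ([a S] \<cdot>\<^bsub>free_ring ?X\<^esub> ?E S) = [a S] \<cdot>\<^bsub>flag_ring par P f\<^esub> ?\<pi> (?E S)"
        using group_hom.hom_int_pow[OF g.a_group_hom, of "?E S" "a S"] E by (simp add: add_pow_def)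
      ultimately show ?thesis by (simp add: free_ring_add_pow(1)[OF E])
    qed (use g.hom_zero in simp)
    have rest: "?\<pi> (\<Sum>S\<in>F. of_int (a S) * ?E S) = \<zero>\<^bsub>flag_ring par P f\<^esub>" if "finite F" "F \<subseteq> ?S - ?G" for F
      using that
    proof (induction F)
      case (insert S F)
      have "?\<pi> (of_int (a S) * ?E S + (\<Sum>S\<in>F. of_int (a S) * ?E S)) =
          ?\<pi> (of_int (a S) * ?E S) \<oplus>\<^bsub>flag_ring par P f\<^esub> ?\<pi> (\<Sum>S\<in>F. of_int (a S) * ?E S)"
        using g.hom_add[OF cE csum] by simp
      then show ?case using insert zero[of S] by simp
    qed (use g.hom_zero in simp)
    have "(\<Sum>S\<in>?S. of_int (a S) * ?E S) = (\<Sum>S\<in>?S - ?G. of_int (a S) * ?E S) + (\<Sum>S\<in>?G. of_int (a S) * ?E S)"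
      by (rule sum.subset_diff[OF GS finS])
    then have "x = ?\<pi> (\<Sum>S\<in>?S - ?G. of_int (a S) * ?E S) \<oplus>\<^bsub>flag_ring par P f\<^esub> ?\<pi> (\<Sum>S\<in>?G. of_int (a S) * ?E S)"
      unfolding x using g.hom_add[OF csum csum] by simp
    also have "\<dots> = ?\<pi> (\<Sum>S\<in>?G. of_int (a S) * ?E S)"
      using rest[of "?S - ?G"] finS g.hom_closed[OF csum] by simp
    also have "(\<Sum>S\<in>?G. of_int (a S) * ?E S) = (\<Sum>S\<in>?G. of_int (b S) * ?E S)"
      using GS by (intro sum.cong) (auto simp: b_def)
    finally have "x = int_combination (flag_ring par P f) ?I (\<lambda>T. flag_map par P f (tableau_element par P D T)) b"
      unfolding comb[OF finG] .
    then show "x \<in> int_span (flag_ring par P f) ?I (\<lambda>T. flag_map par P f (tableau_element par P D T))"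
      unfolding int_span_def using finG by blast
  qed
  ultimately show ?thesis unfolding int_basis_def by blast
qed

end
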